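(* Let $M$ be a compact manifold and let $s$ be a slithering of $M$ around the circle $S^1$. Then the foliation $\mathcal F(s)$ of $M$ is a uniform foliation.
   Context: A manifold $M$ slithers around a manifold $N$ when there is a regular covering space $p:\tilde M\to M$ and a fibration $s:\tilde M\to N$ such that every deck transformation of $p$ takes each fiber of $s$ to a (possibly different) fiber of $s$. The structure determined by $s$ is called a slithering. The components of the images in $M$ under $p$ of the fibers of $s$ are the leaves of a foliation of $M$, denoted $\mathcal F(s)$; for $N=S^1$ it has codimension one. (One may always take $\tilde M$ to be the universal cover.) A codimension-one foliation $\mathcal F$ of a compact manifold $M$ is uniform if (1) every closed curve transverse to $\mathcal F$ is non-trivial in homotopy, and (2) for every pair of leaves $L_1,L_2$ of the lifted foliation $\tilde{\mathcal F}$ of the universal cover, each is contained in a bounded neighborhood of the other (distances being measured in the lift of a Riemannian metric on $M$). *)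

theory Defs
  imports "HOL-Analysis.Analysis"
begin

text \<open>
  Spaces are subsets of topological spaces with the subspace topology; nothing is assumed
  about the ambient type. Manifolds have no boundary.
\<close>

definition topological_manifold :: "nat \<Rightarrow> 'a::topological_space set \<Rightarrow> bool" where
  "topological_manifold n S \<longleftrightarrow>
     Hausdorff_space (top_of_set S) \<and> second_countable (top_of_set S) \<and>
     (\<forall>x\<in>S. \<exists>U. openin (top_of_set S) U \<and> x \<in> U \<and>
                 top_of_set U homeomorphic_space Euclidean_space n)"


section \<open>Smooth and Riemannian manifolds\<close>

text \<open>These notions are meant for open subsets of Euclidean spaces.\<close>

primrec Ck_on ::
  "nat \<Rightarrow> 'a::real_normed_vector set \<Rightarrow> ('a \<Rightarrow> 'b::real_normed_vector) \<Rightarrow> bool" where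
  "Ck_on 0 S f \<longleftrightarrow> continuous_on S f"
| "Ck_on (Suc k) S f \<longleftrightarrow>
     (\<forall>x\<in>S. f differentiable at x) \<and> (\<forall>v. Ck_on k S (\<lambda>x. frechet_derivative f (at x) v))"

definition smooth_on ::
  "'a::real_normed_vector set \<Rightarrow> ('a \<Rightarrow> 'b::real_normed_vector) \<Rightarrow> bool" where
  "smooth_on S f \<longleftrightarrow> (\<forall>k. Ck_on k S f)"

text \<open>
  An atlas is a family of charts \<open>\<phi> i\<close> with domains \<open>D i\<close>, indexed by \<open>i \<in> I\<close>. A chart is only
  meaningful on its domain. The dimension of the manifold is \<open>DIM('e)\<close>.
\<close>

definition transition ::
  "('i \<Rightarrow> 'a set) \<Rightarrow> ('i \<Rightarrow> 'a \<Rightarrow> 'e) \<Rightarrow> 'i \<Rightarrow> 'i \<Rightarrow> 'e \<Rightarrow> 'e" where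
  "transition D \<phi> i j = \<phi> j \<circ> inv_into (D i) (\<phi> i)"

definition smooth_manifold ::
  "'a::topological_space set \<Rightarrow> 'i set \<Rightarrow> ('i \<Rightarrow> 'a set) \<Rightarrow> ('i \<Rightarrow> 'a \<Rightarrow> 'e::euclidean_space) \<Rightarrow> bool"
where
  "smooth_manifold M I D \<phi> \<longleftrightarrow>
     Hausdorff_space (top_of_set M) \<and> second_countable (top_of_set M) \<and>
     (\<Union>i\<in>I. D i) = M \<and>
     (\<forall>i\<in>I. openin (top_of_set M) (D i) \<and> open (\<phi> i ` D i) \<and>
             (\<exists>\<psi>. homeomorphism (D i) (\<phi> i ` D i) (\<phi> i) \<psi>)) \<and>
     (\<forall>i\<in>I. \<forall>j\<in>I. smooth_on (\<phi> i ` (D i \<inter> D j)) (transition D \<phi> i j))"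

text \<open>
  A Riemannian metric is given by its coordinate expressions: \<open>g i x\<close> is the inner product on the
  tangent space at the point with coordinates \<open>x\<close> in the chart \<open>\<phi> i\<close>.
\<close>

definition riemannian_metric ::
  "'i set \<Rightarrow> ('i \<Rightarrow> 'a set) \<Rightarrow> ('i \<Rightarrow> 'a \<Rightarrow> 'e::euclidean_space) \<Rightarrow>
   ('i \<Rightarrow> 'e \<Rightarrow> 'e \<Rightarrow> 'e \<Rightarrow> real) \<Rightarrow> bool" where
  "riemannian_metric I D \<phi> g \<longleftrightarrow>
     (\<forall>i\<in>I. \<forall>x\<in>\<phi> i ` D i.
        bilinear (g i x) \<and> (\<forall>v w. g i x v w = g i x w v) \<and> (\<forall>v. v \<noteq> 0 \<longrightarrow> 0 < g i x v v)) \<and>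
     (\<forall>i\<in>I. \<forall>v w. smooth_on (\<phi> i ` D i) (\<lambda>x. g i x v w)) \<and>
     (\<forall>i\<in>I. \<forall>j\<in>I. \<forall>x\<in>\<phi> i ` (D i \<inter> D j). \<forall>v w.
        g i x v w = g j (transition D \<phi> i j x)
                        (frechet_derivative (transition D \<phi> i j) (at x) v)
                        (frechet_derivative (transition D \<phi> i j) (at x) w))"

text \<open>
  \<open>joined_by_length I D \<phi> g x y l\<close>: some piecewise \<open>C\<^sup>1\<close> curve from \<open>x\<close> to \<open>y\<close> has length \<open>l\<close>.
  Such a curve is a finite concatenation of \<open>C\<^sup>1\<close> arcs, each lying in the domain of one chart;
  \<open>u'\<close> is the coordinate velocity of such an arc \<open>c\<close>.
\<close>

inductive joined_by_length ::
  "'i set \<Rightarrow> ('i \<Rightarrow> 'a set) \<Rightarrow> ('i \<Rightarrow> 'a \<Rightarrow> 'e::euclidean_space) \<Rightarrow>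
   ('i \<Rightarrow> 'e \<Rightarrow> 'e \<Rightarrow> 'e \<Rightarrow> real) \<Rightarrow> 'a \<Rightarrow> 'a \<Rightarrow> real \<Rightarrow> bool"
  for I D \<phi> g where
  arc: "\<lbrakk>i \<in> I; c ` {0..1} \<subseteq> D i;
         \<And>t. t \<in> {0..1} \<Longrightarrow> ((\<phi> i \<circ> c) has_vector_derivative u' t) (at t within {0..1});
         continuous_on {0..1} u'\<rbrakk>
        \<Longrightarrow> joined_by_length I D \<phi> g (c 0) (c 1)
              (integral {0..1} (\<lambda>t. sqrt (g i (\<phi> i (c t)) (u' t) (u' t))))"
| join: "\<lbrakk>joined_by_length I D \<phi> g x y l; joined_by_length I D \<phi> g y z m\<rbrakk>
         \<Longrightarrow> joined_by_length I D \<phi> g x z (l + m)"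

definition riemannian_dist ::
  "'i set \<Rightarrow> ('i \<Rightarrow> 'a set) \<Rightarrow> ('i \<Rightarrow> 'a \<Rightarrow> 'e::euclidean_space) \<Rightarrow>
   ('i \<Rightarrow> 'e \<Rightarrow> 'e \<Rightarrow> 'e \<Rightarrow> real) \<Rightarrow> 'a \<Rightarrow> 'a \<Rightarrow> real" where
  "riemannian_dist I D \<phi> g x y = Inf {l. joined_by_length I D \<phi> g x y l}"

text \<open>
  The lift of an atlas and a metric along a covering map \<open>q : C \<rightarrow> M\<close>, the one that makes \<open>q\<close> a
  local isometry. Its charts are \<open>\<phi> i \<circ> q\<close> on the open sets \<open>V\<close> that \<open>q\<close> maps injectively into
  \<open>D i\<close>, and are indexed by the pairs \<open>(i, V)\<close>.
\<close>

definition lift_index ::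
  "'c::topological_space set \<Rightarrow> ('c \<Rightarrow> 'a) \<Rightarrow> 'i set \<Rightarrow> ('i \<Rightarrow> 'a set) \<Rightarrow> ('i \<times> 'c set) set" where
  "lift_index C q I D =
     {(i, V). i \<in> I \<and> openin (top_of_set C) V \<and> inj_on q V \<and> q ` V \<subseteq> D i}"

definition lift_dist ::
  "'c::topological_space set \<Rightarrow> ('c \<Rightarrow> 'a) \<Rightarrow> 'i set \<Rightarrow> ('i \<Rightarrow> 'a set) \<Rightarrow>
   ('i \<Rightarrow> 'a \<Rightarrow> 'e::euclidean_space) \<Rightarrow> ('i \<Rightarrow> 'e \<Rightarrow> 'e \<Rightarrow> 'e \<Rightarrow> real) \<Rightarrow> 'c \<Rightarrow> 'c \<Rightarrow> real" where
  "lift_dist C q I D \<phi> g =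
     riemannian_dist (lift_index C q I D) snd (\<lambda>(i, V). \<phi> i \<circ> q) (\<lambda>(i, V). g i)"


section \<open>Coverings, fibrations and slitherings\<close>

definition deck_transformations ::
  "'b::topological_space set \<Rightarrow> ('b \<Rightarrow> 'a) \<Rightarrow> ('b \<Rightarrow> 'b) set" where
  "deck_transformations E p =
     {\<tau>. (\<exists>\<tau>'. homeomorphism E E \<tau> \<tau>') \<and> (\<forall>x\<in>E. p (\<tau> x) = p x)}"

definition regular_covering ::
  "'b::topological_space set \<Rightarrow> ('b \<Rightarrow> 'a::topological_space) \<Rightarrow> 'a set \<Rightarrow> bool" where
  "regular_covering E p M \<longleftrightarrow>
     covering_space E p M \<and> connected E \<and>
     (\<forall>x\<in>E. \<forall>y\<in>E. p x = p y \<longrightarrow> (\<exists>\<tau>\<in>deck_transformations E p. \<tau> x = y))"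

definition universal_covering ::
  "'c::topological_space set \<Rightarrow> ('c \<Rightarrow> 'a::topological_space) \<Rightarrow> 'a set \<Rightarrow> bool" where
  "universal_covering C q M \<longleftrightarrow> covering_space C q M \<and> simply_connected C"

definition fiber :: "'b set \<Rightarrow> ('b \<Rightarrow> 'd) \<Rightarrow> 'd \<Rightarrow> 'b set" where
  "fiber E s y = {x \<in> E. s x = y}"

text \<open>
  Fibrations of manifolds: locally trivial bundles whose total space (of dimension \<open>n\<close>),
  base (of dimension \<open>k\<close>) and fibers are manifolds.
\<close>

definition fibration ::
  "nat \<Rightarrow> nat \<Rightarrow> 'b::topological_space set \<Rightarrow> ('b \<Rightarrow> 'd::topological_space) \<Rightarrow> 'd set \<Rightarrow> bool" where
  "fibration n k E s N \<longleftrightarrow>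
     topological_manifold n E \<and> topological_manifold k N \<and> s ` E = N \<and>
     (\<forall>y\<in>N. topological_manifold (n - k) (fiber E s y)) \<and>
     (\<forall>y\<in>N. \<exists>U h h'. openin (top_of_set N) U \<and> y \<in> U \<and>
        homeomorphism (E \<inter> s -` U) (U \<times> fiber E s y) h h' \<and>
        (\<forall>x\<in>E \<inter> s -` U. fst (h x) = s x))"

definition slithering ::
  "nat \<Rightarrow> nat \<Rightarrow> 'a::topological_space set \<Rightarrow> 'b::topological_space set \<Rightarrow> ('b \<Rightarrow> 'a) \<Rightarrow>
   ('b \<Rightarrow> 'd::topological_space) \<Rightarrow> 'd set \<Rightarrow> bool" where
  "slithering n k M E p s N \<longleftrightarrow>
     regular_covering E p M \<and> fibration n k E s N \<and>
     (\<forall>\<tau>\<in>deck_transformations E p. \<forall>y\<in>N. \<exists>z\<in>N. \<tau> ` fiber E s y = fiber E s z)"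

text \<open>
  The components of \<open>p ` fiber E s y\<close> are taken to be path components: a leaf may be dense in
  \<open>M\<close>, and then connected components for the subspace topology can merge several leaves.
  For the same reason path components are used in \<open>lifted_leaves\<close> below.
\<close>

definition slithering_foliation ::
  "'b set \<Rightarrow> ('b \<Rightarrow> 'a::topological_space) \<Rightarrow> ('b \<Rightarrow> 'd) \<Rightarrow> 'd set \<Rightarrow> 'a set set" where
  "slithering_foliation E p s N =
     (\<Union>y\<in>N. path_components_of (top_of_set (p ` fiber E s y)))"


section \<open>Foliations\<close>

text \<open>
  A foliation is identified with its set of leaves. In a foliation chart \<open>\<phi> : U \<rightarrow> \<real>\<^sup>n\<close> of a
  foliation of codimension \<open>k\<close>, the components of the intersections of leaves with \<open>U\<close> are the
  plaques on which the last \<open>k\<close> coordinates are constant.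
\<close>

definition foliation_chart ::
  "nat \<Rightarrow> nat \<Rightarrow> 'a::topological_space set \<Rightarrow> 'a set set \<Rightarrow> 'a set \<Rightarrow> ('a \<Rightarrow> nat \<Rightarrow> real) \<Rightarrow> bool" where
  "foliation_chart n k M F U \<phi> \<longleftrightarrow>
     openin (top_of_set M) U \<and> homeomorphic_map (top_of_set U) (Euclidean_space n) \<phi> \<and>
     (\<forall>L\<in>F. \<forall>P\<in>components (L \<inter> U). \<exists>c. P = {x \<in> U. \<forall>j\<in>{n-k..<n}. \<phi> x j = c j})"

definition foliation :: "nat \<Rightarrow> nat \<Rightarrow> 'a::topological_space set \<Rightarrow> 'a set set \<Rightarrow> bool" where
  "foliation n k M F \<longleftrightarrow>
     partition_on M F \<and> (\<forall>L\<in>F. path_connected L) \<and>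
     (\<forall>x\<in>M. \<exists>U \<phi>. x \<in> U \<and> foliation_chart n k M F U \<phi>)"

text \<open>
  Closed curves transverse to a foliation of codimension one: the transverse coordinate
  \<open>\<phi> _ (n - 1)\<close> of suitable foliation charts is strictly monotone along the curve, locally at every
  parameter. The loop is extended periodically by \<open>frac\<close>, so that transversality is also
  required across the base point.
\<close>

definition closed_transversal ::
  "nat \<Rightarrow> 'a::topological_space set \<Rightarrow> 'a set set \<Rightarrow> (real \<Rightarrow> 'a) \<Rightarrow> bool" where
  "closed_transversal n M F \<gamma> \<longleftrightarrow>
     path \<gamma> \<and> path_image \<gamma> \<subseteq> M \<and> pathfinish \<gamma> = pathstart \<gamma> \<and>
     (\<forall>t. \<exists>U \<phi> \<epsilon>. foliation_chart n 1 M F U \<phi> \<and> 0 < \<epsilon> \<and>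
        (\<forall>u\<in>{t-\<epsilon><..<t+\<epsilon>}. \<gamma> (frac u) \<in> U) \<and>
        (strict_mono_on {t-\<epsilon><..<t+\<epsilon>} (\<lambda>u. \<phi> (\<gamma> (frac u)) (n - 1)) \<or>
         strict_antimono_on {t-\<epsilon><..<t+\<epsilon>} (\<lambda>u. \<phi> (\<gamma> (frac u)) (n - 1))))"

definition lifted_leaves ::
  "'c::topological_space set \<Rightarrow> ('c \<Rightarrow> 'a) \<Rightarrow> 'a set set \<Rightarrow> 'c set set" where
  "lifted_leaves C q F = (\<Union>L\<in>F. path_components_of (top_of_set (C \<inter> q -` L)))"

text \<open>
  Uniformity of a codimension-one foliation \<open>F\<close> of a compact manifold \<open>M\<close> with smooth atlas
  \<open>(I, D, \<phi>)\<close> and universal covering \<open>q : C \<rightarrow> M\<close>. Since \<open>M\<close> is compact, the last condition does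
  not depend on the Riemannian metric; it is required for all of them.
\<close>

definition uniform_foliation ::
  "'a::topological_space set \<Rightarrow> 'i set \<Rightarrow> ('i \<Rightarrow> 'a set) \<Rightarrow> ('i \<Rightarrow> 'a \<Rightarrow> 'e::euclidean_space) \<Rightarrow>
   'c::topological_space set \<Rightarrow> ('c \<Rightarrow> 'a) \<Rightarrow> 'a set set \<Rightarrow> bool" where
  "uniform_foliation M I D \<phi> C q F \<longleftrightarrow>
     foliation DIM('e) 1 M F \<and>
     (\<forall>\<gamma>. closed_transversal DIM('e) M F \<gamma> \<longrightarrow> \<not> (\<exists>a. homotopic_loops M \<gamma> (\<lambda>_. a))) \<and>
     (\<forall>g. riemannian_metric I D \<phi> g \<longrightarrow>
        (\<forall>L1\<in>lifted_leaves C q F. \<forall>L2\<in>lifted_leaves C q F.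
           \<exists>r. \<forall>x\<in>L1. \<exists>y\<in>L2. lift_dist C q I D \<phi> g x y < r))"

end

theory Submission
  imports Defs "HOL-Homology.Invariance_of_Domain"
begin

text \<open>
  Lift the slithering to \<open>r : C \<rightarrow> E\<close> with \<open>p \<circ> r = q\<close>, and its angle to \<open>\<theta> : C \<rightarrow> \<real>\<close> with
  \<open>s \<circ> r = cis \<circ> \<theta>\<close>. The map \<open>\<theta>\<close> is open and onto with path connected level sets, which are the
  leaves of the lifted foliation. A closed transversal that is null homotopic in \<open>M\<close> lifts to a closed
  curve in \<open>C\<close>, along which \<open>\<theta>\<close> is strictly monotone, a contradiction. A deck transformation of \<open>C\<close>
  permutes the level sets of \<open>\<theta>\<close>, and levels at most a full turn apart go to levels at most a full turn
  apart. Hence the distance needed to change \<open>\<theta>\<close> by at most a full turn, which is locally bounded, is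
  bounded on \<open>C\<close> because \<open>M\<close> is compact, and iteration bounds the distance between any two levels.
\<close>

section \<open>Covering maps of general topological spaces\<close>

text \<open>\<open>fibration\<close> includes no smoothness, so no flow transverse to the levels of
  \<open>\<theta>\<close> is at hand. The only way to move in the direction of the angle is a local
  trivialisation, which works near one angle at a time; this forces the small steps. A deck
  transformation \<open>\<delta>\<close> of \<open>C\<close> covers some \<open>\<tau>\<close> on
  \<open>E\<close>, with \<open>\<tau> \<circ> r = r \<circ> \<delta>\<close>, and so respects
  fibers, but the map it induces on angles is merely continuous. The bound by a full turn survives
  because it can be phrased with fibers alone: distinct levels less than a full turn apart lie over
  distinct points of the circle. So compactness of \<open>M\<close> is applied to steps of one turn,
  and to lengths rather than angles. The foliation is known only through its leaves, which may be
  dense, and a closed transversal may use any foliation chart. The transverse coordinate of such a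
  chart is compared with \<open>\<theta>\<close> by topology alone: countability keeps each plaque
  inside one level, and openness of \<open>\<theta>\<close> gives nearby plaques different
  angles.\<close>

lemma path_connected_obtain:
  assumes "path_connected S" "x \<in> S" "y \<in> S"
  obtains g where "path g" "path_image g \<subseteq> S" "g 0 = x" "g 1 = y"
  using bspec[OF bspec[OF iffD1[OF path_connected_def assms(1)] assms(2)] assms(3)]
  by (auto simp: pathstart_def pathfinish_def)

lemma continuous_on_open_cover:
  assumes "\<And>x. x \<in> S \<Longrightarrow> \<exists>W. openin (top_of_set S) W \<and> x \<in> W \<and> continuous_on W f"
  shows "continuous_on S f"
  unfolding continuous_on_def
proof (intro ballI)
  fix x assume "x \<in> S"
  then obtain W where W: "openin (top_of_set S) W" "x \<in> W" "continuous_on W f" using assms by blast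
  obtain T where T: "open T" "W = S \<inter> T" using W(1) by (meson openin_open)
  have "at x within W = at x within S" using T W(2) by (intro at_within_nhd[of x T]) auto
  then show "(f \<longlongrightarrow> f x) (at x within S)" using W by (metis continuous_on_def)
qed

lemma openin_preimage:
  assumes "continuous_on S f" "f ` S \<subseteq> T" "openin (top_of_set T) U"
  shows "openin (top_of_set S) (S \<inter> f -` U)"
  using assms by (intro continuous_openin_preimage) auto

text \<open>The set where the lifts agree is open because \<open>p\<close> is injective near each
  point of \<open>E\<close>, and its complement is open because two distinct points over the same
  point lie in disjoint sheets.\<close>

lemma covering_lift_unique:
  fixes p :: "'a::topological_space \<Rightarrow> 'b::topological_space" and g h :: "'c::topological_space \<Rightarrow> 'a"
  assumes cov: "covering_space E p M" and Y: "connected Y"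
    and g: "continuous_on Y g" "g ` Y \<subseteq> E" and h: "continuous_on Y h" "h ` Y \<subseteq> E"
    and eq: "\<And>y. y \<in> Y \<Longrightarrow> p (g y) = p (h y)"
    and a: "a \<in> Y" "g a = h a" and y: "y \<in> Y"
  shows "g y = h y"
proof -
  define A where "A = {y \<in> Y. g y = h y}"
  have 1: "openin (top_of_set Y) A"
  proof (subst openin_subopen, intro ballI)
    fix z assume z: "z \<in> A"
    then have "g z \<in> E" using g A_def by auto
    then obtain V T k where V: "g z \<in> V" "openin (top_of_set E) V" and k: "homeomorphism V T p k"
      using covering_space_local_homeomorphism[OF cov] by metis
    have inj: "inj_on p V"
      using k by (metis homeomorphism_apply1 inj_on_inverseI)
    have "openin (top_of_set Y) (Y \<inter> g -` V \<inter> (Y \<inter> h -` V))"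
      by (rule openin_Int; rule openin_preimage; use g h V in blast)
    moreover have "z \<in> Y \<inter> g -` V \<inter> (Y \<inter> h -` V)" using z V by (auto simp: A_def)
    moreover have "Y \<inter> g -` V \<inter> (Y \<inter> h -` V) \<subseteq> A"
      using inj eq by (auto simp: A_def inj_on_def)
    ultimately show "\<exists>T. openin (top_of_set Y) T \<and> z \<in> T \<and> T \<subseteq> A" by blast
  qed
  have 2: "openin (top_of_set Y) (Y - A)"
  proof (subst openin_subopen, intro ballI)
    fix z assume z: "z \<in> Y - A"
    then have ge: "g z \<in> E" "h z \<in> E" and ne: "g z \<noteq> h z" and pe: "p (g z) = p (h z)" and zY: "z \<in> Y"
      using g h eq by (auto simp: A_def)
    have "p (g z) \<in> M" using cov ge by (auto simp: covering_space_def)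
    then obtain T v where T: "p (g z) \<in> T" and v: "\<Union>v = E \<inter> p -` T" "\<And>u. u \<in> v \<Longrightarrow> openin (top_of_set E) u"
        "pairwise disjnt v" "\<And>u. u \<in> v \<Longrightarrow> \<exists>q. homeomorphism u T p q"
      using cov unfolding covering_space_def by metis
    obtain u1 u2 where u: "u1 \<in> v" "u2 \<in> v" "g z \<in> u1" "h z \<in> u2"
      using v(1) ge T pe by (metis IntI UnionE vimageI)
    have "u1 \<noteq> u2"
    proof
      assume "u1 = u2"
      with u v(4)[of u1] pe ne show False by (metis homeomorphism_apply1)
    qed
    then have dis: "u1 \<inter> u2 = {}" using v(3) u by (auto simp: pairwise_def disjnt_def)
    have "openin (top_of_set Y) (Y \<inter> g -` u1 \<inter> (Y \<inter> h -` u2))"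
      by (rule openin_Int; rule openin_preimage; use g h v(2) u in blast)
    moreover have "z \<in> Y \<inter> g -` u1 \<inter> (Y \<inter> h -` u2)" using zY u by auto
    moreover have "Y \<inter> g -` u1 \<inter> (Y \<inter> h -` u2) \<subseteq> Y - A" using dis by (auto simp: A_def)
    ultimately show "\<exists>T. openin (top_of_set Y) T \<and> z \<in> T \<and> T \<subseteq> Y - A" by blast
  qed
  have "closedin (top_of_set Y) A"
    using 1 2 by (simp add: closedin_def A_def)
  with 1 Y have "A = {} \<or> A = Y" by (simp add: connected_clopen)
  with a y show ?thesis by (auto simp: A_def)
qed

lemma covering_open_map:
  fixes p :: "'a::topological_space \<Rightarrow> 'b::topological_space"
  assumes cov: "covering_space E p M" and W: "openin (top_of_set E) W"
  shows "openin (top_of_set M) (p ` W)"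
proof (subst openin_subopen, intro ballI)
  fix x assume "x \<in> p ` W"
  then obtain e where e: "e \<in> W" "x = p e" by auto
  then have "e \<in> E" using W openin_imp_subset by blast
  then obtain V T k where V: "e \<in> V" "openin (top_of_set E) V" and T: "openin (top_of_set M) T"
      and k: "homeomorphism V T p k"
    using covering_space_local_homeomorphism[OF cov] by metis
  have "openin (top_of_set V) (V \<inter> W)"
    using W V by (metis Int_commute inf.absorb_iff1 openin_imp_subset openin_subtopology_Int2 subtopology_subtopology)
  then have "openin (top_of_set T) (p ` (V \<inter> W))"
    using homeomorphism_imp_open_map[OF k] by blast
  then have "openin (top_of_set M) (p ` (V \<inter> W))" using T openin_trans by blast
  then show "\<exists>T. openin (top_of_set M) T \<and> x \<in> T \<and> T \<subseteq> p ` W" using e V by blast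
qed

section \<open>Lifting of rectangles and paths through a covering\<close>

text \<open>The initial value may be prescribed at any point \<open>z\<close> of \<open>A\<close>
  instead of at one base point. That is what allows two liftable sets to be glued starting from
  either side.\<close>

definition liftable :: "'a::topological_space set \<Rightarrow> ('a \<Rightarrow> 'b) \<Rightarrow> ('c::topological_space \<Rightarrow> 'b) \<Rightarrow> 'c set \<Rightarrow> bool" where
  "liftable E p f A \<longleftrightarrow> (\<forall>z\<in>A. \<forall>e\<in>E. p e = f z \<longrightarrow>
     (\<exists>g. continuous_on A g \<and> g ` A \<subseteq> E \<and> (\<forall>x\<in>A. p (g x) = f x) \<and> g z = e))"

text \<open>The lift on \<open>A\<close> supplies the initial value at \<open>w\<close> for the lift
  on \<open>B\<close>. By uniqueness the two agree on the connected overlap, and closedness allows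
  pasting.\<close>

lemma liftable_Un_aux:
  fixes p :: "'a::topological_space \<Rightarrow> 'b::topological_space" and f :: "'c::topological_space \<Rightarrow> 'b"
  assumes cov: "covering_space E p M" and A: "liftable E p f A" and B: "liftable E p f B"
    and cl: "closed A" "closed B" and con: "connected (A \<inter> B)" and w: "w \<in> A \<inter> B"
    and z: "z \<in> A" "e \<in> E" "p e = f z"
  shows "\<exists>g. continuous_on (A \<union> B) g \<and> g ` (A \<union> B) \<subseteq> E \<and> (\<forall>x\<in>A \<union> B. p (g x) = f x) \<and> g z = e"
proof -
  obtain g where g: "continuous_on A g" "g ` A \<subseteq> E" "\<forall>x\<in>A. p (g x) = f x" "g z = e"
    using A z unfolding liftable_def by metis
  obtain h where h: "continuous_on B h" "h ` B \<subseteq> E" "\<forall>x\<in>B. p (h x) = f x" "h w = g w"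
    using B w g unfolding liftable_def by (metis IntD1 IntD2 image_subset_iff)
  have eq: "g y = h y" if "y \<in> A \<inter> B" for y
    by (rule covering_lift_unique[OF cov con, of g h w])
      (use g h w that in \<open>auto intro: continuous_on_subset\<close>)
  define k where "k = (\<lambda>x. if x \<in> A then g x else h x)"
  have "continuous_on (A \<union> B) k"
    unfolding k_def using cl g h eq by (intro continuous_on_cases) auto
  moreover have "k ` (A \<union> B) \<subseteq> E" "\<forall>x\<in>A \<union> B. p (k x) = f x" "k z = e"
    using g h z by (auto simp: k_def)
  ultimately show ?thesis by blast
qed

lemma liftable_Un:
  fixes p :: "'a::topological_space \<Rightarrow> 'b::topological_space" and f :: "'c::topological_space \<Rightarrow> 'b"
  assumes cov: "covering_space E p M" and A: "liftable E p f A" and B: "liftable E p f B"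
    and cl: "closed A" "closed B" and con: "connected (A \<inter> B)" and w: "A \<inter> B \<noteq> {}"
  shows "liftable E p f (A \<union> B)"
  unfolding liftable_def
proof (intro ballI impI)
  fix z e assume "z \<in> A \<union> B" and e: "e \<in> E" "p e = f z"
  then consider "z \<in> A" | "z \<in> B" by blast
  then show "\<exists>g. continuous_on (A \<union> B) g \<and> g ` (A \<union> B) \<subseteq> E \<and> (\<forall>x\<in>A \<union> B. p (g x) = f x) \<and> g z = e"
  proof cases
    case 1
    then show ?thesis using liftable_Un_aux[OF cov A B cl con] w e by auto
  next
    case 2
    then show ?thesis
      using liftable_Un_aux[OF cov B A cl(2,1)] con w e by (auto simp: Int_commute Un_commute)
  qed
qed

text \<open>Over an evenly covered set the local inverse on the sheet through \<open>e\<close> lifts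
  every subset at once, connected or not.\<close>

lemma liftable_local:
  fixes p :: "'a::topological_space \<Rightarrow> 'b::topological_space" and f :: "'c::topological_space \<Rightarrow> 'b"
  assumes cov: "covering_space E p M" and f: "continuous_on UNIV f" "range f \<subseteq> M"
  obtains U where "open U" "x \<in> U" "\<And>A. A \<subseteq> U \<Longrightarrow> liftable E p f A"
proof -
  have "f x \<in> M" using f by auto
  then obtain T v where T: "f x \<in> T" "openin (top_of_set M) T"
    and v: "\<Union>v = E \<inter> p -` T" "\<And>u. u \<in> v \<Longrightarrow> openin (top_of_set E) u"
        "\<And>u. u \<in> v \<Longrightarrow> \<exists>q. homeomorphism u T p q"
    using cov unfolding covering_space_def by metis
  have "openin (top_of_set UNIV) (UNIV \<inter> f -` T)"
    using f T by (intro continuous_openin_preimage) auto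
  then have "open (f -` T)" by simp
  moreover have "liftable E p f A" if "A \<subseteq> f -` T" for A
    unfolding liftable_def
  proof (intro ballI impI)
    fix z e assume z: "z \<in> A" "e \<in> E" "p e = f z"
    then have "e \<in> \<Union>v" using v(1) that by auto
    then obtain u where u: "e \<in> u" "u \<in> v" by auto
    then obtain k where k: "homeomorphism u T p k" using v by blast
    have 1: "continuous_on A (k \<circ> f)"
      using f that homeomorphism_cont2[OF k]
      by (intro continuous_on_compose) (auto intro: continuous_on_subset)
    have uE: "u \<subseteq> E" using v(2) u openin_imp_subset by blast
    have 2: "(k \<circ> f) ` A \<subseteq> E" using that uE homeomorphism_image2[OF k] by auto
    have 3: "\<forall>x\<in>A. p ((k \<circ> f) x) = f x" using that homeomorphism_apply2[OF k] by auto
    have 4: "(k \<circ> f) z = e" using z u homeomorphism_apply1[OF k] by (metis comp_apply)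
    show "\<exists>g. continuous_on A g \<and> g ` A \<subseteq> E \<and> (\<forall>x\<in>A. p (g x) = f x) \<and> g z = e"
      using 1 2 3 4 by blast
  qed
  ultimately show ?thesis using that T by blast
qed

text \<open>Two nested bisections: adjacent rectangles meet in a segment, which is connected, so
  they can be glued. The map is defined on the whole plane so that boundary points need no separate
  treatment.\<close>

lemma liftable_rectangle:
  fixes p :: "'a::topological_space \<Rightarrow> 'b::topological_space" and f :: "real \<times> real \<Rightarrow> 'b"
  assumes cov: "covering_space E p M" and f: "continuous_on UNIV f" "range f \<subseteq> M"
    and "a \<le> b" "c \<le> d"
  shows "liftable E p f ({a..b} \<times> {c..d})"
  using \<open>a \<le> b\<close>
proof (induction rule: Bolzano)
  case (trans a b b')
  have eq: "{a..b} \<times> {c..d} \<union> {b..b'} \<times> {c..d} = {a..b'} \<times> {c..d}"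
    "{a..b} \<times> {c..d} \<inter> {b..b'} \<times> {c..d} = {b} \<times> {c..d}"
    using trans by auto
  have "connected ({b} \<times> {c..d})" by (intro connected_Times) auto
  then show ?case
    using liftable_Un[OF cov trans(1,2)] eq \<open>c \<le> d\<close> by (simp add: closed_Times)
next
  case (local x)
  \<comment> \<open>The local step in the first coordinate asks for a width about \<open>x\<close>
    below which all strips of full height are liftable. The inner bisection runs over the height and
    takes the smaller width when stacking.\<close>
  have "\<exists>\<delta>>0. \<forall>a b. a \<le> x \<and> x \<le> b \<and> b - a < \<delta> \<longrightarrow> liftable E p f ({a..b} \<times> {c..d})"
    using \<open>c \<le> d\<close>
  proof (induction rule: Bolzano)
    case (trans c d d')
    obtain \<delta>1 \<delta>2 where \<delta>: "\<delta>1 > 0" "\<delta>2 > 0"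
      "\<And>a b. a \<le> x \<and> x \<le> b \<and> b - a < \<delta>1 \<Longrightarrow> liftable E p f ({a..b} \<times> {c..d})"
      "\<And>a b. a \<le> x \<and> x \<le> b \<and> b - a < \<delta>2 \<Longrightarrow> liftable E p f ({a..b} \<times> {d..d'})"
      using trans(1,2) by meson
    have "liftable E p f ({a..b} \<times> {c..d'})" if "a \<le> x" "x \<le> b" "b - a < min \<delta>1 \<delta>2" for a b
    proof -
      have eq: "{a..b} \<times> {c..d} \<union> {a..b} \<times> {d..d'} = {a..b} \<times> {c..d'}"
        "{a..b} \<times> {c..d} \<inter> {a..b} \<times> {d..d'} = {a..b} \<times> {d}"
        using trans by auto
      have "connected ({a..b} \<times> {d})" by (intro connected_Times) auto
      then show ?thesis
        using liftable_Un[OF cov \<delta>(3,4)[of a b]] eq that by (simp add: closed_Times)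
    qed
    then show ?case using \<delta>(1,2) by (intro exI[of _ "min \<delta>1 \<delta>2"]) auto
  next
    case (local y)
    obtain U where U: "open U" "(x, y) \<in> U" "\<And>A. A \<subseteq> U \<Longrightarrow> liftable E p f A"
      using liftable_local[OF cov f, of "(x, y)"] by blast
    obtain S T where ST: "open S" "open T" "x \<in> S" "y \<in> T" "S \<times> T \<subseteq> U"
      using U(1,2) by (metis open_prod_def mem_Sigma_iff)
    obtain d1 d2 where d: "d1 > 0" "d2 > 0" "ball x d1 \<subseteq> S" "ball y d2 \<subseteq> T"
      using ST by (meson open_contains_ball)
    have "liftable E p f ({a..b} \<times> {c..d})"
      if "a \<le> x" "x \<le> b" "b - a < d1" "c \<le> y" "y \<le> d" "d - c < d2" for a b c d
    proof -
      have "{a..b} \<subseteq> ball x d1" "{c..d} \<subseteq> ball y d2"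
        using that by (auto simp: dist_real_def)
      then show ?thesis using U(3) ST d by (meson Sigma_mono order_trans)
    qed
    then show ?case using d(1,2) by (intro exI[of _ d2]) (auto intro!: exI[of _ d1])
  qed
  then show ?case by blast
qed

lemma covering_square_lift:
  fixes p :: "'a::topological_space \<Rightarrow> 'b::topological_space" and f :: "real \<times> real \<Rightarrow> 'b"
  assumes cov: "covering_space E p M"
    and f: "continuous_on ({0..1} \<times> {0..1}) f" "f ` ({0..1} \<times> {0..1}) \<subseteq> M"
    and z: "z \<in> {0..1} \<times> {0..1}" "e \<in> E" "p e = f z"
  obtains g where "continuous_on ({0..1} \<times> {0..1}) g" "g ` ({0..1} \<times> {0..1}) \<subseteq> E"
    "\<And>x. x \<in> {0..1} \<times> {0..1} \<Longrightarrow> p (g x) = f x" "g z = e"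
proof -
  \<comment> \<open>Clamping retracts the plane onto the unit square and thereby extends
    \<open>f\<close> to the whole plane.\<close>
  define c :: "real \<times> real \<Rightarrow> real \<times> real" where "c = (\<lambda>(x, y). (max 0 (min 1 x), max 0 (min 1 y)))"
  have c: "continuous_on UNIV c" "range c \<subseteq> {0..1} \<times> {0..1}"
    unfolding c_def case_prod_unfold by (auto intro!: continuous_intros)
  have cid: "c x = x" if "x \<in> {0..1} \<times> {0..1}" for x using that by (auto simp: c_def)
  have "continuous_on UNIV (f \<circ> c)"
    by (rule continuous_on_compose[OF c(1) continuous_on_subset[OF f(1) c(2)]])
  moreover have "range (f \<circ> c) \<subseteq> M" using c(2) f(2) by fastforce
  ultimately  have "liftable E p (f \<circ> c) ({0..1} \<times> {0..1})"
    by (intro liftable_rectangle[OF cov]) auto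
  then obtain g where "continuous_on ({0..1} \<times> {0..1}) g" "g ` ({0..1} \<times> {0..1}) \<subseteq> E"
    "\<forall>x\<in>{0..1} \<times> {0..1}. p (g x) = (f \<circ> c) x" "g z = e"
    using z(1,2) z(3)[folded cid[OF z(1), THEN arg_cong[of _ _ f]]] unfolding liftable_def comp_def by blast
  then show ?thesis using that cid by (metis comp_apply)
qed

lemma covering_path_lift:
  fixes p :: "'a::topological_space \<Rightarrow> 'b::topological_space"
  assumes cov: "covering_space E p M" and f: "path f" "path_image f \<subseteq> M"
    and z: "t \<in> {0..1}" "e \<in> E" "p e = f t"
  obtains g where "path g" "path_image g \<subseteq> E" "\<And>x. x \<in> {0..1} \<Longrightarrow> p (g x) = f x" "g t = e"
proof -
  \<comment> \<open>A path is treated as a square that is constant in the second coordinate.\<close>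
  have "continuous_on ({0..1} \<times> {0..1}) (f \<circ> (fst :: real \<times> real \<Rightarrow> real))"
    using f by (intro continuous_on_compose continuous_intros) (auto simp: path_def intro: continuous_on_subset)
  moreover have "(f \<circ> fst) ` ({0..1} \<times> {0..1 :: real}) \<subseteq> M" using f by (auto simp: path_image_def)
  ultimately obtain g where g: "continuous_on ({0..1} \<times> {0..1}) g" "g ` ({0..1} \<times> {0..1 :: real}) \<subseteq> E"
    "\<And>x. x \<in> {0..1} \<times> {0..1 :: real} \<Longrightarrow> p (g x) = (f \<circ> fst) x" "g (t, 0) = e"
    using covering_square_lift[OF cov, of "f \<circ> fst" "(t, 0)" e] z by auto
  have "path (\<lambda>x. g (x, 0))"
    unfolding path_def by (rule continuous_on_compose2[OF g(1)]) (auto intro!: continuous_intros)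
  moreover have "path_image (\<lambda>x. g (x, 0)) \<subseteq> E" using g(2) by (auto simp: path_image_def)
  ultimately show ?thesis
    using that[of "\<lambda>x. g (x, 0)"] g(3,4) by auto
qed

section \<open>Monodromy and the lifting criterion\<close>

text \<open>The first coordinate of \<open>h\<close> is the homotopy parameter, the second runs
  along the loop. Of the four sides of the lifted square, one is \<open>g\<close>, the opposite one
  is constant, and the other two lift the same track of the base point.\<close>

lemma null_homotopic_lift_closed:
  fixes p :: "'a::topological_space \<Rightarrow> 'b::topological_space"
  assumes cov: "covering_space E p M" and hom: "homotopic_loops M \<gamma> (\<lambda>_. a)"
    and g: "path g" "path_image g \<subseteq> E" "\<And>t. t \<in> {0..1} \<Longrightarrow> p (g t) = \<gamma> t"
  shows "g 0 = g 1"
proof -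
  obtain h where h: "continuous_on ({0..1::real} \<times> {0..1}) h" "h ` ({0..1} \<times> {0..1}) \<subseteq> M"
      "\<And>x. x \<in> {0..1} \<Longrightarrow> h (0, x) = \<gamma> x" "\<And>x. x \<in> {0..1} \<Longrightarrow> h (1, x) = a"
      "\<And>t. t \<in> {0..1} \<Longrightarrow> h (t, 1) = h (t, 0)"
    using hom unfolding homotopic_loops pathfinish_def pathstart_def image_subset_iff_funcset comp_def by blast
  have z: "(0, 0) \<in> {0..1 :: real} \<times> {0..1 :: real}" "g 0 \<in> E" "p (g 0) = h (0, 0)"
    using g(2,3) h(3)[of 0] by (auto simp: path_image_def)
  obtain k where k: "continuous_on ({0..1} \<times> {0..1}) k" "k ` ({0..1} \<times> {0..1}) \<subseteq> E"
      "\<And>x. x \<in> {0..1} \<times> {0..1} \<Longrightarrow> p (k x) = h x" "k (0, 0) = g 0"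
    using covering_square_lift[OF cov h(1,2) z] by metis
  have side: "continuous_on {0..1} (\<lambda>x. k (u x, v x))"
    if "continuous_on {0..1} u" "continuous_on {0..1} v" "\<And>x. x \<in> {0..1} \<Longrightarrow> u x \<in> {0..1}"
      "\<And>x. x \<in> {0..1} \<Longrightarrow> v x \<in> {0..1}" for u v :: "real \<Rightarrow> real"
    by (rule continuous_on_compose2[OF k(1) continuous_on_Pair[OF that(1,2)]]) (use that(3,4) in blast)
  have con: "connected {0..1 :: real}" by simp
  have "k (0, 1) = g 1"
    by (rule covering_lift_unique[OF cov con, of "\<lambda>x. k (0, x)" g 0 1])
      (use side[of "\<lambda>_. 0" "\<lambda>x. x"] k g h in \<open>auto simp: path_def path_image_def\<close>)
  moreover have "k (1, 1) = k (1, 0)"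
    by (rule covering_lift_unique[OF cov con, of "\<lambda>x. k (1, x)" "\<lambda>x. k (1, 0)" 0 1])
      (use side[of "\<lambda>_. 1" "\<lambda>x. x"] k h in \<open>auto simp: path_def path_image_def\<close>)
  \<comment> \<open>The two lifted tracks are compared at parameter 1, the end where they are
    already known to meet.\<close>
  moreover have "k (0, 1) = k (0, 0)"
    by (rule covering_lift_unique[OF cov con, of "\<lambda>x. k (x, 1)" "\<lambda>x. k (x, 0)" 1 0])
      (use side[of "\<lambda>x. x" "\<lambda>_. 1"] side[of "\<lambda>x. x" "\<lambda>_. 0"] k h calculation(2) in \<open>auto simp: path_def path_image_def\<close>)
  ultimately show ?thesis using k by simp
qed

text \<open>The track of the base point under a free homotopy from the constant loop at
  \<open>x\<close> to the one at \<open>y\<close> is the desired path.\<close>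

lemma simply_connected_path_connected:
  assumes "simply_connected (S :: 'a::topological_space set)"
  shows "path_connected S"
  unfolding path_connected_def
proof (intro ballI)
  fix x y assume xy: "x \<in> S" "y \<in> S"
  have c: "path (\<lambda>_::real. z)" "path_image (\<lambda>_::real. z) = {z}" for z :: 'a
    by (auto simp: path_def path_image_def)
  have "homotopic_loops S (\<lambda>_. x) (\<lambda>_. y)"
    using assms xy c unfolding simply_connected_def by (simp add: pathfinish_def pathstart_def)
  then obtain h where h: "continuous_on ({0..1::real} \<times> {0..1::real}) h" "h ` ({0..1} \<times> {0..1}) \<subseteq> S"
      "\<And>t. t \<in> {0..1} \<Longrightarrow> h (0, t) = x" "\<And>t. t \<in> {0..1} \<Longrightarrow> h (1, t) = y"
    unfolding homotopic_loops by blast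
  have "path (\<lambda>t. h (t, 0))"
    unfolding path_def by (rule continuous_on_compose2[OF h(1)]) (auto intro!: continuous_intros)
  then show "\<exists>g. path g \<and> path_image g \<subseteq> S \<and> pathstart g = x \<and> pathfinish g = y"
    using h(2-4) by (intro exI[of _ "\<lambda>t. h (t, 0)"]) (auto simp: path_image_def pathstart_def pathfinish_def)
qed

text \<open>\<open>ends y e\<close> says that some path from \<open>y0\<close> to \<open>y\<close>
  has a lift from \<open>e0\<close> to \<open>e\<close>. Simple connectedness makes \<open>e\<close>
  unique, and local path connectedness makes the resulting map continuous.\<close>

lemma covering_lift:
  fixes p :: "'a::topological_space \<Rightarrow> 'b::topological_space" and f :: "'c::topological_space \<Rightarrow> 'b"
  assumes cov: "covering_space E p M" and Y: "simply_connected Y"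
    and loc: "\<And>O' y. openin (top_of_set Y) O' \<Longrightarrow> y \<in> O' \<Longrightarrow>
               \<exists>V. openin (top_of_set Y) V \<and> y \<in> V \<and> V \<subseteq> O' \<and> path_connected V"
    and f: "continuous_on Y f" "f ` Y \<subseteq> M" and y0: "y0 \<in> Y" and e0: "e0 \<in> E" "p e0 = f y0"
  obtains F where "continuous_on Y F" "F ` Y \<subseteq> E" "\<And>y. y \<in> Y \<Longrightarrow> p (F y) = f y" "F y0 = e0"
proof -
  define ends where "ends y e \<longleftrightarrow> (\<exists>g h. path g \<and> path_image g \<subseteq> Y \<and> g 0 = y0 \<and> g 1 = y \<and>
      path h \<and> path_image h \<subseteq> E \<and> (\<forall>t\<in>{0..1}. p (h t) = f (g t)) \<and> h 0 = e0 \<and> h 1 = e)" for y e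
  have ex: "\<exists>e. ends y e" if "y \<in> Y" for y
  proof -
    obtain g where g: "path g" "path_image g \<subseteq> Y" "g 0 = y0" "g 1 = y"
      using path_connected_obtain[OF simply_connected_path_connected[OF Y] y0 \<open>y \<in> Y\<close>] by metis
    have "path (f \<circ> g)" using g f by (auto intro!: path_continuous_image intro: continuous_on_subset)
    moreover have "path_image (f \<circ> g) \<subseteq> M" using g f by (auto simp: path_image_def)
    ultimately obtain h where "path h" "path_image h \<subseteq> E" "\<And>x. x \<in> {0..1} \<Longrightarrow> p (h x) = (f \<circ> g) x" "h 0 = e0"
      using covering_path_lift[OF cov, of "f \<circ> g" 0 e0] g e0 by auto
    then show ?thesis unfolding ends_def using g
      by (intro exI[of _ "h 1"] exI[of _ g] exI[of _ h]) auto
  qed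
  have ends_E: "e \<in> E" "p e = f y" if "ends y e" for y e
    using that unfolding ends_def path_image_def by force+
  have uniq: "e = e'" if ends1: "ends y e" and ends2: "ends y e'" for y e e'
  proof -
    obtain g h where g: "path g" "path_image g \<subseteq> Y" "g 0 = y0" "g 1 = y"
      and h: "path h" "path_image h \<subseteq> E" "\<And>t. t \<in> {0..1} \<Longrightarrow> p (h t) = f (g t)" "h 0 = e0" "h 1 = e"
      using ends1 unfolding ends_def by metis
    obtain g' h' where g': "path g'" "path_image g' \<subseteq> Y" "g' 0 = y0" "g' 1 = y"
      and h': "path h'" "path_image h' \<subseteq> E" "\<And>t. t \<in> {0..1} \<Longrightarrow> p (h' t) = f (g' t)" "h' 0 = e0" "h' 1 = e'"
      using ends2 unfolding ends_def by metis
    \<comment> \<open>The loop starts at \<open>y\<close>, goes back to \<open>y0\<close> and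
      returns to \<open>y\<close>, so its lift runs from \<open>e\<close> through \<open>e0\<close>
      to \<open>e'\<close>.\<close>
    define \<gamma> where "\<gamma> = reversepath g +++ g'"
    have jg: "pathfinish (reversepath g) = pathstart g'" using g g' by (simp add: pathstart_def)
    have \<gamma>: "path \<gamma>" unfolding \<gamma>_def using g g' jg by simp
    have \<gamma>2: "path_image \<gamma> \<subseteq> Y" unfolding \<gamma>_def using g g' by (simp add: subset_path_image_join)
    have \<gamma>3: "pathfinish \<gamma> = pathstart \<gamma>" unfolding \<gamma>_def using g g' by (simp add: pathfinish_def joinpaths_def reversepath_def pathstart_def)
    have yY: "y \<in> Y" using g by (auto simp: path_image_def)
    then have "homotopic_loops Y \<gamma> (\<lambda>_. y)"
      by (intro simply_connected_def[THEN meta_eq_to_obj_eq, THEN iffD1, OF Y, rule_format])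
         (use \<gamma> \<gamma>2 \<gamma>3 in \<open>auto simp: path_def path_image_def pathstart_def pathfinish_def\<close>)
    then have hom: "homotopic_loops M (f \<circ> \<gamma>) (\<lambda>_. f y)"
      using homotopic_loops_continuous_image[of Y \<gamma> "\<lambda>_. y" f M] f by (auto simp: o_def)
    define k where "k = reversepath h +++ h'"
    have j: "pathfinish (reversepath h) = pathstart h'" using h h' by (simp add: pathstart_def)
    have k: "path k" using h h' j unfolding k_def by (simp add: path_join)
    have k2: "path_image k \<subseteq> E" using h h' unfolding k_def by (simp add: subset_path_image_join)
    have k3: "p (k t) = (f \<circ> \<gamma>) t" if "t \<in> {0..1}" for t
      using that h h' by (auto simp: k_def \<gamma>_def joinpaths_def reversepath_def)
    have "k 0 = k 1" by (rule null_homotopic_lift_closed[OF cov hom k k2 k3])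
    then show ?thesis using h h' by (simp add: k_def joinpaths_def reversepath_def)
  qed
  define F where "F y = (THE e. ends y e)" for y
  have F: "ends y (F y)" if "y \<in> Y" for y
    unfolding F_def using ex[OF that] uniq by (metis theI')
  have "continuous_on Y F"
  proof (rule continuous_on_open_cover)
    fix y assume y: "y \<in> Y"
    have Fy: "F y \<in> E" "p (F y) = f y" using F[OF y] ends_E by auto
    obtain V T k where V: "F y \<in> V" "openin (top_of_set E) V" and T: "p (F y) \<in> T" "openin (top_of_set M) T"
      and k: "homeomorphism V T p k"
      using covering_space_local_homeomorphism[OF cov Fy(1)] by metis
    have "openin (top_of_set Y) (Y \<inter> f -` T)" using f T by (intro continuous_openin_preimage) auto
    then obtain W where W: "openin (top_of_set Y) W" "y \<in> W" "W \<subseteq> Y \<inter> f -` T" "path_connected W"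
      using loc[of "Y \<inter> f -` T" y] y T Fy by auto
    \<comment> \<open>Inside \<open>W\<close> the path to \<open>y\<close> is continued by a path
      whose lift stays in the sheet \<open>V\<close> and hence is given by the local inverse
      \<open>k\<close>.\<close>
    have eq: "F w = k (f w)" if w: "w \<in> W" for w
    proof -
      obtain c where c: "path c" "path_image c \<subseteq> W" "c 0 = y" "c 1 = w"
        using path_connected_obtain[OF W(4,2) w] by metis
      obtain g h where g: "path g" "path_image g \<subseteq> Y" "g 0 = y0" "g 1 = y"
        and h: "path h" "path_image h \<subseteq> E" "\<And>t. t \<in> {0..1} \<Longrightarrow> p (h t) = f (g t)" "h 0 = e0" "h 1 = F y"
        using F[OF y] unfolding ends_def by metis
      define c' where "c' = k \<circ> (f \<circ> c)"
      have fc: "path (f \<circ> c)" using c(1,2) W(3) by (auto intro!: path_continuous_image continuous_on_subset[OF f(1)])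
      have fcT: "path_image (f \<circ> c) \<subseteq> T" using c W by (auto simp: path_image_def)
      have c': "path c'" unfolding c'_def using fc fcT homeomorphism_cont2[OF k]
        by (auto intro!: path_continuous_image intro: continuous_on_subset)
      have "path_image c' \<subseteq> V" unfolding c'_def using fcT homeomorphism_image2[OF k]
        by (auto simp: path_image_def)
      then have c'E: "path_image c' \<subseteq> E" using V openin_imp_subset by blast
      have c'p: "p (c' t) = f (c t)" if "t \<in> {0..1}" for t
        using fcT that homeomorphism_apply2[OF k] by (force simp: c'_def path_image_def)
      have c'0: "c' 0 = F y" using c Fy V homeomorphism_apply1[OF k] by (metis c'_def comp_apply)
      have "ends w (c' 1)"
        unfolding ends_def
      proof (intro exI conjI ballI)
        show "path (g +++ c)" "path (h +++ c')" using g c h c' c'0 by (auto simp: path_join pathstart_def pathfinish_def)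
        show "path_image (g +++ c) \<subseteq> Y" using g c W by (intro subset_path_image_join) auto
        show "path_image (h +++ c') \<subseteq> E" using h c'E by (intro subset_path_image_join) auto
        show "(g +++ c) 0 = y0" "(g +++ c) 1 = w" "(h +++ c') 0 = e0" "(h +++ c') 1 = c' 1"
          using g c h by (auto simp: joinpaths_def)
        show "p ((h +++ c') t) = f ((g +++ c) t)" if "t \<in> {0..1}" for t
          using that h c'p by (auto simp: joinpaths_def)
      qed
      moreover have "w \<in> Y" using W w by auto
      ultimately have "F w = c' 1" using F uniq by blast
      then show ?thesis using c by (simp add: c'_def)
    qed
    have "continuous_on W (k \<circ> f)"
      using f W homeomorphism_cont2[OF k] by (intro continuous_on_compose) (auto intro: continuous_on_subset)
    then have "continuous_on W F" using eq by (simp cong: continuous_on_cong)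
    then show "\<exists>W. openin (top_of_set Y) W \<and> y \<in> W \<and> continuous_on W F" using W(1,2) by blast
  qed
  moreover have "ends y0 e0"
    unfolding ends_def using y0 e0
    by (intro exI[of _ "\<lambda>_. y0"] exI[of _ "\<lambda>_. e0"]) (auto simp: path_def path_image_def)
  then have "F y0 = e0" using F uniq y0 by blast
  ultimately show ?thesis using that F ends_E by (metis image_subsetI)
qed

section \<open>Real functions whose values can be prescribed along paths\<close>

text \<open>
  The form of the homotopy lifting property of a locally trivial \<open>\<theta>\<close> that is needed below. The angle
  along a path may be altered while it stays near a given value \<open>t0\<close>, with end points kept where the
  angle is kept. Pushing down the top of the range of the angle in small steps then joins two points
  of a level set inside that level set.
\<close>

definition squeezable :: "'c::topological_space set \<Rightarrow> ('c \<Rightarrow> real) \<Rightarrow> bool" where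
  "squeezable C \<theta> \<longleftrightarrow> (\<forall>t0. \<exists>\<epsilon>>0. \<forall>\<alpha> w.
     path \<alpha> \<and> path_image \<alpha> \<subseteq> C \<and> continuous_on {0..1} w \<and>
     (\<forall>u\<in>{0..1}. w u = \<theta> (\<alpha> u) \<or> \<bar>\<theta> (\<alpha> u) - t0\<bar> \<le> \<epsilon> \<and> \<bar>w u - t0\<bar> \<le> \<epsilon>) \<longrightarrow>
     (\<exists>\<beta>. path \<beta> \<and> path_image \<beta> \<subseteq> C \<and> (\<forall>u\<in>{0..1}. \<theta> (\<beta> u) = w u) \<and>
        (w 0 = \<theta> (\<alpha> 0) \<longrightarrow> \<beta> 0 = \<alpha> 0) \<and> (w 1 = \<theta> (\<alpha> 1) \<longrightarrow> \<beta> 1 = \<alpha> 1)))"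

lemma squeezableE:
  assumes "squeezable C \<theta>"
  obtains \<epsilon> where "\<epsilon> > 0" "\<And>\<alpha> w. path \<alpha> \<Longrightarrow> path_image \<alpha> \<subseteq> C \<Longrightarrow> continuous_on {0..1} w \<Longrightarrow>
     (\<And>u. u \<in> {0..1} \<Longrightarrow> w u = \<theta> (\<alpha> u) \<or> \<bar>\<theta> (\<alpha> u) - t0\<bar> \<le> \<epsilon> \<and> \<bar>w u - t0\<bar> \<le> \<epsilon>) \<Longrightarrow>
     \<exists>\<beta>. path \<beta> \<and> path_image \<beta> \<subseteq> C \<and> (\<forall>u\<in>{0..1}. \<theta> (\<beta> u) = w u) \<and>
        (w 0 = \<theta> (\<alpha> 0) \<longrightarrow> \<beta> 0 = \<alpha> 0) \<and> (w 1 = \<theta> (\<alpha> 1) \<longrightarrow> \<beta> 1 = \<alpha> 1)"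
  using spec[OF iffD1[OF squeezable_def assms], of t0] by (elim exE conjE) (rule that, auto)

text \<open>Reflection of the angle, so that pushing down also yields pushing up, and upper half
  neighbourhoods yield lower ones.\<close>

lemma squeezable_uminus:
  assumes "squeezable C \<theta>"
  shows "squeezable C (\<lambda>x. - \<theta> x)"
  unfolding squeezable_def
proof
  fix t0
  obtain \<epsilon> where \<epsilon>: "\<epsilon> > 0" "\<And>\<alpha> w. path \<alpha> \<Longrightarrow> path_image \<alpha> \<subseteq> C \<Longrightarrow> continuous_on {0..1} w \<Longrightarrow>
     (\<And>u. u \<in> {0..1} \<Longrightarrow> w u = \<theta> (\<alpha> u) \<or> \<bar>\<theta> (\<alpha> u) - (-t0)\<bar> \<le> \<epsilon> \<and> \<bar>w u - (-t0)\<bar> \<le> \<epsilon>) \<Longrightarrow>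
     \<exists>\<beta>. path \<beta> \<and> path_image \<beta> \<subseteq> C \<and> (\<forall>u\<in>{0..1}. \<theta> (\<beta> u) = w u) \<and>
        (w 0 = \<theta> (\<alpha> 0) \<longrightarrow> \<beta> 0 = \<alpha> 0) \<and> (w 1 = \<theta> (\<alpha> 1) \<longrightarrow> \<beta> 1 = \<alpha> 1)"
    using squeezableE[OF assms, of "-t0"] by blast
  show "\<exists>\<epsilon>>0. \<forall>\<alpha> w.
     path \<alpha> \<and> path_image \<alpha> \<subseteq> C \<and> continuous_on {0..1} w \<and>
     (\<forall>u\<in>{0..1}. w u = - \<theta> (\<alpha> u) \<or> \<bar>- \<theta> (\<alpha> u) - t0\<bar> \<le> \<epsilon> \<and> \<bar>w u - t0\<bar> \<le> \<epsilon>) \<longrightarrow>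
     (\<exists>\<beta>. path \<beta> \<and> path_image \<beta> \<subseteq> C \<and> (\<forall>u\<in>{0..1}. - \<theta> (\<beta> u) = w u) \<and>
        (w 0 = - \<theta> (\<alpha> 0) \<longrightarrow> \<beta> 0 = \<alpha> 0) \<and> (w 1 = - \<theta> (\<alpha> 1) \<longrightarrow> \<beta> 1 = \<alpha> 1))"
  proof (intro exI[of _ \<epsilon>] conjI allI impI \<epsilon>(1))
    fix \<alpha> w assume a: "path \<alpha> \<and> path_image \<alpha> \<subseteq> C \<and> continuous_on {0..1} w \<and>
     (\<forall>u\<in>{0..1}. w u = - \<theta> (\<alpha> u) \<or> \<bar>- \<theta> (\<alpha> u) - t0\<bar> \<le> \<epsilon> \<and> \<bar>w u - t0\<bar> \<le> \<epsilon>)"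
    have "\<exists>\<beta>. path \<beta> \<and> path_image \<beta> \<subseteq> C \<and> (\<forall>u\<in>{0..1}. \<theta> (\<beta> u) = - w u) \<and>
        (- w 0 = \<theta> (\<alpha> 0) \<longrightarrow> \<beta> 0 = \<alpha> 0) \<and> (- w 1 = \<theta> (\<alpha> 1) \<longrightarrow> \<beta> 1 = \<alpha> 1)"
    proof (rule \<epsilon>(2))
      show "continuous_on {0..1} (\<lambda>u. - w u)" using a by (intro continuous_intros) auto
      fix u :: real assume "u \<in> {0..1}"
      with a have "w u = - \<theta> (\<alpha> u) \<or> \<bar>- \<theta> (\<alpha> u) - t0\<bar> \<le> \<epsilon> \<and> \<bar>w u - t0\<bar> \<le> \<epsilon>" by blast
      then show "- w u = \<theta> (\<alpha> u) \<or> \<bar>\<theta> (\<alpha> u) - - t0\<bar> \<le> \<epsilon> \<and> \<bar>- w u - - t0\<bar> \<le> \<epsilon>" by linarith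
    qed (use a in auto)
    then show "\<exists>\<beta>. path \<beta> \<and> path_image \<beta> \<subseteq> C \<and> (\<forall>u\<in>{0..1}. - \<theta> (\<beta> u) = w u) \<and>
        (w 0 = - \<theta> (\<alpha> 0) \<longrightarrow> \<beta> 0 = \<alpha> 0) \<and> (w 1 = - \<theta> (\<alpha> 1) \<longrightarrow> \<beta> 1 = \<alpha> 1)"
      by (elim exE) (rule exI, force)
  qed
qed

text \<open>Shifting a constant path shows that some closed ball around each angle is either
  contained in the image or disjoint from it, so the image is open and closed in the line.\<close>

lemma squeezable_surj:
  assumes sq: "squeezable C \<theta>" and "C \<noteq> {}"
  shows "\<theta> ` C = UNIV"
proof -
  have ex: "\<exists>\<epsilon>>0. \<forall>t\<in>cball t0 \<epsilon> \<inter> \<theta> ` C. cball t0 \<epsilon> \<subseteq> \<theta> ` C" for t0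
  proof -
    obtain \<epsilon> where \<epsilon>: "\<epsilon> > 0" "\<And>\<alpha> w. path \<alpha> \<Longrightarrow> path_image \<alpha> \<subseteq> C \<Longrightarrow> continuous_on {0..1} w \<Longrightarrow>
     (\<And>u. u \<in> {0..1} \<Longrightarrow> w u = \<theta> (\<alpha> u) \<or> \<bar>\<theta> (\<alpha> u) - t0\<bar> \<le> \<epsilon> \<and> \<bar>w u - t0\<bar> \<le> \<epsilon>) \<Longrightarrow>
     \<exists>\<beta>. path \<beta> \<and> path_image \<beta> \<subseteq> C \<and> (\<forall>u\<in>{0..1}. \<theta> (\<beta> u) = w u) \<and>
        (w 0 = \<theta> (\<alpha> 0) \<longrightarrow> \<beta> 0 = \<alpha> 0) \<and> (w 1 = \<theta> (\<alpha> 1) \<longrightarrow> \<beta> 1 = \<alpha> 1)"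
      using squeezableE[OF sq, of t0] by blast
    have "t' \<in> \<theta> ` C" if t: "\<bar>\<theta> x - t0\<bar> \<le> \<epsilon>" "x \<in> C" and t': "\<bar>t' - t0\<bar> \<le> \<epsilon>" for x t'
    proof -
      have "\<exists>\<beta>. path \<beta> \<and> path_image \<beta> \<subseteq> C \<and> (\<forall>u\<in>{0..1}. \<theta> (\<beta> u) = (\<lambda>_. t') u) \<and>
        ((\<lambda>_. t') 0 = \<theta> ((\<lambda>_. x) 0) \<longrightarrow> \<beta> 0 = (\<lambda>_. x) 0) \<and> ((\<lambda>_. t') 1 = \<theta> ((\<lambda>_. x) 1) \<longrightarrow> \<beta> 1 = (\<lambda>_. x) 1)"
        by (rule \<epsilon>(2)) (use t t' in \<open>auto simp: path_def path_image_def\<close>)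
      then obtain \<beta> where "path_image \<beta> \<subseteq> C" "\<theta> (\<beta> 0) = t'" by auto
      then have "\<beta> 0 \<in> C" by (auto simp: path_image_def)
      then show ?thesis using \<open>\<theta> (\<beta> 0) = t'\<close> by blast
    qed
    then show ?thesis using \<epsilon>(1)
      by (intro exI[of _ \<epsilon>]) (auto simp: dist_real_def abs_minus_commute)
  qed
  have "open (\<theta> ` C)"
    unfolding open_contains_cball
  proof
    fix t assume t: "t \<in> \<theta> ` C"
    obtain \<epsilon> where e: "\<epsilon>>0" "\<forall>t'\<in>cball t \<epsilon> \<inter> \<theta> ` C. cball t \<epsilon> \<subseteq> \<theta> ` C" using ex by blast
    then have "t \<in> cball t \<epsilon> \<inter> \<theta> ` C" using t by simp
    then show "\<exists>e>0. cball t e \<subseteq> \<theta> ` C" using e by blast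
  qed
  moreover have "open (- \<theta> ` C)"
    unfolding open_contains_cball
  proof
    fix t assume t: "t \<in> - \<theta> ` C"
    obtain \<epsilon> where e: "\<epsilon>>0" "\<forall>t'\<in>cball t \<epsilon> \<inter> \<theta> ` C. cball t \<epsilon> \<subseteq> \<theta> ` C" using ex by blast
    have "t \<in> cball t \<epsilon>" using e by simp
    then have "cball t \<epsilon> \<inter> \<theta> ` C = {}" using e t by blast
    then show "\<exists>e>0. cball t e \<subseteq> - \<theta> ` C" using e by blast
  qed
  ultimately have "\<theta> ` C = {} \<or> \<theta> ` C = UNIV" using clopen[of "\<theta> ` C"] by (auto simp: closed_open)
  then show ?thesis using \<open>C \<noteq> {}\<close> by simp
qed

text \<open>Let the angle of the constant path at \<open>x\<close> rise linearly. The altered path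
  starts at \<open>x\<close>, since the angle is kept there, and by continuity it stays in
  \<open>W\<close> for a while.\<close>

lemma squeezable_half_nbhd:
  assumes sq: "squeezable C \<theta>" and W: "openin (top_of_set C) W" "x \<in> W"
  shows "\<exists>\<delta>>0. {\<theta> x..<\<theta> x + \<delta>} \<subseteq> \<theta> ` W"
proof -
  obtain \<epsilon> where \<epsilon>: "\<epsilon> > 0" "\<And>\<alpha> w. path \<alpha> \<Longrightarrow> path_image \<alpha> \<subseteq> C \<Longrightarrow> continuous_on {0..1} w \<Longrightarrow>
     (\<And>u. u \<in> {0..1} \<Longrightarrow> w u = \<theta> (\<alpha> u) \<or> \<bar>\<theta> (\<alpha> u) - \<theta> x\<bar> \<le> \<epsilon> \<and> \<bar>w u - \<theta> x\<bar> \<le> \<epsilon>) \<Longrightarrow>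
     \<exists>\<beta>. path \<beta> \<and> path_image \<beta> \<subseteq> C \<and> (\<forall>u\<in>{0..1}. \<theta> (\<beta> u) = w u) \<and>
        (w 0 = \<theta> (\<alpha> 0) \<longrightarrow> \<beta> 0 = \<alpha> 0) \<and> (w 1 = \<theta> (\<alpha> 1) \<longrightarrow> \<beta> 1 = \<alpha> 1)"
    using squeezableE[OF sq, of "\<theta> x"] by blast
  have "x \<in> C" using W openin_imp_subset by blast
  have "\<exists>\<beta>. path \<beta> \<and> path_image \<beta> \<subseteq> C \<and> (\<forall>u\<in>{0..1}. \<theta> (\<beta> u) = (\<lambda>u. \<theta> x + \<epsilon> * u) u) \<and>
        ((\<lambda>u. \<theta> x + \<epsilon> * u) 0 = \<theta> ((\<lambda>_. x) 0) \<longrightarrow> \<beta> 0 = (\<lambda>_. x) 0) \<and> ((\<lambda>u. \<theta> x + \<epsilon> * u) 1 = \<theta> ((\<lambda>_. x) 1) \<longrightarrow> \<beta> 1 = (\<lambda>_. x) 1)"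
    by (rule \<epsilon>(2)) (use \<epsilon>(1) \<open>x \<in> C\<close> in \<open>auto simp: path_def path_image_def abs_mult mult_left_le intro!: continuous_intros\<close>)
  then obtain \<beta> where "path \<beta> \<and> path_image \<beta> \<subseteq> C \<and> (\<forall>u\<in>{0..1}. \<theta> (\<beta> u) = \<theta> x + \<epsilon> * u) \<and>
      (\<theta> x + \<epsilon> * 0 = \<theta> x \<longrightarrow> \<beta> 0 = x) \<and> (\<theta> x + \<epsilon> * 1 = \<theta> x \<longrightarrow> \<beta> 1 = x)" ..
  then have \<beta>: "path \<beta>" "path_image \<beta> \<subseteq> C" "\<And>u. u \<in> {0..1} \<Longrightarrow> \<theta> (\<beta> u) = \<theta> x + \<epsilon> * u" "\<beta> 0 = x"
    by simp_all
  have "openin (top_of_set {0..1}) ({0..1} \<inter> \<beta> -` W)"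
    using \<beta> W by (intro openin_preimage) (auto simp: path_def path_image_def)
  then obtain S where S: "open S" "{0..1} \<inter> \<beta> -` W = {0..1} \<inter> S" by (metis openin_open)
  have "0 \<in> S" using S \<beta> W by auto
  then obtain d where d: "d > 0" "ball 0 d \<subseteq> S" using S open_contains_ball by blast
  \<comment> \<open>The path parameter may run up to \<open>min 1 d\<close>, and the angle rises at
    speed \<open>\<epsilon>\<close>.\<close>
  define \<delta> where "\<delta> = \<epsilon> * min 1 d"
  have "{\<theta> x..<\<theta> x + \<delta>} \<subseteq> \<theta> ` W"
  proof
    fix t assume t: "t \<in> {\<theta> x..<\<theta> x + \<delta>}"
    define u where "u = (t - \<theta> x) / \<epsilon>"
    have u: "0 \<le> u" "u < min 1 d" "\<theta> x + \<epsilon> * u = t"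
    proof -
      show "0 \<le> u" "\<theta> x + \<epsilon> * u = t" using t \<epsilon>(1) by (auto simp: u_def)
      have "\<epsilon> * u < \<epsilon> * min 1 d" using t \<open>\<theta> x + \<epsilon> * u = t\<close> by (auto simp: \<delta>_def)
      then show "u < min 1 d" using \<epsilon>(1) by (rule mult_left_less_imp_less[OF _ less_imp_le])
    qed
    then have "u \<in> {0..1} \<inter> S" using d by auto
    then have "\<beta> u \<in> W" "u \<in> {0..1}" using equalityD2[OF S(2)] by blast+
    moreover from this have "\<theta> (\<beta> u) = t" using \<beta>(3) u(3) by metis
    ultimately have "\<beta> u \<in> W" "\<theta> (\<beta> u) = t" by auto
    then show "t \<in> \<theta> ` W" by blast
  qed
  moreover have "\<delta> > 0" using \<epsilon> d by (simp add: \<delta>_def)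
  ultimately show ?thesis by blast
qed

lemma squeezable_open:
  assumes sq: "squeezable C \<theta>" and W: "openin (top_of_set C) W"
  shows "open (\<theta> ` W)"
  unfolding open_dist
proof (intro ballI)
  fix t assume "t \<in> \<theta> ` W"
  then obtain x where x: "x \<in> W" "t = \<theta> x" by auto
  obtain \<delta>1 where 1: "\<delta>1 > 0" "{t..<t + \<delta>1} \<subseteq> \<theta> ` W"
    using squeezable_half_nbhd[OF sq W x(1)] x by auto
  obtain \<delta>2 where 2: "\<delta>2 > 0" "{-t..<-t + \<delta>2} \<subseteq> (\<lambda>x. - \<theta> x) ` W"
    using squeezable_half_nbhd[OF squeezable_uminus[OF sq] W x(1)] x by auto
  have "y \<in> \<theta> ` W" if "dist y t < min \<delta>1 \<delta>2" for y
  proof (cases "y \<ge> t")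
    case True then show ?thesis using that 1 by (auto simp: dist_real_def)
  next
    case False
    then have "-y \<in> {-t..<-t + \<delta>2}" using that by (auto simp: dist_real_def)
    then have "- y \<in> (\<lambda>x. - \<theta> x) ` W" using 2(2) by (rule rev_subsetD)
    then show ?thesis by auto
  qed
  then show "\<exists>e>0. \<forall>y. dist y t < e \<longrightarrow> y \<in> \<theta> ` W"
    using 1 2 by (intro exI[of _ "min \<delta>1 \<delta>2"]) auto
qed

text \<open>Bisection over the interval of levels: capping at \<open>b\<close> and then at a smaller
  \<open>a\<close> amounts to capping at \<open>a\<close>. The end points already have angle at most
  \<open>a\<close>, so they stay fixed.\<close>

lemma squeeze_down:
  assumes sq: "squeezable C \<theta>" and cont: "continuous_on C \<theta>" and "a \<le> b"
    and \<alpha>: "path \<alpha>" "path_image \<alpha> \<subseteq> C" "\<And>u. u \<in> {0..1} \<Longrightarrow> \<theta> (\<alpha> u) \<le> b" "\<theta> (\<alpha> 0) \<le> a" "\<theta> (\<alpha> 1) \<le> a"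
  obtains \<beta> where "path \<beta>" "path_image \<beta> \<subseteq> C" "\<beta> 0 = \<alpha> 0" "\<beta> 1 = \<alpha> 1"
    "\<And>u. u \<in> {0..1} \<Longrightarrow> \<theta> (\<beta> u) = min a (\<theta> (\<alpha> u))"
proof -
  define P where "P a b \<longleftrightarrow> (\<forall>\<alpha>. path \<alpha> \<and> path_image \<alpha> \<subseteq> C \<and> (\<forall>u\<in>{0..1}. \<theta> (\<alpha> u) \<le> b) \<and>
     \<theta> (\<alpha> 0) \<le> a \<and> \<theta> (\<alpha> 1) \<le> a \<longrightarrow>
     (\<exists>\<beta>. path \<beta> \<and> path_image \<beta> \<subseteq> C \<and> \<beta> 0 = \<alpha> 0 \<and> \<beta> 1 = \<alpha> 1 \<and>
       (\<forall>u\<in>{0..1}. \<theta> (\<beta> u) = min a (\<theta> (\<alpha> u)))))" for a b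
  have "P a b" using \<open>a \<le> b\<close>
  proof (induction rule: Bolzano)
    case (trans a b c)
    show ?case unfolding P_def
    proof (intro allI impI, elim conjE)
      fix \<alpha> assume \<alpha>: "path \<alpha>" "path_image \<alpha> \<subseteq> C" "\<forall>u\<in>{0..1}. \<theta> (\<alpha> u) \<le> c" "\<theta> (\<alpha> 0) \<le> a" "\<theta> (\<alpha> 1) \<le> a"
      then have "\<theta> (\<alpha> 0) \<le> b" "\<theta> (\<alpha> 1) \<le> b" using trans by auto
      then obtain \<beta> where \<beta>: "path \<beta>" "path_image \<beta> \<subseteq> C" "\<beta> 0 = \<alpha> 0" "\<beta> 1 = \<alpha> 1"
         "\<forall>u\<in>{0..1}. \<theta> (\<beta> u) = min b (\<theta> (\<alpha> u))"
        using trans(2)[unfolded P_def, rule_format, of \<alpha>] \<alpha> by auto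
      then obtain \<gamma> where "path \<gamma>" "path_image \<gamma> \<subseteq> C" "\<gamma> 0 = \<beta> 0" "\<gamma> 1 = \<beta> 1"
         "\<forall>u\<in>{0..1}. \<theta> (\<gamma> u) = min a (\<theta> (\<beta> u))"
        using trans(1)[unfolded P_def, rule_format, of \<beta>] \<alpha> by auto
      then show "\<exists>\<beta>. path \<beta> \<and> path_image \<beta> \<subseteq> C \<and> \<beta> 0 = \<alpha> 0 \<and> \<beta> 1 = \<alpha> 1 \<and>
          (\<forall>u\<in>{0..1}. \<theta> (\<beta> u) = min a (\<theta> (\<alpha> u)))"
        using \<beta> trans(3) by (intro exI[of _ \<gamma>]) (auto simp: min_def)
    qed
  next
    case (local t0)
    obtain \<epsilon> where \<epsilon>: "\<epsilon> > 0" "\<And>\<alpha> w. path \<alpha> \<Longrightarrow> path_image \<alpha> \<subseteq> C \<Longrightarrow> continuous_on {0..1} w \<Longrightarrow>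
     (\<And>u. u \<in> {0..1} \<Longrightarrow> w u = \<theta> (\<alpha> u) \<or> \<bar>\<theta> (\<alpha> u) - t0\<bar> \<le> \<epsilon> \<and> \<bar>w u - t0\<bar> \<le> \<epsilon>) \<Longrightarrow>
     \<exists>\<beta>. path \<beta> \<and> path_image \<beta> \<subseteq> C \<and> (\<forall>u\<in>{0..1}. \<theta> (\<beta> u) = w u) \<and>
        (w 0 = \<theta> (\<alpha> 0) \<longrightarrow> \<beta> 0 = \<alpha> 0) \<and> (w 1 = \<theta> (\<alpha> 1) \<longrightarrow> \<beta> 1 = \<alpha> 1)"
      using squeezableE[OF sq, of t0] by blast
    have "P a b" if ab: "a \<le> t0" "t0 \<le> b" "b - a < \<epsilon>" for a b
      unfolding P_def
    proof (intro allI impI, elim conjE)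
      fix \<alpha> assume \<alpha>: "path \<alpha>" "path_image \<alpha> \<subseteq> C" "\<forall>u\<in>{0..1}. \<theta> (\<alpha> u) \<le> b" "\<theta> (\<alpha> 0) \<le> a" "\<theta> (\<alpha> 1) \<le> a"
      have c: "continuous_on {0..1} (\<lambda>u. \<theta> (\<alpha> u))"
        by (rule continuous_on_compose2[OF cont]) (use \<alpha> in \<open>auto simp: path_def path_image_def\<close>)
      \<comment> \<open>Only angles in \<open>(a, b]\<close> change; both they and the new value
        \<open>a\<close> are within \<open>\<epsilon>\<close> of \<open>t0\<close>.\<close>
      define w where "w u = min a (\<theta> (\<alpha> u))" for u
      have "\<exists>\<beta>. path \<beta> \<and> path_image \<beta> \<subseteq> C \<and> (\<forall>u\<in>{0..1}. \<theta> (\<beta> u) = w u) \<and>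
        (w 0 = \<theta> (\<alpha> 0) \<longrightarrow> \<beta> 0 = \<alpha> 0) \<and> (w 1 = \<theta> (\<alpha> 1) \<longrightarrow> \<beta> 1 = \<alpha> 1)"
      proof (rule \<epsilon>(2))
        show "continuous_on {0..1} w" unfolding w_def using c by (intro continuous_intros)
        fix u :: real assume "u \<in> {0..1}"
        then have "\<theta> (\<alpha> u) \<le> b" using \<alpha> by blast
        then show "w u = \<theta> (\<alpha> u) \<or> \<bar>\<theta> (\<alpha> u) - t0\<bar> \<le> \<epsilon> \<and> \<bar>w u - t0\<bar> \<le> \<epsilon>"
          using ab by (auto simp: w_def min_def)
      qed (use \<alpha> in auto)
      then show "\<exists>\<beta>. path \<beta> \<and> path_image \<beta> \<subseteq> C \<and> \<beta> 0 = \<alpha> 0 \<and> \<beta> 1 = \<alpha> 1 \<and>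
          (\<forall>u\<in>{0..1}. \<theta> (\<beta> u) = min a (\<theta> (\<alpha> u)))"
        using \<alpha>(4,5) by (auto simp: w_def)
    qed
    then show ?case using \<epsilon>(1) by blast
  qed
  then have "\<exists>\<beta>. path \<beta> \<and> path_image \<beta> \<subseteq> C \<and> \<beta> 0 = \<alpha> 0 \<and> \<beta> 1 = \<alpha> 1 \<and>
       (\<forall>u\<in>{0..1}. \<theta> (\<beta> u) = min a (\<theta> (\<alpha> u)))"
    unfolding P_def by (elim allE impE) (use \<alpha> in auto)
  then show ?thesis using that by blast
qed

text \<open>Compactness bounds the angle along a path between two points of the level. Capping at
  \<open>c\<close> and then, after reflection, from the other side leaves the constant angle
  \<open>c\<close>.\<close>

lemma squeezable_level_path_connected:
  assumes sq: "squeezable C \<theta>" and cont: "continuous_on C \<theta>" and C: "path_connected C"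
  shows "path_connected {x \<in> C. \<theta> x = c}"
  unfolding path_connected_def
proof (intro ballI)
  fix x y assume xy: "x \<in> {x \<in> C. \<theta> x = c}" "y \<in> {x \<in> C. \<theta> x = c}"
  obtain \<alpha> where \<alpha>: "path \<alpha>" "path_image \<alpha> \<subseteq> C" "\<alpha> 0 = x" "\<alpha> 1 = y"
    by (rule path_connected_obtain[OF C, of x y]) (use xy in auto)
  have bd: "\<exists>B\<ge>b. \<forall>u\<in>{0..1}. f (\<alpha> u) \<le> B" if "path \<alpha>" "path_image \<alpha> \<subseteq> C" "continuous_on C f" for \<alpha> b and f :: "'a \<Rightarrow> real"
  proof -
    have "compact (f ` path_image \<alpha>)"
      using that by (intro compact_continuous_image compact_path_image) (auto intro: continuous_on_subset)
    then obtain B where "\<forall>t\<in>f ` path_image \<alpha>. norm t \<le> B" using compact_imp_bounded bounded_iff by metis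
    then have "\<forall>t\<in>path_image \<alpha>. f t \<le> B" by (metis abs_le_D1 imageI real_norm_def)
    then have "f (\<alpha> u) \<le> max b B" if "u \<in> {0..1}" for u
      using that unfolding path_image_def by (metis imageI max.coboundedI2)
    then show ?thesis by (intro exI[of _ "max b B"]) auto
  qed
  obtain B where B: "c \<le> B" "\<And>u. u \<in> {0..1} \<Longrightarrow> \<theta> (\<alpha> u) \<le> B" using bd[OF \<alpha>(1,2) cont, of c] by blast
  obtain \<beta> where \<beta>: "path \<beta>" "path_image \<beta> \<subseteq> C" "\<beta> 0 = \<alpha> 0" "\<beta> 1 = \<alpha> 1"
    "\<And>u. u \<in> {0..1} \<Longrightarrow> \<theta> (\<beta> u) = min c (\<theta> (\<alpha> u))"
    by (rule squeeze_down[OF sq cont B(1) \<alpha>(1,2) B(2)]) (use xy \<alpha> in auto)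
  have cont': "continuous_on C (\<lambda>x. - \<theta> x)" using cont by (intro continuous_intros)
  obtain B' where B': "- c \<le> B'" "\<And>u. u \<in> {0..1} \<Longrightarrow> - \<theta> (\<beta> u) \<le> B'" using bd[OF \<beta>(1,2) cont', of "-c"] by blast
  obtain \<gamma> where \<gamma>: "path \<gamma>" "path_image \<gamma> \<subseteq> C" "\<gamma> 0 = \<beta> 0" "\<gamma> 1 = \<beta> 1"
    "\<And>u. u \<in> {0..1} \<Longrightarrow> - \<theta> (\<gamma> u) = min (- c) (- \<theta> (\<beta> u))"
    by (rule squeeze_down[OF squeezable_uminus[OF sq] cont' B'(1) \<beta>(1,2) B'(2)]) (use xy \<alpha> \<beta>(3,4) in auto)
  have "\<theta> (\<gamma> u) = c" if "u \<in> {0..1}" for u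
    using \<gamma>(5)[OF that] \<beta>(5)[OF that] by (simp add: min_def split: if_splits)
  then have "path_image \<gamma> \<subseteq> {x \<in> C. \<theta> x = c}" using \<gamma>(2) by (auto simp: path_image_def)
  then show "\<exists>g. path g \<and> path_image g \<subseteq> {x \<in> C. \<theta> x = c} \<and> pathstart g = x \<and> pathfinish g = y"
    using \<gamma> \<beta> \<alpha> by (intro exI[of _ \<gamma>]) (auto simp: pathstart_def pathfinish_def)
qed

section \<open>Angles as lifts through the exponential\<close>

lemma cis_inj_near:
  assumes "cis a = cis b" "\<bar>a - b\<bar> < 2 * pi"
  shows "a = b"
proof (rule ccontr)
  assume "a \<noteq> b"
  have "cis (a - b) = 1" using assms(1) by (simp flip: cis_divide)
  then have "cos (a - b) = 1" by (metis cis.sel(1) one_complex.sel(1))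
  then obtain k :: int where k: "a - b = real_of_int k * 2 * pi" using cos_one_2pi_int by blast
  then have "\<bar>real_of_int k\<bar> * (2 * pi) < 1 * (2 * pi)" using assms(2) by (simp add: abs_mult)
  then have "\<bar>real_of_int k\<bar> < 1" using mult_less_cancel_right_pos[of "2 * pi"] pi_gt_zero by auto
  then have "k = 0" by linarith
  with k \<open>a \<noteq> b\<close> show False by simp
qed

text \<open>An angle function times \<open>\<i>\<close> is a lift through \<open>exp\<close>, so
  uniqueness of lifts applies.\<close>

lemma cis_lift_unique:
  fixes f g :: "'a::topological_space \<Rightarrow> real"
  assumes Y: "connected Y" and f: "continuous_on Y f" and g: "continuous_on Y g"
    and eq: "\<And>y. y \<in> Y \<Longrightarrow> cis (f y) = cis (g y)" and a: "a \<in> Y" "f a = g a" and y: "y \<in> Y"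
  shows "f y = g y"
proof -
  have "\<i> * complex_of_real (f y) = \<i> * complex_of_real (g y)"
    by (rule covering_lift_unique[OF covering_space_exp_punctured_plane Y, of "\<lambda>y. \<i> * complex_of_real (f y)" "\<lambda>y. \<i> * complex_of_real (g y)"])
       (use assms in \<open>auto simp flip: cis_conv_exp intro!: continuous_intros\<close>)
  then show ?thesis by simp
qed

text \<open>The homotopy \<open>k\<close> is built in \<open>E\<close>, where the trivialisation
  lives, and its projection to \<open>M\<close> is lifted through \<open>q\<close> to
  \<open>K\<close>. Uniqueness of lifts, first through \<open>p\<close> and then through
  \<open>exp\<close>, shows that \<open>r \<circ> K\<close> is \<open>k\<close> and that the angle
  of \<open>K\<close> is \<open>m\<close>.\<close>

lemma slithering_lift_squeezable:
  fixes C :: "'c::topological_space set" and E :: "'b::topological_space set" and M :: "'a::topological_space set"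
  assumes covE: "covering_space E p M" and covC: "covering_space C q M"
    and r: "continuous_on C r" "r ` C \<subseteq> E" "\<And>x. x \<in> C \<Longrightarrow> p (r x) = q x"
    and \<theta>: "continuous_on C \<theta>" "\<And>x. x \<in> C \<Longrightarrow> s (r x) = cis (\<theta> x)"
    and triv: "\<And>y. y \<in> sphere 0 1 \<Longrightarrow> \<exists>U h h'. openin (top_of_set (sphere 0 1)) U \<and> y \<in> U \<and>
        homeomorphism (E \<inter> s -` U) (U \<times> fiber E s y) h h' \<and> (\<forall>x\<in>E \<inter> s -` U. fst (h x) = s x)"
  shows "squeezable C \<theta>"
  unfolding squeezable_def
proof
  fix t0 :: real
  let ?S = "{0..1} \<times> {0..1} :: (real \<times> real) set"
  obtain U h h' where U: "openin (top_of_set (sphere 0 1)) U" "cis t0 \<in> U"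
    and h: "homeomorphism (E \<inter> s -` U) (U \<times> fiber E s (cis t0)) h h'" "\<And>x. x \<in> E \<inter> s -` U \<Longrightarrow> fst (h x) = s x"
    using triv[of "cis t0"] by (auto simp: dist_norm)
  obtain O' where O': "open O'" "U = sphere 0 1 \<inter> O'" using U by (metis openin_open)
  have "open (cis -` O')" using O' by (intro open_vimage continuous_intros) auto
  then obtain \<epsilon> where \<epsilon>: "\<epsilon> > 0" "cball t0 \<epsilon> \<subseteq> cis -` O'"
    using O' U(2) by (metis IntD2 open_contains_cball vimageI)
  have cisU: "cis t \<in> U" if "\<bar>t - t0\<bar> \<le> \<epsilon>" for t
    using that \<epsilon>(2) O' by (auto simp: dist_real_def abs_minus_commute subset_iff)
  show "\<exists>\<epsilon>>0. \<forall>\<alpha> w.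
     path \<alpha> \<and> path_image \<alpha> \<subseteq> C \<and> continuous_on {0..1} w \<and>
     (\<forall>u\<in>{0..1}. w u = \<theta> (\<alpha> u) \<or> \<bar>\<theta> (\<alpha> u) - t0\<bar> \<le> \<epsilon> \<and> \<bar>w u - t0\<bar> \<le> \<epsilon>) \<longrightarrow>
     (\<exists>\<beta>. path \<beta> \<and> path_image \<beta> \<subseteq> C \<and> (\<forall>u\<in>{0..1}. \<theta> (\<beta> u) = w u) \<and>
        (w 0 = \<theta> (\<alpha> 0) \<longrightarrow> \<beta> 0 = \<alpha> 0) \<and> (w 1 = \<theta> (\<alpha> 1) \<longrightarrow> \<beta> 1 = \<alpha> 1))"
  proof (intro exI[of _ \<epsilon>] conjI allI impI \<epsilon>(1), elim conjE)
    fix \<alpha> w assume \<alpha>: "path \<alpha>" "path_image \<alpha> \<subseteq> C" and w: "continuous_on {0..1} w"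
      and near: "\<forall>u\<in>{0..1}. w u = \<theta> (\<alpha> u) \<or> \<bar>\<theta> (\<alpha> u) - t0\<bar> \<le> \<epsilon> \<and> \<bar>w u - t0\<bar> \<le> \<epsilon>"
    have \<alpha>C: "\<alpha> u \<in> C" if "u \<in> {0..1}" for u using that \<alpha> by (auto simp: path_image_def)
    have rE: "r (\<alpha> u) \<in> E" if "u \<in> {0..1}" for u using \<alpha>C[OF that] r by auto
    have c\<alpha>: "continuous_on ?S (\<lambda>z. \<alpha> (fst z))"
      by (rule continuous_on_compose2[of "{0..1}" \<alpha>]) (use \<alpha> in \<open>auto simp: path_def intro!: continuous_intros\<close>)
    have c\<theta>: "continuous_on ?S (\<lambda>z. \<theta> (\<alpha> (fst z)))"
      by (rule continuous_on_compose2[OF \<theta>(1) c\<alpha>]) (use \<alpha>C in auto)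
    have cr: "continuous_on ?S (\<lambda>z. r (\<alpha> (fst z)))"
      by (rule continuous_on_compose2[OF r(1) c\<alpha>]) (use \<alpha>C in auto)
    have cw: "continuous_on ?S (\<lambda>z. w (fst z))"
      by (rule continuous_on_compose2[OF w]) (auto intro!: continuous_intros)
    \<comment> \<open>move the base angle linearly from \<open>\<theta> (\<alpha> u)\<close> to \<open>w u\<close> in the trivialisation, then lift to \<open>C\<close>\<close>
    define m where "m z = (1 - snd z) * \<theta> (\<alpha> (fst z)) + snd z * w (fst z)" for z
    have cm: "continuous_on ?S m" unfolding m_def by (intro continuous_intros c\<theta> cw)
    \<comment> \<open>On \<open>A\<close> both angles are near \<open>t0\<close>, so by convexity
      all intermediate ones are and the trivialisation applies; on \<open>B\<close> nothing moves.
      Both sets are closed, which allows the two definitions of \<open>k\<close> to be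
      pasted.\<close>
    define A where "A = (?S \<inter> (\<lambda>z. \<theta> (\<alpha> (fst z))) -` {t0 - \<epsilon>..t0 + \<epsilon>}) \<inter> (?S \<inter> (\<lambda>z. w (fst z)) -` {t0 - \<epsilon>..t0 + \<epsilon>})"
    define B where "B = ?S \<inter> (\<lambda>z. w (fst z) - \<theta> (\<alpha> (fst z))) -` {0}"
    have clA: "closed A" unfolding A_def
      by (intro closed_Int continuous_closed_preimage c\<theta> cw closed_Times) auto
    have clB: "closed B" unfolding B_def
      by (intro continuous_closed_preimage continuous_on_diff c\<theta> cw closed_Times) auto
    have AB: "A \<union> B = ?S"
    proof
      show "A \<union> B \<subseteq> ?S" by (auto simp: A_def B_def)
      show "?S \<subseteq> A \<union> B"
      proof
        fix z assume "z \<in> ?S"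
        moreover from this have "fst z \<in> {0..1}" by (simp add: mem_Times_iff)
        with near have "w (fst z) = \<theta> (\<alpha> (fst z)) \<or> \<bar>\<theta> (\<alpha> (fst z)) - t0\<bar> \<le> \<epsilon> \<and> \<bar>w (fst z) - t0\<bar> \<le> \<epsilon>" by blast
        ultimately show "z \<in> A \<union> B" by (auto simp: A_def B_def abs_le_iff)
      qed
    qed
    have mA: "\<bar>m z - t0\<bar> \<le> \<epsilon>" if "z \<in> A" for z
    proof -
      have "m z \<in> cball t0 \<epsilon>"
        unfolding m_def using convexD[OF convex_cball, of "\<theta> (\<alpha> (fst z))" t0 \<epsilon> "w (fst z)" "1 - snd z" "snd z"] that
        by (auto simp: A_def dist_real_def abs_le_iff)
      then show ?thesis by (simp add: dist_real_def abs_minus_commute)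
    qed
    have rA: "r (\<alpha> (fst z)) \<in> E \<inter> s -` U" if "z \<in> A" for z
      using that rE[of "fst z"] \<alpha>C[of "fst z"] \<theta>(2)[of "\<alpha> (fst z)"] cisU[of "\<theta> (\<alpha> (fst z))"] by (auto simp: A_def abs_le_iff)
    have hA: "(cis (m z), snd (h (r (\<alpha> (fst z))))) \<in> U \<times> fiber E s (cis t0)" if "z \<in> A" for z
      using cisU[OF mA[OF that]] rA[OF that] homeomorphism_image1[OF h(1)] by (metis imageI mem_Sigma_iff prod.collapse)
    \<comment> \<open>On \<open>A\<close> the fiber coordinate is kept and only the point of the
      circle moves.\<close>
    define k where "k z = (if z \<in> A then h' (cis (m z), snd (h (r (\<alpha> (fst z))))) else r (\<alpha> (fst z)))" for z
    have heq: "h' (cis (m z), snd (h (r (\<alpha> (fst z))))) = r (\<alpha> (fst z))"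
      if "z \<in> A" "m z = \<theta> (\<alpha> (fst z))" for z
    proof -
      have "\<alpha> (fst z) \<in> C" using that \<alpha>C[of "fst z"] by (auto simp: A_def)
      then have "fst (h (r (\<alpha> (fst z)))) = cis (m z)" using that rA[of z] h(2) \<theta>(2) by simp
      then show ?thesis using homeomorphism_apply1[OF h(1) rA[OF that(1)]] by (metis prod.collapse)
    qed
    have kr: "k z = r (\<alpha> (fst z))" if "m z = \<theta> (\<alpha> (fst z))" for z
      using heq that by (auto simp: k_def)
    have mB: "m z = \<theta> (\<alpha> (fst z))" if "z \<in> B" for z
      using that by (auto simp: B_def m_def algebra_simps)
    have "continuous_on A (\<lambda>z. h' (cis (m z), snd (h (r (\<alpha> (fst z))))))"
    proof (rule continuous_on_compose2[OF homeomorphism_cont2[OF h(1)]])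
      have sub: "A \<subseteq> ?S" by (auto simp: A_def)
      have "continuous_on A (\<lambda>z. h (r (\<alpha> (fst z))))"
        by (rule continuous_on_compose2[OF homeomorphism_cont1[OF h(1)] continuous_on_subset[OF cr sub]]) (use rA in blast)
      then show "continuous_on A (\<lambda>z. (cis (m z), snd (h (r (\<alpha> (fst z))))))"
        using continuous_on_subset[OF cm sub] by (intro continuous_intros)
      show "(\<lambda>z. (cis (m z), snd (h (r (\<alpha> (fst z)))))) ` A \<subseteq> U \<times> fiber E s (cis t0)" using hA by blast
    qed
    moreover have "continuous_on B (\<lambda>z. r (\<alpha> (fst z)))"
      by (rule continuous_on_subset[OF cr]) (auto simp: B_def)
    ultimately have "continuous_on (A \<union> B) k"
      unfolding k_def using heq mB by (intro continuous_on_cases clA clB) auto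
    then have kc: "continuous_on ?S k" by (simp add: AB)
    have kE: "k z \<in> E" "s (k z) = cis (m z)" if zS: "z \<in> ?S" for z
    proof -
      have "z \<in> A \<union> B" using zS AB by simp
      then consider "z \<in> A" | "z \<in> B" "z \<notin> A" by blast
      then have "k z \<in> E \<and> s (k z) = cis (m z)"
      proof cases
        case 1
        then have kz: "k z = h' (cis (m z), snd (h (r (\<alpha> (fst z)))))" by (simp add: k_def)
        have in1: "k z \<in> E \<inter> s -` U" unfolding kz using hA[OF 1] homeomorphism_image2[OF h(1)] by blast
        have "h (k z) = (cis (m z), snd (h (r (\<alpha> (fst z)))))"
          unfolding kz using homeomorphism_apply2[OF h(1) hA[OF 1]] .
        then show ?thesis using in1 h(2)[OF in1] by simp
      next
        case 2
        moreover have "fst z \<in> {0..1}" using zS by auto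
        ultimately show ?thesis using mB[OF 2(1)] rE[of "fst z"] \<theta>(2)[OF \<alpha>C[of "fst z"]] by (simp add: k_def)
      qed
      then show "k z \<in> E" "s (k z) = cis (m z)" by auto
    qed
    have pk: "continuous_on ?S (\<lambda>z. p (k z))"
      by (rule continuous_on_compose2[OF covering_space_imp_continuous[OF covE] kc]) (use kE(1) in blast)
    have pk2: "(\<lambda>z. p (k z)) ` ?S \<subseteq> M"
      using kE(1) covering_space_imp_surjective[OF covE] by blast
    have k0: "k (u, 0) = r (\<alpha> u)" for u by (subst kr) (auto simp: m_def)
    have "\<alpha> 0 \<in> C" "q (\<alpha> 0) = p (k (0, 0))" using \<alpha>C[of 0] r(3) k0 by auto
    moreover have "(0, 0) \<in> ?S" by simp
    ultimately obtain K where K: "continuous_on ?S K" "K ` ?S \<subseteq> C" "\<And>z. z \<in> ?S \<Longrightarrow> q (K z) = p (k z)" "K (0, 0) = \<alpha> 0"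
      using covering_square_lift[OF covC pk pk2, of "(0, 0)" "\<alpha> 0"] by metis
    have conS: "connected ?S" by (intro connected_Times) auto
    have rK: "r (K z) = k z" if "z \<in> ?S" for z
      by (rule covering_lift_unique[OF covE conS, of "\<lambda>z. r (K z)" k "(0,0)"])
        (use that K r kc kE k0[of 0] in \<open>auto intro!: continuous_on_compose2[OF r(1) K(1)] simp: image_subset_iff\<close>)
    have \<theta>K: "\<theta> (K z) = m z" if "z \<in> ?S" for z
    proof (rule cis_lift_unique[OF conS, of "\<lambda>z. \<theta> (K z)" m "(0,0)"])
      show "continuous_on ?S (\<lambda>z. \<theta> (K z))" by (rule continuous_on_compose2[OF \<theta>(1) K(1,2)])
      show "cis (\<theta> (K y)) = cis (m y)" if "y \<in> ?S" for y
      proof -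
        have "K y \<in> C" using K(2) that by blast
        then show ?thesis using \<theta>(2)[of "K y"] rK[OF that] kE(2)[OF that] by simp
      qed
      show "\<theta> (K (0, 0)) = m (0, 0)" using K(4) by (simp add: m_def)
    qed (use cm that in auto)
    have side: "continuous_on {0..1} (\<lambda>x. K (f x, g x))" "\<And>x. x \<in> {0..1} \<Longrightarrow> K (f x, g x) \<in> C"
      if "continuous_on {0..1} f" "continuous_on {0..1} g" "\<forall>x\<in>{0..1}. f x \<in> {0..1}" "\<forall>x\<in>{0..1}. g x \<in> {0..1}" for f g :: "real \<Rightarrow> real"
    proof -
      show "continuous_on {0..1} (\<lambda>x. K (f x, g x))"
        by (rule continuous_on_compose2[OF K(1) continuous_on_Pair[OF that(1,2)]]) (use that(3,4) in blast)
      show "\<And>x. x \<in> {0..1} \<Longrightarrow> K (f x, g x) \<in> C" using that(3,4) K(2) by blast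
    qed
    have con: "connected {0..1::real}" by simp
    have K0: "K (u, 0) = \<alpha> u" if "u \<in> {0..1}" for u
      by (rule covering_lift_unique[OF covC con, of "\<lambda>u. K (u, 0)" \<alpha> 0])
        (use that side[of "\<lambda>x. x" "\<lambda>_. 0"] K(3,4) \<alpha> k0 r(3)[OF \<alpha>C] in \<open>auto simp: path_def path_image_def\<close>)
    \<comment> \<open>Where the angle is to be kept, \<open>k\<close> does not depend on the second
      coordinate, so \<open>K\<close> lifts a constant path there.\<close>
    have Kend: "K (u, 1) = \<alpha> u" if u: "u \<in> {0..1}" and wu: "w u = \<theta> (\<alpha> u)" for u
    proof -
      have "k (u, v) = r (\<alpha> u)" for v by (subst kr) (auto simp: m_def wu algebra_simps)
      then have eq: "q (K (u, v)) = p (r (\<alpha> u))" if "v \<in> {0..1}" for v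
        using K(3)[of "(u, v)"] u that by simp
      have s: "continuous_on {0..1} (\<lambda>v. K (u, v))" "\<And>v. v \<in> {0..1} \<Longrightarrow> K (u, v) \<in> C"
        using side[of "\<lambda>_. u" "\<lambda>x. x"] u by simp_all
      have "K (u, 1) = K (u, 0)"
        by (rule covering_lift_unique[OF covC con, of "\<lambda>v. K (u, v)" "\<lambda>_. K (u, 0)" 0 1])
           (use s eq in auto)
      then show ?thesis using K0[OF u] by simp
    qed
    define \<beta> where "\<beta> u = K (u, 1)" for u
    have "path \<beta>" "path_image \<beta> \<subseteq> C"
      using side[of "\<lambda>x. x" "\<lambda>_. 1"] by (auto simp: \<beta>_def path_def path_image_def)
    moreover have "\<forall>u\<in>{0..1}. \<theta> (\<beta> u) = w u" using \<theta>K by (auto simp: \<beta>_def m_def)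
    ultimately show "\<exists>\<beta>. path \<beta> \<and> path_image \<beta> \<subseteq> C \<and> (\<forall>u\<in>{0..1}. \<theta> (\<beta> u) = w u) \<and>
        (w 0 = \<theta> (\<alpha> 0) \<longrightarrow> \<beta> 0 = \<alpha> 0) \<and> (w 1 = \<theta> (\<alpha> 1) \<longrightarrow> \<beta> 1 = \<alpha> 1)"
      using Kend[of 0] Kend[of 1] by (intro exI[of _ \<beta>]) (auto simp: \<beta>_def)
  qed
qed

section \<open>The lift of a slithering to the universal covering\<close>

text \<open>\<open>deckE\<close> merges regularity of the covering with the slithering condition:
  any two points of \<open>E\<close> over the same point are related by a map over \<open>M\<close>
  that sends fibers of \<open>s\<close> into fibers of \<open>s\<close>. \<open>locC\<close> is what
  the lifting criterion requires of \<open>C\<close>.\<close>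

locale lifted_slithering =
  fixes M :: "'a::topological_space set" and E :: "'b::topological_space set" and p :: "'b \<Rightarrow> 'a"
    and s :: "'b \<Rightarrow> complex" and C :: "'c::topological_space set" and q :: "'c \<Rightarrow> 'a"
    and r :: "'c \<Rightarrow> 'b" and \<theta> :: "'c \<Rightarrow> real"
  assumes covE: "covering_space E p M" and covC: "covering_space C q M"
    and simplyC: "simply_connected C" and C_nonempty: "C \<noteq> {}"
    and locC: "\<And>O' y. openin (top_of_set C) O' \<Longrightarrow> y \<in> O' \<Longrightarrow>
               \<exists>V. openin (top_of_set C) V \<and> y \<in> V \<and> V \<subseteq> O' \<and> path_connected V"
    and r: "continuous_on C r" "r ` C \<subseteq> E" "\<And>x. x \<in> C \<Longrightarrow> p (r x) = q x"
    and \<theta>: "continuous_on C \<theta>" "\<And>x. x \<in> C \<Longrightarrow> s (r x) = cis (\<theta> x)"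
    and triv: "\<And>y. y \<in> sphere 0 1 \<Longrightarrow> \<exists>U h h'. openin (top_of_set (sphere 0 1)) U \<and> y \<in> U \<and>
        homeomorphism (E \<inter> s -` U) (U \<times> fiber E s y) h h' \<and> (\<forall>x\<in>E \<inter> s -` U. fst (h x) = s x)"
    and deckE: "\<And>e e'. e \<in> E \<Longrightarrow> e' \<in> E \<Longrightarrow> p e = p e' \<Longrightarrow> \<exists>\<tau>. continuous_on E \<tau> \<and> \<tau> ` E \<subseteq> E \<and>
        (\<forall>x\<in>E. p (\<tau> x) = p x) \<and> \<tau> e = e' \<and> (\<forall>x\<in>E. \<forall>y\<in>E. s x = s y \<longrightarrow> s (\<tau> x) = s (\<tau> y))"
begin

lemma path_connectedC: "path_connected C"
  using simplyC by (rule simply_connected_path_connected)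

lemma connectedC: "connected C"
  using path_connectedC by (rule path_connected_imp_connected)

lemma squeezableC: "squeezable C \<theta>"
  by (rule slithering_lift_squeezable[OF covE covC r \<theta> triv])

lemma \<theta>_surj: obtains x where "x \<in> C" "\<theta> x = t"
  using squeezable_surj[OF squeezableC C_nonempty] by (metis imageE UNIV_I)

section \<open>Action of the deck transformations on the angle\<close>

text \<open>Invertibility is not built in; where an inverse is needed, a second map is obtained from
  \<open>deck_exists\<close> and \<open>deck_inverse\<close> identifies it as the inverse.\<close>

definition deck :: "('c \<Rightarrow> 'c) \<Rightarrow> bool" where
  "deck \<delta> \<longleftrightarrow> continuous_on C \<delta> \<and> \<delta> ` C \<subseteq> C \<and> (\<forall>x\<in>C. q (\<delta> x) = q x)"

text \<open>Lift \<open>q\<close> through \<open>q\<close> itself.\<close>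

lemma deck_exists:
  assumes "x \<in> C" "x' \<in> C" "q x = q x'"
  obtains \<delta> where "deck \<delta>" "\<delta> x = x'"
proof -
  have qM: "q ` C \<subseteq> M" using covering_space_imp_surjective[OF covC] by simp
  obtain \<delta> where "continuous_on C \<delta>" "\<delta> ` C \<subseteq> C" "\<And>y. y \<in> C \<Longrightarrow> q (\<delta> y) = q y" "\<delta> x = x'"
    by (rule covering_lift[OF covC simplyC locC covering_space_imp_continuous[OF covC] qM assms(1,2)])
       (use assms in auto)
  then show ?thesis using that[of \<delta>] by (auto simp: deck_def)
qed

lemma deck_inverse:
  assumes d: "deck \<delta>" "deck \<delta>'" and x: "x \<in> C" "\<delta>' (\<delta> x) = x" and y: "y \<in> C"
  shows "\<delta>' (\<delta> y) = y"
proof -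
  have "continuous_on C (\<lambda>y. \<delta>' (\<delta> y))"
    by (rule continuous_on_compose2[of C \<delta>' C \<delta>]) (use d in \<open>simp_all add: deck_def\<close>)
  moreover have "\<delta> z \<in> C" "\<delta>' (\<delta> z) \<in> C" "q (\<delta>' (\<delta> z)) = q z" if "z \<in> C" for z
    using d that by (auto simp: deck_def image_subset_iff)
  ultimately show ?thesis
    using x y by (intro covering_lift_unique[OF covC connectedC, where g = "\<lambda>y. \<delta>' (\<delta> y)" and h = "\<lambda>y. y" and a = x and y = y]
      continuous_on_id image_subsetI)
qed

text \<open>\<open>r \<circ> \<delta>\<close> and \<open>\<tau> \<circ> r\<close> are two lifts of
  \<open>q\<close> through \<open>p\<close> that agree at \<open>a\<close>. Hence
  \<open>\<delta>\<close> covers a map \<open>\<tau>\<close> of \<open>E\<close> that respects the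
  fibers of \<open>s\<close>.\<close>

lemma deck_cis:
  assumes d: "deck \<delta>" and ab: "a \<in> C" "b \<in> C" "cis (\<theta> a) = cis (\<theta> b)"
  shows "cis (\<theta> (\<delta> a)) = cis (\<theta> (\<delta> b))"
proof -
  have dC: "\<delta> x \<in> C" if "x \<in> C" for x using d that by (auto simp: deck_def)
  have rC: "r x \<in> E" if "x \<in> C" for x using r that by auto
  have "p (r a) = p (r (\<delta> a))" using ab dC r d by (auto simp: deck_def)
  then obtain \<tau> where \<tau>: "continuous_on E \<tau>" "\<tau> ` E \<subseteq> E" "\<And>x. x \<in> E \<Longrightarrow> p (\<tau> x) = p x" "\<tau> (r a) = r (\<delta> a)"
    "\<And>x y. x \<in> E \<Longrightarrow> y \<in> E \<Longrightarrow> s x = s y \<Longrightarrow> s (\<tau> x) = s (\<tau> y)"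
    using deckE[OF rC[OF ab(1)] rC[OF dC[OF ab(1)]]] by metis
  have c1: "continuous_on C (\<lambda>x. \<tau> (r x))" by (rule continuous_on_compose2[OF \<tau>(1) r(1,2)])
  have c2: "continuous_on C (\<lambda>x. r (\<delta> x))"
    using d by (intro continuous_on_compose2[OF r(1)]) (auto simp: deck_def)
  have "\<tau> (r x) = r (\<delta> x)" if "x \<in> C" for x
    by (rule covering_lift_unique[OF covE connectedC c1 _ c2 _ _ ab(1) \<tau>(4) that])
       (use \<tau> rC dC r(3) d in \<open>auto simp: deck_def\<close>)
  then have "s (r (\<delta> a)) = s (r (\<delta> b))"
    using \<tau>(5)[of "r a" "r b"] rC ab \<theta>(2) by metis
  then show ?thesis using \<theta>(2) dC ab by simp
qed

text \<open>Along a level set the angle of the image is determined up to full turns by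
  \<open>deck_cis\<close>, and the level set is connected.\<close>

lemma deck_level:
  assumes d: "deck \<delta>" and ab: "a \<in> C" "b \<in> C" "\<theta> a = \<theta> b"
  shows "\<theta> (\<delta> a) = \<theta> (\<delta> b)"
proof -
  let ?L = "{x \<in> C. \<theta> x = \<theta> a}"
  have con: "connected ?L"
    by (intro path_connected_imp_connected squeezable_level_path_connected squeezableC \<theta> path_connectedC)
  have "continuous_on C (\<lambda>x. \<theta> (\<delta> x))"
    using d by (intro continuous_on_compose2[OF \<theta>(1)]) (auto simp: deck_def)
  then have c: "continuous_on ?L (\<lambda>x. \<theta> (\<delta> x))" by (rule continuous_on_subset) auto
  have e: "cis (\<theta> (\<delta> x)) = cis (\<theta> (\<delta> a))" if "x \<in> ?L" for x
  proof -
    have x: "x \<in> C" "\<theta> x = \<theta> a" using that by auto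
    show ?thesis by (rule deck_cis[OF d x(1) ab(1)]) (simp only: x(2))
  qed
  have "a \<in> ?L" "b \<in> ?L" using ab by auto
  then have "\<theta> (\<delta> b) = \<theta> (\<delta> a)"
    by (intro cis_lift_unique[OF con c continuous_on_const e _ refl])
  then show ?thesis by simp
qed

text \<open>
  If the angles of the images differed by more than a full turn, some intermediate angle, less than a
  full turn away from \<open>\<theta> a\<close>, would be mapped to the fiber of \<open>\<delta> a\<close>, and the inverse \<open>\<delta>'\<close> would
  send that fiber to two different fibers.
\<close>

lemma deck_period:
  assumes d: "deck \<delta>" "deck \<delta>'" and inv: "\<And>x. x \<in> C \<Longrightarrow> \<delta>' (\<delta> x) = x"
    and ab: "a \<in> C" "b \<in> C" "\<bar>\<theta> a - \<theta> b\<bar> \<le> 2 * pi"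
  shows "\<bar>\<theta> (\<delta> a) - \<theta> (\<delta> b)\<bar> \<le> 2 * pi"
proof -
  have dC: "\<delta> x \<in> C" if "x \<in> C" for x using d that by (auto simp: deck_def)
  \<comment> \<open>\<open>F\<close> is the map induced on angles; by \<open>deck_level\<close> it
    does not depend on the chosen point.\<close>
  define F where "F t = \<theta> (\<delta> (SOME x. x \<in> C \<and> \<theta> x = t))" for t
  have F: "F (\<theta> x) = \<theta> (\<delta> x)" if x: "x \<in> C" for x
  proof -
    have "(SOME y. y \<in> C \<and> \<theta> y = \<theta> x) \<in> C \<and> \<theta> (SOME y. y \<in> C \<and> \<theta> y = \<theta> x) = \<theta> x"
      by (rule someI[where P = "\<lambda>y. y \<in> C \<and> \<theta> y = \<theta> x" and x = x]) (use x in auto)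
    then show ?thesis unfolding F_def using deck_level[OF d(1)] x by blast
  qed
  \<comment> \<open>Preimages of open sets under \<open>F\<close> are images under
    \<open>\<theta>\<close> of open sets, since \<open>\<theta>\<close> is onto, and
    \<open>\<theta>\<close> is open.\<close>
  have contF: "continuous_on UNIV F"
    unfolding continuous_on_open_vimage[OF open_UNIV]
  proof (intro allI impI)
    fix O' :: "real set" assume O': "open O'"
    have "continuous_on C (\<lambda>x. \<theta> (\<delta> x))"
      using d by (intro continuous_on_compose2[OF \<theta>(1)]) (auto simp: deck_def)
    then have "openin (top_of_set C) (C \<inter> (\<lambda>x. \<theta> (\<delta> x)) -` O')" using O' by (rule continuous_openin_preimage_gen)
    then have "open (\<theta> ` (C \<inter> (\<lambda>x. \<theta> (\<delta> x)) -` O'))" by (rule squeezable_open[OF squeezableC])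
    moreover have "\<theta> ` (C \<inter> (\<lambda>x. \<theta> (\<delta> x)) -` O') = F -` O' \<inter> UNIV"
    proof (intro equalityI subsetI)
      fix t assume "t \<in> F -` O' \<inter> UNIV"
      moreover obtain x where "x \<in> C" "\<theta> x = t" using \<theta>_surj .
      ultimately show "t \<in> \<theta> ` (C \<inter> (\<lambda>x. \<theta> (\<delta> x)) -` O')" using F by auto
    next
      fix t assume "t \<in> \<theta> ` (C \<inter> (\<lambda>x. \<theta> (\<delta> x)) -` O')"
      then show "t \<in> F -` O' \<inter> UNIV" using F by auto
    qed
    ultimately show "open (F -` O' \<inter> UNIV)" by simp
  qed
  have key: "\<bar>\<theta> (\<delta> a) - \<theta> (\<delta> b)\<bar> \<le> 2 * pi" if ab: "a \<in> C" "b \<in> C" "\<theta> a \<le> \<theta> b" "\<theta> b - \<theta> a \<le> 2 * pi" for a b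
  proof (rule ccontr)
    assume far: "\<not> \<bar>\<theta> (\<delta> a) - \<theta> (\<delta> b)\<bar> \<le> 2 * pi"
    \<comment> \<open>\<open>v\<close> lies over the same point of the circle as
      \<open>F (\<theta> a)\<close> and strictly between the two end values, so it is attained in
      between.\<close>
    obtain v where v: "v = F (\<theta> a) + 2 * pi \<or> v = F (\<theta> a) - 2 * pi"
      "F (\<theta> a) < v \<and> v < F (\<theta> b) \<or> F (\<theta> b) < v \<and> v < F (\<theta> a)"
    proof (cases "F (\<theta> a) < F (\<theta> b)")
      case True
      then show ?thesis using far F ab pi_gt_zero by (intro that[of "F (\<theta> a) + 2 * pi"]) auto
    next
      case False
      then show ?thesis using far F ab pi_gt_zero by (intro that[of "F (\<theta> a) - 2 * pi"]) auto
    qed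
    have "connected (F ` {\<theta> a..\<theta> b})"
      by (intro connected_continuous_image continuous_on_subset[OF contF]) auto
    moreover have "F (\<theta> a) \<in> F ` {\<theta> a..\<theta> b}" "F (\<theta> b) \<in> F ` {\<theta> a..\<theta> b}" using ab by auto
    ultimately have "v \<in> F ` {\<theta> a..\<theta> b}"
      using v(2) connected_contains_Icc[of "F ` {\<theta> a..\<theta> b}"] by (meson atLeastAtMost_iff less_imp_le subsetD)
    then obtain t where t: "\<theta> a \<le> t" "t \<le> \<theta> b" "F t = v" by auto
    obtain x where x: "x \<in> C" "\<theta> x = t" using \<theta>_surj .
    have ne: "t \<noteq> \<theta> a" "t \<noteq> \<theta> b" using t v(2) by auto
    have "cis v = cis (F (\<theta> a))" using v(1) by (auto simp: cis.ctr cos_diff sin_diff)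
    then have "cis (\<theta> (\<delta> x)) = cis (\<theta> (\<delta> a))" using F x ab t by auto
    then have "cis (\<theta> (\<delta>' (\<delta> x))) = cis (\<theta> (\<delta>' (\<delta> a)))" using deck_cis[OF d(2)] dC x ab by blast
    then have "cis t = cis (\<theta> a)" using inv x ab by simp
    moreover have "\<bar>t - \<theta> a\<bar> < 2 * pi" using t ab ne by auto
    ultimately show False using cis_inj_near ne by blast
  qed
  show ?thesis
  proof (cases "\<theta> a \<le> \<theta> b")
    case True then show ?thesis using key[of a b] ab by auto
  next
    case False then show ?thesis using key[of b a] ab by auto
  qed
qed

section \<open>Uniform bounds from compactness\<close>

text \<open>\<open>R x y l\<close> stands for the existence of a curve of length \<open>l\<close>.
  The geometry enters through additivity, local boundedness and invariance under deck
  transformations, so the argument is independent of the definition of length.\<close>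

lemma uniform_reach:
  fixes R :: "'c \<Rightarrow> 'c \<Rightarrow> real \<Rightarrow> bool" and N :: nat
  assumes M: "compact M"
    and trans: "\<And>x y z l m. R x y l \<Longrightarrow> R y z m \<Longrightarrow> R x z (l + m)"
    and loc: "\<And>x. x \<in> C \<Longrightarrow> \<exists>V K. openin (top_of_set C) V \<and> x \<in> V \<and> (\<forall>a\<in>V. \<forall>b\<in>V. \<exists>l\<le>K. R a b l)"
    and inv: "\<And>\<delta> \<delta>' x y l. deck \<delta> \<Longrightarrow> deck \<delta>' \<Longrightarrow> (\<And>x. x \<in> C \<Longrightarrow> \<delta>' (\<delta> x) = x) \<Longrightarrow>
          (\<And>x. x \<in> C \<Longrightarrow> \<delta> (\<delta>' x) = x) \<Longrightarrow> R x y l \<Longrightarrow> R (\<delta> x) (\<delta> y) l"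
  shows "\<exists>B. \<forall>x\<in>C. \<forall>t. \<bar>t - \<theta> x\<bar> \<le> 2 * pi * real N \<longrightarrow> (\<exists>y\<in>C. \<theta> y = t \<and> (\<exists>l\<le>B. R x y l))"
proof -
  define Rb where "Rb K x y \<longleftrightarrow> (\<exists>l\<le>K. R x y l)" for K x y
  have Rb_trans: "Rb (K + L) x z" if "Rb K x y" "Rb L y z" for K L x y z
    using that trans unfolding Rb_def by (meson add_mono)
  have Rb_mono: "Rb L x y" if "Rb K x y" "K \<le> L" for K L x y
    using that unfolding Rb_def by (meson order_trans)
  have Rb_loc: "\<exists>V K. openin (top_of_set C) V \<and> x \<in> V \<and> (\<forall>a\<in>V. \<forall>b\<in>V. Rb K a b)" if "x \<in> C" for x
    using loc[OF that] unfolding Rb_def .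
  \<comment> \<open>Bisection along a path: lengths add up and are bounded near each of its
    points.\<close>
  have reach: "\<exists>K. Rb K x y" if xy: "x \<in> C" "y \<in> C" for x y
  proof -
    obtain g where g: "path g" "path_image g \<subseteq> C" "g 0 = x" "g 1 = y"
      using path_connected_obtain[OF path_connectedC xy] by metis
    define P where "P a b \<longleftrightarrow> (0 \<le> a \<longrightarrow> b \<le> 1 \<longrightarrow> (\<exists>K. Rb K (g a) (g b)))" for a b :: real
    have "P 0 1"
      using zero_le_one
    proof (induction rule: Bolzano)
      case (trans a b c)
      show ?case
        unfolding P_def
      proof (intro impI)
        assume "0 \<le> a" "c \<le> 1"
        then obtain K L where "Rb K (g a) (g b)" "Rb L (g b) (g c)" using trans unfolding P_def by fastforce
        then show "\<exists>K. Rb K (g a) (g c)" using Rb_trans by blast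
      qed
    next
      case (local t)
      then have "g t \<in> C" using g by (auto simp: path_image_def)
      then obtain V K where V: "openin (top_of_set C) V" "g t \<in> V" "\<forall>a\<in>V. \<forall>b\<in>V. Rb K a b" using Rb_loc by blast
      have "openin (top_of_set {0..1}) ({0..1} \<inter> g -` V)"
        using g V by (intro openin_preimage) (auto simp: path_def path_image_def)
      then obtain S where S: "open S" "{0..1} \<inter> g -` V = {0..1} \<inter> S" by (metis openin_open)
      have "t \<in> {0..1} \<inter> g -` V" using V(2) local by simp
      then have "t \<in> S" unfolding S(2) by simp
      then obtain d where d: "d > 0" "ball t d \<subseteq> S" using S open_contains_ball by blast
      have "\<exists>K. Rb K (g a) (g b)" if ab: "a \<le> t \<and> t \<le> b \<and> b - a < d" "0 \<le> a" "b \<le> 1" for a b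
      proof -
        have "a \<in> {0..1} \<inter> S" "b \<in> {0..1} \<inter> S" using ab d(2) by (auto simp: dist_real_def subset_iff)
        then have "g a \<in> V" "g b \<in> V" using equalityD2[OF S(2)] by blast+
        then show ?thesis using V(3) by blast
      qed
      then show ?case using d(1) unfolding P_def by blast
    qed
    then show ?thesis using g by (simp add: P_def)
  qed
  \<comment> \<open>\<open>\<theta>\<close> is open, so a neighbourhood of \<open>y0\<close> with
    bounded lengths already realises all angles near \<open>t0\<close>.\<close>
  have reach_near: "\<exists>K. \<exists>\<delta>>0. \<forall>t. \<bar>t - t0\<bar> < \<delta> \<longrightarrow> (\<exists>y\<in>C. \<theta> y = t \<and> Rb K x0 y)" if x0: "x0 \<in> C" for x0 t0
  proof -
    obtain y0 where y0: "y0 \<in> C" "\<theta> y0 = t0" using \<theta>_surj .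
    obtain V K where V: "openin (top_of_set C) V" "y0 \<in> V" "\<forall>a\<in>V. \<forall>b\<in>V. Rb K a b" using Rb_loc[OF y0(1)] by blast
    obtain L where L: "Rb L x0 y0" using reach x0 y0 by blast
    have VC: "V \<subseteq> C" using V openin_imp_subset by blast
    have "open (\<theta> ` V)" by (rule squeezable_open[OF squeezableC V(1)])
    moreover have "t0 \<in> \<theta> ` V" using V(2) y0(2) by blast
    ultimately obtain \<delta> where \<delta>: "\<delta> > 0" "ball t0 \<delta> \<subseteq> \<theta> ` V" using open_contains_ball by blast
    have "\<exists>y\<in>C. \<theta> y = t \<and> Rb (L + K) x0 y" if t: "\<bar>t - t0\<bar> < \<delta>" for t
    proof -
      have "t \<in> ball t0 \<delta>" using t by (simp add: dist_real_def abs_minus_commute)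
      then obtain y where y: "y \<in> V" "\<theta> y = t" using \<delta>(2) by blast
      then show ?thesis using V L VC Rb_trans by blast
    qed
    then show ?thesis using \<delta>(1) by blast
  qed
  have reach_interval: "\<exists>K. \<forall>t\<in>{A..B}. \<exists>y\<in>C. \<theta> y = t \<and> Rb K x0 y" if x0: "x0 \<in> C" and "A \<le> B" for x0 A B
    using \<open>A \<le> B\<close>
  proof (induction rule: Bolzano)
    case (trans a b c)
    then obtain K L where KL: "\<forall>t\<in>{a..b}. \<exists>y\<in>C. \<theta> y = t \<and> Rb K x0 y" "\<forall>t\<in>{b..c}. \<exists>y\<in>C. \<theta> y = t \<and> Rb L x0 y"
      by blast
    have "\<exists>y\<in>C. \<theta> y = t \<and> Rb (max K L) x0 y" if t: "t \<in> {a..c}" for t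
    proof (cases "t \<le> b")
      case True then show ?thesis using KL(1) t Rb_mono[OF _ max.cobounded1] by (meson atLeastAtMost_iff)
    next
      case False then show ?thesis using KL(2) t Rb_mono[OF _ max.cobounded2] by (meson atLeastAtMost_iff linear)
    qed
    then show ?case by blast
  next
    case (local t0)
    obtain K \<delta> where K: "\<delta> > 0" "\<And>t. \<bar>t - t0\<bar> < \<delta> \<Longrightarrow> \<exists>y\<in>C. \<theta> y = t \<and> Rb K x0 y"
      using reach_near[OF x0, of t0] by blast
    have "\<exists>K. \<forall>t\<in>{a..b}. \<exists>y\<in>C. \<theta> y = t \<and> Rb K x0 y" if "a \<le> t0 \<and> t0 \<le> b \<and> b - a < \<delta>" for a b
    proof (intro exI ballI)
      fix t assume "t \<in> {a..b}"
      then show "\<exists>y\<in>C. \<theta> y = t \<and> Rb K x0 y" using that by (intro K(2)) auto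
    qed
    then show ?case using K(1) by blast
  qed
  define Adv where "Adv K x \<longleftrightarrow> (\<forall>t. \<bar>t - \<theta> x\<bar> \<le> 2 * pi \<longrightarrow> (\<exists>y\<in>C. \<theta> y = t \<and> Rb K x y))" for K x
  have Adv_mono: "Adv L x" if "Adv K x" "K \<le> L" for K L x
    using that Rb_mono unfolding Adv_def by meson
  have Adv_loc: "\<exists>W K. openin (top_of_set C) W \<and> x0 \<in> W \<and> (\<forall>x\<in>W. Adv K x)" if x0: "x0 \<in> C" for x0
  proof -
    obtain V K where V: "openin (top_of_set C) V" "x0 \<in> V" "\<forall>a\<in>V. \<forall>b\<in>V. Rb K a b" using Rb_loc[OF x0] by blast
    \<comment> \<open>The margin 1 absorbs the change of \<open>\<theta>\<close> within
      \<open>W\<close>, so the window around \<open>\<theta> x0\<close> contains a full turn on both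
      sides of each \<open>\<theta> x\<close>.\<close>
    obtain L where L: "\<forall>t\<in>{\<theta> x0 - (2 * pi + 1)..\<theta> x0 + (2 * pi + 1)}. \<exists>y\<in>C. \<theta> y = t \<and> Rb L x0 y"
      using reach_interval[OF x0, of "\<theta> x0 - (2 * pi + 1)" "\<theta> x0 + (2 * pi + 1)"] pi_gt_zero by auto
    define W where "W = V \<inter> (C \<inter> \<theta> -` ball (\<theta> x0) 1)"
    have "openin (top_of_set C) W"
      unfolding W_def using V by (intro openin_Int[OF V(1)] continuous_openin_preimage_gen \<theta>) auto
    moreover have "x0 \<in> W" using V x0 by (auto simp: W_def)
    moreover have "Adv (K + L) x" if x: "x \<in> W" for x
      unfolding Adv_def
    proof (intro allI impI)
      fix t assume t: "\<bar>t - \<theta> x\<bar> \<le> 2 * pi"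
      have "\<bar>\<theta> x - \<theta> x0\<bar> < 1" using x by (auto simp: W_def dist_real_def)
      then have "t \<in> {\<theta> x0 - (2 * pi + 1)..\<theta> x0 + (2 * pi + 1)}" using t by auto
      then obtain y where "y \<in> C" "\<theta> y = t" "Rb L x0 y" using L by blast
      moreover have "Rb K x x0" using V x by (auto simp: W_def)
      ultimately show "\<exists>y\<in>C. \<theta> y = t \<and> Rb (K + L) x y" using Rb_trans by blast
    qed
    ultimately show ?thesis by blast
  qed
  \<comment> \<open>The target level is pulled back by the inverse, where by
    \<open>deck_period\<close> it is still within a full turn of \<open>x\<close>; it is reached
    from \<open>x\<close>, and the end point is pushed forward again.\<close>
  have Adv_deck: "Adv K x'" if K: "Adv K x" and x: "x \<in> C" "x' \<in> C" "q x = q x'" for K x x'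
    unfolding Adv_def
  proof (intro allI impI)
    fix t assume t: "\<bar>t - \<theta> x'\<bar> \<le> 2 * pi"
    obtain \<delta> where \<delta>: "deck \<delta>" "\<delta> x = x'" using deck_exists[OF x] .
    obtain \<delta>' where \<delta>': "deck \<delta>'" "\<delta>' x' = x" using deck_exists[OF x(2,1) x(3)[symmetric]] .
    have i1: "\<delta>' (\<delta> y) = y" if "y \<in> C" for y
      by (rule deck_inverse[OF \<delta>(1) \<delta>'(1) x(1) _ that]) (simp add: \<delta> \<delta>')
    have i2: "\<delta> (\<delta>' y) = y" if "y \<in> C" for y
      by (rule deck_inverse[OF \<delta>'(1) \<delta>(1) x(2) _ that]) (simp add: \<delta> \<delta>')
    obtain w where w: "w \<in> C" "\<theta> w = t" using \<theta>_surj .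
    have w': "\<delta>' w \<in> C" using \<delta>' w by (auto simp: deck_def)
    have "\<bar>\<theta> (\<delta>' w) - \<theta> (\<delta>' x')\<bar> \<le> 2 * pi"
      by (rule deck_period[OF \<delta>'(1) \<delta>(1) i2 w(1) x(2)]) (use t w in auto)
    then obtain y where y: "y \<in> C" "\<theta> y = \<theta> (\<delta>' w)" "Rb K x y"
      using K \<delta>' unfolding Adv_def by metis
    have "\<theta> (\<delta> y) = t" using deck_level[OF \<delta>(1) y(1) w' y(2)] i2 w by simp
    moreover have "\<delta> y \<in> C" using \<delta> y by (auto simp: deck_def)
    moreover have "Rb K x' (\<delta> y)" using y(3) inv[OF \<delta>(1) \<delta>'(1) i1 i2] \<delta>(2) unfolding Rb_def by metis
    ultimately show "\<exists>y\<in>C. \<theta> y = t \<and> Rb K x' y" by blast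
  qed
  have "\<exists>K. \<forall>x\<in>C. Adv K x"
  proof -
    \<comment> \<open>By \<open>Adv_deck\<close> a bound valid on \<open>W\<close> is valid at all
      points over the image of \<open>W\<close>, so finitely many such images covering
      \<open>M\<close> give a bound on all of \<open>C\<close>.\<close>
    define \<W> where "\<W> = {q ` W |W. openin (top_of_set C) W \<and> (\<exists>K. \<forall>x\<in>W. Adv K x)}"
    have "\<forall>c\<in>\<W>. openin (top_of_set M) c" unfolding \<W>_def using covering_open_map[OF covC] by blast
    moreover have "M \<subseteq> \<Union>\<W>"
    proof
      fix z assume "z \<in> M"
      then obtain x where x: "x \<in> C" "q x = z" using covering_space_imp_surjective[OF covC] by blast
      then show "z \<in> \<Union>\<W>" using Adv_loc[OF x(1)] unfolding \<W>_def by blast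
    qed
    ultimately obtain \<D> where \<D>: "\<D> \<subseteq> \<W>" "finite \<D>" "M \<subseteq> \<Union>\<D>"
      using M unfolding compact_eq_openin_cover by meson
    have "\<exists>K. \<forall>x\<in>C. q x \<in> c \<longrightarrow> Adv K x" if cD: "c \<in> \<D>" for c
    proof -
      obtain W K where W: "c = q ` W" "openin (top_of_set C) W" "\<forall>x\<in>W. Adv K x"
        using \<D>(1) cD unfolding \<W>_def by blast
      have "Adv K x" if x: "x \<in> C" "q x \<in> c" for x
      proof -
        obtain w where "w \<in> W" "q w = q x" using x(2) W(1) by auto
        moreover have "w \<in> C" using \<open>w \<in> W\<close> W(2) openin_imp_subset by blast
        ultimately show ?thesis using Adv_deck[of K w x] W(3) x(1) by blast
      qed
      then show ?thesis by blast
    qed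
    then obtain \<kappa> where \<kappa>: "\<And>c x. c \<in> \<D> \<Longrightarrow> x \<in> C \<Longrightarrow> q x \<in> c \<Longrightarrow> Adv (\<kappa> c) x" by metis
    have "Adv (Max (insert 0 (\<kappa> ` \<D>))) x" if x: "x \<in> C" for x
    proof -
      have "q x \<in> M" using x covering_space_imp_surjective[OF covC] by blast
      then obtain c where c: "c \<in> \<D>" "q x \<in> c" using \<D>(3) by blast
      then show ?thesis using \<D>(2) by (intro Adv_mono[OF \<kappa>[OF c(1) x c(2)]] Max_ge) auto
    qed
    then show ?thesis by blast
  qed
  then obtain K where K: "\<And>x. x \<in> C \<Longrightarrow> Adv K x" by blast
  have "\<exists>B. \<forall>x\<in>C. \<forall>t. \<bar>t - \<theta> x\<bar> \<le> 2 * pi * real N \<longrightarrow> (\<exists>y\<in>C. \<theta> y = t \<and> Rb B x y)"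
  proof (induction N)
    case 0
    have "\<exists>y\<in>C. \<theta> y = t \<and> Rb K x y" if "x \<in> C" "\<bar>t - \<theta> x\<bar> \<le> 2 * pi * real 0" for x t
      using K[OF that(1)] that(2) unfolding Adv_def by auto
    then show ?case by blast
  next
    case (Suc N)
    then obtain B where B: "\<And>x t. x \<in> C \<Longrightarrow> \<bar>t - \<theta> x\<bar> \<le> 2 * pi * real N \<Longrightarrow> \<exists>y\<in>C. \<theta> y = t \<and> Rb B x y" by blast
    have "\<exists>y\<in>C. \<theta> y = t \<and> Rb (B + K) x y" if x: "x \<in> C" and t: "\<bar>t - \<theta> x\<bar> \<le> 2 * pi * real (Suc N)" for x t
    proof -
      \<comment> \<open>\<open>t'\<close> is the target clamped to \<open>N\<close> turns around
        \<open>\<theta> x\<close>; what remains is at most one more turn.\<close>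
      define t' where "t' = max (\<theta> x - 2 * pi * real N) (min (\<theta> x + 2 * pi * real N) t)"
      have t1: "\<bar>t' - \<theta> x\<bar> \<le> 2 * pi * real N" unfolding t'_def by (auto simp: max_def min_def abs_le_iff)
      have t2: "\<bar>t - t'\<bar> \<le> 2 * pi" using t unfolding t'_def by (auto simp: max_def min_def abs_le_iff algebra_simps)
      obtain y where y: "y \<in> C" "\<theta> y = t'" "Rb B x y" using B[OF x t1] by blast
      obtain z where "z \<in> C" "\<theta> z = t" "Rb K y z" using K[OF y(1)] t2 y(2) unfolding Adv_def by auto
      then show ?thesis using Rb_trans y by blast
    qed
    then show ?case by blast
  qed
  then show ?thesis unfolding Rb_def .
qed

end

section \<open>Charts adapted to a fibration over the circle\<close>

definition coord_space :: "nat \<Rightarrow> (nat \<Rightarrow> real) set" where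
  "coord_space n = {x. \<forall>i\<ge>n. x i = 0}"

lemma Euclidean_space_coord_space: "Euclidean_space n = top_of_set (coord_space n)"
  by (simp add: Euclidean_space_def coord_space_def euclidean_product_topology)

lemma homeomorphic_maps_top_of_set:
  "homeomorphic_maps (top_of_set U) (top_of_set V) f g \<longleftrightarrow> homeomorphism U V f g"
proof
  assume "homeomorphic_maps (top_of_set U) (top_of_set V) f g"
  then have 1: "continuous_on U f" "f ` U \<subseteq> V" "continuous_on V g" "g ` V \<subseteq> U"
    "\<And>x. x \<in> U \<Longrightarrow> g (f x) = x" "\<And>x. x \<in> V \<Longrightarrow> f (g x) = x"
    unfolding homeomorphic_maps_def by auto
  then show "homeomorphism U V f g" by (rule_tac homeomorphismI) auto
qed (auto simp: homeomorphism_def homeomorphic_maps_def)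

lemma homeomorphic_spaceD:
  assumes "top_of_set U homeomorphic_space Euclidean_space n"
  obtains f g where "homeomorphism U (coord_space n) f g"
  using assms that
  unfolding homeomorphic_space_def Euclidean_space_coord_space homeomorphic_maps_top_of_set by blast

text \<open>
  Continuity of \<open>s\<close> is not part of \<^const>\<open>fibration\<close>: that \<open>E \<inter> s -` U\<close> is open in \<open>E\<close> for a
  trivialising \<open>U\<close> is a consequence of invariance of domain.
\<close>

lemma openin_manifold_image:
  fixes E :: "'b::topological_space set"
  assumes E: "\<And>x. x \<in> E \<Longrightarrow> \<exists>U. openin (top_of_set E) U \<and> x \<in> U \<and> top_of_set U homeomorphic_space Euclidean_space n"
    and \<Omega>: "openin (top_of_set (coord_space n)) \<Omega>"
    and \<Psi>: "continuous_on \<Omega> \<Psi>" "\<Psi> ` \<Omega> \<subseteq> E" "inj_on \<Psi> \<Omega>"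
  shows "openin (top_of_set E) (\<Psi> ` \<Omega>)"
proof (subst openin_subopen, intro ballI)
  fix x assume "x \<in> \<Psi> ` \<Omega>"
  then obtain z where z: "z \<in> \<Omega>" "x = \<Psi> z" by auto
  then have "x \<in> E" using \<Psi> by auto
  then obtain U where U: "openin (top_of_set E) U" "x \<in> U" "top_of_set U homeomorphic_space Euclidean_space n"
    using E by blast
  obtain \<nu> \<nu>' where \<nu>: "homeomorphism U (coord_space n) \<nu> \<nu>'" using homeomorphic_spaceD[OF U(3)] .
  define W where "W = \<Omega> \<inter> \<Psi> -` U"
  have "openin (top_of_set \<Omega>) W" unfolding W_def using \<Psi>(1,2) U(1) by (rule openin_preimage)
  then have W: "openin (top_of_set (coord_space n)) W" using \<Omega> by (rule openin_trans)
  have W\<Omega>: "W \<subseteq> \<Omega>" "\<Psi> ` W \<subseteq> U" by (auto simp: W_def)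
  have cont: "continuous_on W (\<lambda>z. \<nu> (\<Psi> z))"
    by (rule continuous_on_compose2[OF homeomorphism_cont1[OF \<nu>] continuous_on_subset[OF \<Psi>(1) W\<Omega>(1)] W\<Omega>(2)])
  have im: "(\<lambda>z. \<nu> (\<Psi> z)) ` W \<subseteq> coord_space n"
    using W\<Omega>(2) homeomorphism_image1[OF \<nu>] by blast
  have inj\<nu>: "inj_on \<nu> U" using homeomorphism_apply1[OF \<nu>] by (metis inj_on_inverseI)
  have "inj_on (\<nu> \<circ> \<Psi>) W"
    by (intro comp_inj_on inj_on_subset[OF \<Psi>(3) W\<Omega>(1)] inj_on_subset[OF inj\<nu> W\<Omega>(2)])
  then have inj: "inj_on (\<lambda>z. \<nu> (\<Psi> z)) W" by (simp add: o_def)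
  have Wsub: "W \<subseteq> coord_space n" using W openin_imp_subset by blast
  \<comment> \<open>Read in the chart \<open>\<nu>\<close>, the map is a continuous injection from
    an open subset of the model space into that space, so invariance of domain applies.\<close>
  have open': "openin (top_of_set (coord_space n)) ((\<lambda>z. \<nu> (\<Psi> z)) ` W)"
    unfolding Euclidean_space_coord_space[symmetric]
  proof (rule invariance_of_domain_Euclidean_space[OF _ _ inj])
    show "openin (Euclidean_space n) W" using W by (simp add: Euclidean_space_coord_space)
    have "subtopology (Euclidean_space n) W = top_of_set W"
      using Wsub by (simp add: Euclidean_space_coord_space subtopology_subtopology Int_absorb1)
    then show "continuous_map (subtopology (Euclidean_space n) W) (Euclidean_space n) (\<lambda>z. \<nu> (\<Psi> z))"
      using cont im by (auto simp: Euclidean_space_coord_space)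
  qed
  have "openin (top_of_set U) (U \<inter> \<nu> -` ((\<lambda>z. \<nu> (\<Psi> z)) ` W))"
    by (rule openin_preimage[OF homeomorphism_cont1[OF \<nu>] _ open']) (use homeomorphism_image1[OF \<nu>] in blast)
  moreover have "U \<inter> \<nu> -` ((\<lambda>z. \<nu> (\<Psi> z)) ` W) = \<Psi> ` W"
  proof (intro equalityI subsetI)
    fix v assume v: "v \<in> U \<inter> \<nu> -` ((\<lambda>z. \<nu> (\<Psi> z)) ` W)"
    then obtain z where z: "z \<in> W" "\<nu> v = \<nu> (\<Psi> z)" by blast
    have "\<Psi> z \<in> U" using z(1) W\<Omega>(2) by blast
    then have "v = \<Psi> z" using inj_onD[OF inj\<nu> z(2)] v by blast
    then show "v \<in> \<Psi> ` W" using z(1) by blast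
  qed (use W\<Omega>(2) in blast)
  ultimately have "openin (top_of_set E) (\<Psi> ` W)" using U(1) openin_trans by metis
  moreover have "x \<in> \<Psi> ` W" using z U by (auto simp: W_def)
  ultimately show "\<exists>T. openin (top_of_set E) T \<and> x \<in> T \<and> T \<subseteq> \<Psi> ` \<Omega>" using W\<Omega> by blast
qed

text \<open>Points of \<open>coord_space n\<close> agree from index \<open>n\<close> on, so only the
  first \<open>n\<close> factors of a basic open set matter. The 1 in the minimum covers
  \<open>n = 0\<close>.\<close>

lemma coord_space_box:
  assumes "openin (top_of_set (coord_space n)) \<Omega>" and z0: "z0 \<in> \<Omega>"
  obtains \<eta> where "\<eta> > 0" "{z \<in> coord_space n. \<forall>i<n. \<bar>z i - z0 i\<bar> < \<eta>} \<subseteq> \<Omega>"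
proof -
  obtain O' where O': "open O'" "\<Omega> = coord_space n \<inter> O'" using assms by (metis openin_open)
  then have "openin (product_topology (\<lambda>_. euclidean) UNIV) O'"
    by (simp add: euclidean_product_topology)
  then obtain X where X: "z0 \<in> (\<Pi>\<^sub>E i\<in>UNIV. X i)" "\<And>i. open (X i)" "(\<Pi>\<^sub>E i\<in>UNIV. X i) \<subseteq> O'"
    using product_topology_open_contains_basis[of "\<lambda>_. euclidean" UNIV O' z0] O' z0 by auto
  have "\<exists>\<epsilon>>0. ball (z0 i) \<epsilon> \<subseteq> X i" for i
    using X(1) X(2)[of i] by (auto simp: PiE_def Pi_def open_contains_ball)
  then obtain \<epsilon> where \<epsilon>: "\<And>i. \<epsilon> i > 0" "\<And>i. ball (z0 i) (\<epsilon> i) \<subseteq> X i" by metis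
  define \<eta> where "\<eta> = Min (insert 1 (\<epsilon> ` {..<n}))"
  have "\<eta> > 0" unfolding \<eta>_def using \<epsilon> by auto
  moreover have "z \<in> \<Omega>" if z: "z \<in> coord_space n" "\<forall>i<n. \<bar>z i - z0 i\<bar> < \<eta>" for z
  proof -
    have "z i \<in> X i" for i
    proof (cases "i < n")
      case True
      then have "\<eta> \<le> \<epsilon> i" unfolding \<eta>_def by (intro Min_le) auto
      then have "z i \<in> ball (z0 i) (\<epsilon> i)" using z(2) True by (force simp: dist_real_def abs_minus_commute)
      then show ?thesis using \<epsilon> by blast
    next
      case False
      then have "z i = z0 i" using z(1) z0 O' by (auto simp: coord_space_def)
      then show ?thesis using X(1) by (auto simp: PiE_def Pi_def)
    qed
    then show ?thesis using X(3) O' z by (auto simp: PiE_def Pi_def)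
  qed
  ultimately show ?thesis using that by blast
qed

lemma continuous_on_coordinate: "continuous_on S (\<lambda>z. z i)"
  by (rule continuous_on_product_then_coordinatewise) (rule continuous_on_id)

text \<open>Serves to stretch a small box over the whole model space, onto which a foliation chart
  has to map.\<close>

lemma real_homeomorphic_interval:
  fixes \<eta> :: real assumes "\<eta> > 0"
  obtains f :: "real \<Rightarrow> real" where "continuous_on UNIV f" "inj f" "range f = {-\<eta><..<\<eta>}"
proof -
  have "(UNIV :: real set) homeomorphic {-\<eta><..<\<eta>}"
    using homeomorphic_open_interval_UNIV[of "-\<eta>" \<eta>] assms homeomorphic_sym by auto
  then obtain f g :: "real \<Rightarrow> real" where h: "homeomorphism UNIV {-\<eta><..<\<eta>} f g" unfolding homeomorphic_def by metis
  show ?thesis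
    using that homeomorphism_cont1[OF h] homeomorphism_image1[OF h] homeomorphism_apply1[OF h]
    by (metis UNIV_I injI)
qed

text \<open>The last coordinate determines the angle and the first \<open>n - 1\<close> come from a
  chart of the fiber; the trivialisation combines them. A small box of these coordinates is
  stretched over the whole model space, so the \<open>F\<close> of the statement is
  \<open>t0 + f a\<close>.\<close>

lemma fibration_circle_chart:
  fixes E :: "'b::topological_space set" and s :: "'b \<Rightarrow> complex"
  assumes fib: "fibration n 1 E s (sphere 0 1)" and n: "n \<ge> 1"
    and e: "e \<in> O'" and O': "openin (top_of_set E) O'"
  obtains \<Psi> F where "continuous_on (coord_space n) \<Psi>" "inj_on \<Psi> (coord_space n)" "\<Psi> ` coord_space n \<subseteq> O'"
    "e \<in> \<Psi> ` coord_space n" "continuous_on (\<Psi> ` coord_space n) s"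
    "\<And>z. z \<in> coord_space n \<Longrightarrow> s (\<Psi> z) = cis (F (z (n - 1)))" "\<And>a b. cis (F a) = cis (F b) \<Longrightarrow> a = b"
    "\<And>W. openin (top_of_set (coord_space n)) W \<Longrightarrow> openin (top_of_set E) (\<Psi> ` W)"
proof -
  have Eman: "\<And>x. x \<in> E \<Longrightarrow> \<exists>U. openin (top_of_set E) U \<and> x \<in> U \<and> top_of_set U homeomorphic_space Euclidean_space n"
    using fib by (auto simp: fibration_def topological_manifold_def)
  have O'E: "O' \<subseteq> E" using O' openin_imp_subset by blast
  then have eE: "e \<in> E" using e by blast
  define y where "y = s e"
  have y: "y \<in> sphere 0 1" using fib eE by (auto simp: fibration_def y_def)
  then obtain t0 where t0: "y = cis t0" using cis_Arg[of y] by (metis dist_0_norm mem_sphere norm_zero sgn_eq divide_numeral_1 zero_neq_one div_by_1 of_real_1)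
  obtain U h h' where U: "openin (top_of_set (sphere 0 1)) U" "y \<in> U"
    and h: "homeomorphism (E \<inter> s -` U) (U \<times> fiber E s y) h h'" "\<And>x. x \<in> E \<inter> s -` U \<Longrightarrow> fst (h x) = s x"
    using fib y unfolding fibration_def by metis
  define b where "b = snd (h e)"
  have eU: "e \<in> E \<inter> s -` U" using eE U by (simp add: y_def)
  then have he: "h e = (y, b)" using h(2)[OF eU] by (simp add: b_def y_def prod_eq_iff)
  then have b: "b \<in> fiber E s y" using homeomorphism_image1[OF h(1)] eU by (metis imageI mem_Sigma_iff)
  have "topological_manifold (n - 1) (fiber E s y)" using fib y by (auto simp: fibration_def)
  then obtain B0 where B0: "openin (top_of_set (fiber E s y)) B0" "b \<in> B0" "top_of_set B0 homeomorphic_space Euclidean_space (n - 1)"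
    using b unfolding topological_manifold_def by blast
  obtain \<beta> \<beta>' where \<beta>: "homeomorphism B0 (coord_space (n - 1)) \<beta> \<beta>'" using homeomorphic_spaceD[OF B0(3)] .
  have B0f: "B0 \<subseteq> fiber E s y" using B0 openin_imp_subset by blast
  define P where "P z = z(n - 1 := 0)" for z :: "nat \<Rightarrow> real"
  have P: "P z \<in> coord_space (n - 1)" if "z \<in> coord_space n" for z
    using that n by (auto simp: P_def coord_space_def)
  have contP: "continuous_on S P" for S
    unfolding P_def
  proof (rule continuous_on_coordinatewise_then_product)
    fix i show "continuous_on S (\<lambda>z. (z(n - 1 := 0)) i)"
      by (cases "i = n - 1") (auto intro: continuous_on_coordinate)
  qed
  \<comment> \<open>Angles within \<open>pi\<close> of \<open>t0\<close> make \<open>cis\<close>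
    injective; the second condition keeps the point of the circle in the base of the
    trivialisation.\<close>
  define \<Omega> where "\<Omega> = (coord_space n \<inter> (\<lambda>z. z (n - 1)) -` ball t0 pi) \<inter> (coord_space n \<inter> (\<lambda>z. cis (z (n - 1))) -` U)"
  have \<Omega>: "openin (top_of_set (coord_space n)) \<Omega>"
    unfolding \<Omega>_def
  proof (rule openin_Int)
    show "openin (top_of_set (coord_space n)) (coord_space n \<inter> (\<lambda>z. z (n - 1)) -` ball t0 pi)"
      by (rule continuous_openin_preimage_gen) (auto intro: continuous_on_coordinate)
    show "openin (top_of_set (coord_space n)) (coord_space n \<inter> (\<lambda>z. cis (z (n - 1))) -` U)"
      by (rule openin_preimage[OF _ _ U(1)]) (auto intro!: continuous_intros continuous_on_coordinate simp: dist_norm)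
  qed
  have \<Omega>s: "\<Omega> \<subseteq> coord_space n" by (auto simp: \<Omega>_def)
  define \<Psi>0 where "\<Psi>0 z = h' (cis (z (n - 1)), \<beta>' (P z))" for z
  have pair: "(cis (z (n - 1)), \<beta>' (P z)) \<in> U \<times> fiber E s y" if "z \<in> \<Omega>" for z
  proof -
    have "\<beta>' (P z) \<in> B0" using P that \<Omega>s homeomorphism_image2[OF \<beta>] by blast
    then show ?thesis using that B0f by (auto simp: \<Omega>_def)
  qed
  have \<Psi>0U: "\<Psi>0 z \<in> E \<inter> s -` U" if "z \<in> \<Omega>" for z
    unfolding \<Psi>0_def using pair[OF that] homeomorphism_image2[OF h(1)] by blast
  have h\<Psi>0: "h (\<Psi>0 z) = (cis (z (n - 1)), \<beta>' (P z))" if "z \<in> \<Omega>" for z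
    unfolding \<Psi>0_def using homeomorphism_apply2[OF h(1) pair[OF that]] .
  have s\<Psi>0: "s (\<Psi>0 z) = cis (z (n - 1))" if "z \<in> \<Omega>" for z
    using h(2)[OF \<Psi>0U[OF that]] h\<Psi>0[OF that] by simp
  have cont\<Psi>0: "continuous_on \<Omega> \<Psi>0"
    unfolding \<Psi>0_def
  proof (rule continuous_on_compose2[OF homeomorphism_cont2[OF h(1)]])
    have "continuous_on \<Omega> (\<lambda>z. \<beta>' (P z))"
      by (rule continuous_on_compose2[OF homeomorphism_cont2[OF \<beta>] contP]) (use P \<Omega>s in blast)
    then show "continuous_on \<Omega> (\<lambda>z. (cis (z (n - 1)), \<beta>' (P z)))"
      by (intro continuous_intros continuous_on_coordinate)
  qed (use pair in blast)
  have inj\<Psi>0: "inj_on \<Psi>0 \<Omega>"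
  proof (rule inj_onI)
    fix z z' assume z: "z \<in> \<Omega>" "z' \<in> \<Omega>" "\<Psi>0 z = \<Psi>0 z'"
    then have eq: "cis (z (n - 1)) = cis (z' (n - 1))" "\<beta>' (P z) = \<beta>' (P z')" using h\<Psi>0 by (metis prod.inject)+
    have "\<bar>z (n - 1) - t0\<bar> < pi" "\<bar>z' (n - 1) - t0\<bar> < pi"
      using z by (auto simp: \<Omega>_def dist_real_def abs_minus_commute)
    then have 1: "z (n - 1) = z' (n - 1)" by (intro cis_inj_near[OF eq(1)]) linarith
    have "P z = P z'" using eq(2) P z \<Omega>s homeomorphism_apply2[OF \<beta>] by (metis subsetD)
    then show "z = z'" using 1 unfolding P_def by (metis fun_upd_triv fun_upd_upd)
  qed
  define z0 where "z0 = (\<beta> b)(n - 1 := t0)"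
  have \<beta>b: "\<beta> b \<in> coord_space (n - 1)" using B0 homeomorphism_image1[OF \<beta>] by blast
  then have z0: "z0 \<in> coord_space n" using n by (auto simp: z0_def coord_space_def)
  have z0n: "z0 (n - 1) = t0" by (simp add: z0_def)
  have "z0 \<in> \<Omega>" using z0 z0n U t0 by (auto simp: \<Omega>_def)
  have "P z0 = \<beta> b" using \<beta>b by (auto simp: P_def z0_def coord_space_def fun_eq_iff)
  then have "\<Psi>0 z0 = e"
    using z0n t0 he homeomorphism_apply1[OF \<beta> B0(2)] homeomorphism_apply1[OF h(1) eU] by (simp add: \<Psi>0_def)
  define \<Omega>1 where "\<Omega>1 = \<Omega> \<inter> \<Psi>0 -` O'"
  have "openin (top_of_set \<Omega>) \<Omega>1"
    unfolding \<Omega>1_def by (rule openin_preimage[OF cont\<Psi>0 _ O']) (use \<Psi>0U in blast)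
  then have \<Omega>1: "openin (top_of_set (coord_space n)) \<Omega>1" using \<Omega> by (rule openin_trans)
  have "z0 \<in> \<Omega>1" using \<open>z0 \<in> \<Omega>\<close> \<open>\<Psi>0 z0 = e\<close> e by (simp add: \<Omega>1_def)
  then obtain \<eta> where \<eta>: "\<eta> > 0" "{z \<in> coord_space n. \<forall>i<n. \<bar>z i - z0 i\<bar> < \<eta>} \<subseteq> \<Omega>1"
    by (rule coord_space_box[OF \<Omega>1])
  obtain f :: "real \<Rightarrow> real" where f: "continuous_on UNIV f" "inj f" "range f = {-\<eta><..<\<eta>}"
    using real_homeomorphic_interval[OF \<eta>(1)] .
  \<comment> \<open>As \<open>f\<close> takes values of modulus below \<open>\<eta>\<close>, the
    whole model space is mapped into the box around \<open>z0\<close>.\<close>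
  define G where "G z = (\<lambda>i. if i < n then z0 i + f (z i) else 0)" for z
  have f_bd: "\<bar>f a\<bar> < \<eta>" for a using f(3) by (metis abs_less_iff greaterThanLessThan_iff minus_less_iff rangeI)
  have G\<Omega>: "G z \<in> \<Omega>1" for z
    by (rule subsetD[OF \<eta>(2)]) (use f_bd in \<open>auto simp: G_def coord_space_def\<close>)
  have contG: "continuous_on (coord_space n) G"
    unfolding G_def
  proof (rule continuous_on_coordinatewise_then_product)
    fix i show "continuous_on (coord_space n) (\<lambda>z. if i < n then z0 i + f (z i) else 0)"
      by (cases "i < n") (auto intro!: continuous_intros continuous_on_compose2[OF f(1) continuous_on_coordinate])
  qed
  have injG: "inj_on G (coord_space n)"
  proof (rule inj_onI)
    fix z z' assume z: "z \<in> coord_space n" "z' \<in> coord_space n" "G z = G z'"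
    have "z i = z' i" for i
    proof (cases "i < n")
      case True
      then have "f (z i) = f (z' i)" using fun_cong[OF z(3), of i] by (simp add: G_def)
      then show ?thesis using f(2) by (simp add: inj_def)
    next
      case False then show ?thesis using z by (simp add: coord_space_def)
    qed
    then show "z = z'" by blast
  qed
  define \<Psi> where "\<Psi> z = \<Psi>0 (G z)" for z
  have \<Omega>1\<Omega>: "\<Omega>1 \<subseteq> \<Omega>" by (auto simp: \<Omega>1_def)
  have G\<Omega>': "G z \<in> \<Omega>" for z using G\<Omega> \<Omega>1\<Omega> by blast
  have c\<Psi>: "continuous_on (coord_space n) \<Psi>"
    unfolding \<Psi>_def by (rule continuous_on_compose2[OF cont\<Psi>0 contG]) (use G\<Omega>' in blast)
  have i\<Psi>: "inj_on \<Psi> (coord_space n)"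
    unfolding \<Psi>_def using inj\<Psi>0 injG G\<Omega>' by (auto simp: inj_on_def)
  have sub\<Psi>: "\<Psi> ` coord_space n \<subseteq> O'" unfolding \<Psi>_def using G\<Omega> by (auto simp: \<Omega>1_def)
  obtain c where c: "f c = 0" using f(3) \<eta>(1) by (metis greaterThanLessThan_iff imageE neg_less_0_iff_less)
  have "G (\<lambda>i. if i < n then c else 0) = z0" using c z0 by (auto simp: G_def coord_space_def fun_eq_iff)
  moreover have "(\<lambda>i. if i < n then c else 0) \<in> coord_space n" by (auto simp: coord_space_def)
  ultimately have e\<Psi>: "e \<in> \<Psi> ` coord_space n" using \<open>\<Psi>0 z0 = e\<close> unfolding \<Psi>_def by (metis imageI)
  have "continuous_on (E \<inter> s -` U) (\<lambda>x. fst (h x))"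
    by (intro continuous_on_fst homeomorphism_cont1[OF h(1)])
  then have "continuous_on (E \<inter> s -` U) s" by (rule continuous_on_eq) (use h(2) in blast)
  moreover have "\<Psi> ` coord_space n \<subseteq> E \<inter> s -` U" unfolding \<Psi>_def using \<Psi>0U G\<Omega>' by blast
  ultimately have cs: "continuous_on (\<Psi> ` coord_space n) s" by (rule continuous_on_subset)
  have s\<Psi>: "s (\<Psi> z) = cis (t0 + f (z (n - 1)))" for z
    unfolding \<Psi>_def using s\<Psi>0[OF G\<Omega>', of z] n z0n by (simp add: G_def)
  have injF: "a = b" if "cis (t0 + f a) = cis (t0 + f b)" for a b
  proof -
    \<comment> \<open>Test points with arbitrary last coordinate \<open>a\<close>, from which
      \<open>\<bar>f a\<bar> < pi\<close> is read off for every \<open>a\<close>.\<close>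
    define za :: "real \<Rightarrow> nat \<Rightarrow> real" where "za a = (\<lambda>i. if i = n - 1 then a else 0)" for a
    have za: "za a \<in> coord_space n" for a using n by (auto simp: za_def coord_space_def)
    have "\<bar>G (za a) (n - 1) - t0\<bar> < pi" for a
      using G\<Omega>'[of "za a"] by (auto simp: \<Omega>_def dist_real_def abs_minus_commute)
    then have "\<bar>f a\<bar> < pi" for a using n z0n by (simp add: G_def za_def)
    from this[of a] this[of b] have "t0 + f a = t0 + f b" by (intro cis_inj_near[OF that]) linarith
    then show ?thesis using f(2) by (simp add: inj_def)
  qed
  have op: "openin (top_of_set E) (\<Psi> ` W)" if W: "openin (top_of_set (coord_space n)) W" for W
  proof (rule openin_manifold_image[OF Eman W])
    have Ws: "W \<subseteq> coord_space n" using W openin_imp_subset by blast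
    show "continuous_on W \<Psi>" using c\<Psi> Ws by (rule continuous_on_subset)
    show "inj_on \<Psi> W" using i\<Psi> Ws by (rule inj_on_subset)
    show "\<Psi> ` W \<subseteq> E" using sub\<Psi> Ws O'E by blast
  qed
  show ?thesis by (rule that[OF c\<Psi> i\<Psi> sub\<Psi> e\<Psi> cs s\<Psi> injF op])
qed

lemma fibration_circle_continuous:
  fixes E :: "'b::topological_space set" and s :: "'b \<Rightarrow> complex"
  assumes fib: "fibration n 1 E s (sphere 0 1)" and n: "n \<ge> 1"
  shows "continuous_on E s"
proof (rule continuous_on_open_cover)
  fix e assume "e \<in> E"
  then obtain \<Psi> where "e \<in> \<Psi> ` coord_space n" "continuous_on (\<Psi> ` coord_space n) s"
    "\<And>W. openin (top_of_set (coord_space n)) W \<Longrightarrow> openin (top_of_set E) (\<Psi> ` W)"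
    using fibration_circle_chart[OF fib n _ openin_subtopology_self] by metis
  then show "\<exists>W. openin (top_of_set E) W \<and> e \<in> W \<and> continuous_on W s"
    using openin_subtopology_self by blast
qed

section \<open>Distances in the universal covering\<close>

text \<open>In coordinates these charts of the lifted atlas are balls: segments stay in them, and
  the closed ball inside the image of \<open>D i\<close> provides the compactness for bounding a
  metric.\<close>

lemma covering_chart_ball:
  fixes M :: "'a::topological_space set" and C :: "'c::topological_space set"
    and \<phi> :: "'i \<Rightarrow> 'a \<Rightarrow> 'e::euclidean_space"
  assumes sm: "smooth_manifold M I D \<phi>" and covC: "covering_space C q M"
    and O': "openin (top_of_set C) O'" and x: "x \<in> O'"
  obtains i V c \<rho> k where "i \<in> I" "openin (top_of_set C) V" "x \<in> V" "V \<subseteq> O'" "inj_on q V" "q ` V \<subseteq> D i"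
    "cball c \<rho> \<subseteq> \<phi> i ` D i" "homeomorphism V (ball c \<rho>) (\<lambda>y. \<phi> i (q y)) k"
proof -
  have xC: "x \<in> C" using O' x openin_imp_subset by blast
  then have "q x \<in> M" using covering_space_imp_surjective[OF covC] by blast
  then obtain i where i: "i \<in> I" "q x \<in> D i" using sm unfolding smooth_manifold_def by blast
  have Di: "openin (top_of_set M) (D i)" "open (\<phi> i ` D i)" and "\<exists>\<psi>. homeomorphism (D i) (\<phi> i ` D i) (\<phi> i) \<psi>"
    using sm i unfolding smooth_manifold_def by blast+
  then obtain \<psi> where \<psi>: "homeomorphism (D i) (\<phi> i ` D i) (\<phi> i) \<psi>" by blast
  obtain T u k1 where T: "x \<in> T" "openin (top_of_set C) T" and k1: "homeomorphism T u q k1"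
    using covering_space_local_homeomorphism[OF covC xC] by metis
  have qC: "continuous_on C q" by (rule covering_space_imp_continuous[OF covC])
  define T' where "T' = T \<inter> O' \<inter> (C \<inter> q -` D i)"
  have T': "openin (top_of_set C) T'"
    unfolding T'_def
    by (intro openin_Int T O' openin_preimage[OF qC _ Di(1)]) (use covering_space_imp_surjective[OF covC] in blast)
  have xT': "x \<in> T'" using T x xC i by (simp add: T'_def)
  have T'C: "T' \<subseteq> C" and T'T: "T' \<subseteq> T" and T'D: "q ` T' \<subseteq> D i" by (auto simp: T'_def)
  have "openin (top_of_set M) (q ` T')" by (rule covering_open_map[OF covC T'])
  then have "openin (top_of_set (D i)) (q ` T')"
    using T'D Di(1) openin_imp_subset openin_subset_trans by metis
  then have "openin (top_of_set (\<phi> i ` D i)) (\<phi> i ` q ` T')"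
    using homeomorphism_imp_open_map[OF \<psi>] by blast
  then have op: "open (\<phi> i ` q ` T')" using Di(2) openin_open_trans by blast
  define c where "c = \<phi> i (q x)"
  have "c \<in> \<phi> i ` q ` T'" using xT' by (auto simp: c_def)
  then obtain \<rho> where \<rho>: "\<rho> > 0" "cball c \<rho> \<subseteq> \<phi> i ` q ` T'" using op open_contains_cball by blast
  define V where "V = T' \<inter> (\<lambda>y. \<phi> i (q y)) -` ball c \<rho>"
  have cont: "continuous_on T' (\<lambda>y. \<phi> i (q y))"
    by (rule continuous_on_compose2[OF homeomorphism_cont1[OF \<psi>] continuous_on_subset[OF qC T'C] T'D])
  have "openin (top_of_set T') V" unfolding V_def using cont by (rule continuous_openin_preimage_gen) auto
  then have V: "openin (top_of_set C) V" using T' by (rule openin_trans)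
  have VT: "V \<subseteq> T'" by (auto simp: V_def)
  define k where "k w = k1 (\<psi> w)" for w
  have kw: "k w \<in> V \<and> \<phi> i (q (k w)) = w" if w: "w \<in> ball c \<rho>" for w
  proof -
    obtain y where y: "y \<in> T'" "w = \<phi> i (q y)" using w \<rho>(2) ball_subset_cball by blast
    then have "k w = y"
      using homeomorphism_apply1[OF \<psi>] homeomorphism_apply1[OF k1] T'D T'T by (auto simp: k_def image_subset_iff)
    then show ?thesis using y w by (simp add: V_def)
  qed
  have ky: "k (\<phi> i (q y)) = y" if "y \<in> V" for y
    using that VT homeomorphism_apply1[OF \<psi>] homeomorphism_apply1[OF k1] T'D T'T by (auto simp: k_def image_subset_iff subset_iff)
  have \<psi>u: "\<psi> ` ball c \<rho> \<subseteq> u"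
  proof
    fix z assume "z \<in> \<psi> ` ball c \<rho>"
    then obtain y where "y \<in> T'" "z = \<psi> (\<phi> i (q y))" using \<rho>(2) ball_subset_cball by blast
    then have "z = q y" "y \<in> T" using homeomorphism_apply1[OF \<psi>] T'D T'T by auto
    then show "z \<in> u" using homeomorphism_image1[OF k1] by blast
  qed
  have ballD: "cball c \<rho> \<subseteq> \<phi> i ` D i" using \<rho>(2) T'D by blast
  have "continuous_on (ball c \<rho>) \<psi>"
    using homeomorphism_cont2[OF \<psi>] ballD ball_subset_cball by (rule_tac continuous_on_subset) auto
  then have contk: "continuous_on (ball c \<rho>) k"
    unfolding k_def by (rule continuous_on_compose2[OF homeomorphism_cont2[OF k1] _ \<psi>u])
  have hom: "homeomorphism V (ball c \<rho>) (\<lambda>y. \<phi> i (q y)) k"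
    by (rule homeomorphismI[OF continuous_on_subset[OF cont VT] contk]) (use kw ky in \<open>auto simp: V_def\<close>)
  have "x \<in> V" using xT' \<rho>(1) by (simp add: V_def c_def)
  moreover have "V \<subseteq> O'" "q ` V \<subseteq> D i" using VT T'D by (auto simp: T'_def)
  moreover have "inj_on q V"
    using VT T'T homeomorphism_apply1[OF k1] by (metis inj_on_inverseI inj_on_subset)
  ultimately show ?thesis using that[OF i(1) V _ _ _ _ ballD hom] by blast
qed

lemma covering_locally_path_connected:
  fixes M :: "'a::topological_space set" and C :: "'c::topological_space set"
    and \<phi> :: "'i \<Rightarrow> 'a \<Rightarrow> 'e::euclidean_space"
  assumes sm: "smooth_manifold M I D \<phi>" and covC: "covering_space C q M"
    and O': "openin (top_of_set C) O'" "x \<in> O'"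
  shows "\<exists>V. openin (top_of_set C) V \<and> x \<in> V \<and> V \<subseteq> O' \<and> path_connected V"
proof -
  obtain i V c \<rho> k where V: "openin (top_of_set C) V" "x \<in> V" "V \<subseteq> O'"
    "homeomorphism V (ball c \<rho>) (\<lambda>y. \<phi> i (q y)) k"
    using covering_chart_ball[OF sm covC O'] by metis
  have "path_connected (ball c \<rho>)" by (simp add: convex_imp_path_connected)
  then have "path_connected (k ` ball c \<rho>)"
    by (rule path_connected_continuous_image[OF homeomorphism_cont2[OF V(4)]])
  then show ?thesis using V homeomorphism_image2[OF V(4)] by auto
qed

text \<open>Expand in the standard basis: there are finitely many coefficients, continuous and hence
  bounded on the compact set.\<close>

lemma bilinear_form_bounded_on_compact:
  fixes g :: "'e::euclidean_space \<Rightarrow> 'e \<Rightarrow> 'e \<Rightarrow> real"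
  assumes S: "compact S" and bil: "\<And>x. x \<in> S \<Longrightarrow> bilinear (g x)"
    and cont: "\<And>v w. continuous_on S (\<lambda>x. g x v w)"
  obtains G where "G \<ge> 0" "\<And>x w. x \<in> S \<Longrightarrow> g x w w \<le> G * (norm w)\<^sup>2"
proof -
  have "\<exists>B. \<forall>x\<in>S. \<bar>g x v w\<bar> \<le> B" for v w
  proof -
    have "compact ((\<lambda>x. g x v w) ` S)" by (rule compact_continuous_image[OF cont S])
    then obtain B where "\<forall>t\<in>(\<lambda>x. g x v w) ` S. norm t \<le> B" using compact_imp_bounded bounded_iff by metis
    then show ?thesis by auto
  qed
  then obtain B where B: "\<And>v w x. x \<in> S \<Longrightarrow> \<bar>g x v w\<bar> \<le> B v w" by metis
  define G where "G = (\<Sum>b\<in>Basis. \<Sum>b'\<in>Basis. \<bar>B b' b\<bar>)"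
  have "g x w w \<le> G * (norm w)\<^sup>2" if x: "x \<in> S" for x w
  proof -
    interpret L: linear "\<lambda>v. g x v w'" for w' using bil[OF x] by (simp add: bilinear_def)
    interpret R: linear "g x v" for v using bil[OF x] by (simp add: bilinear_def)
    have "g x w w = g x (\<Sum>b\<in>Basis. (w \<bullet> b) *\<^sub>R b) (\<Sum>b\<in>Basis. (w \<bullet> b) *\<^sub>R b)"
      by (simp add: euclidean_representation)
    also have "\<dots> = (\<Sum>b\<in>Basis. \<Sum>b'\<in>Basis. (w \<bullet> b) * ((w \<bullet> b') * g x b' b))"
      by (simp only: L.sum R.sum L.scaleR R.scaleR real_scaleR_def sum_distrib_left)
    also have "\<dots> \<le> (\<Sum>b\<in>Basis. \<Sum>b'\<in>Basis. \<bar>B b' b\<bar> * (norm w)\<^sup>2)"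
    proof (intro sum_mono)
      fix b b' :: 'e assume b: "b \<in> Basis" "b' \<in> Basis"
      have "(w \<bullet> b) * ((w \<bullet> b') * g x b' b) \<le> \<bar>w \<bullet> b\<bar> * (\<bar>w \<bullet> b'\<bar> * \<bar>g x b' b\<bar>)"
        by (metis abs_ge_self abs_mult)
      also have "\<dots> \<le> norm w * (norm w * \<bar>B b' b\<bar>)"
      proof -
        have "\<bar>g x b' b\<bar> \<le> \<bar>B b' b\<bar>" using B[OF x, where v = b' and w = b] by linarith
        then show ?thesis using Basis_le_norm[OF b(1), of w] Basis_le_norm[OF b(2), of w] by (intro mult_mono) auto
      qed
      finally show "(w \<bullet> b) * ((w \<bullet> b') * g x b' b) \<le> \<bar>B b' b\<bar> * (norm w)\<^sup>2"
        by (simp add: power2_eq_square mult_ac)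
    qed
    also have "\<dots> = G * (norm w)\<^sup>2" by (simp add: G_def sum_distrib_right)
    finally show ?thesis .
  qed
  moreover have "G \<ge> 0" unfolding G_def by (intro sum_nonneg) auto
  ultimately show ?thesis using that by blast
qed

lemma riemannian_metricD:
  assumes g: "riemannian_metric I D \<phi> g" and i: "i \<in> I"
  shows "x \<in> \<phi> i ` D i \<Longrightarrow> bilinear (g i x)" "x \<in> \<phi> i ` D i \<Longrightarrow> v \<noteq> 0 \<Longrightarrow> 0 < g i x v v"
    "smooth_on (\<phi> i ` D i) (\<lambda>x. g i x v w)"
  using g[unfolded riemannian_metric_def, THEN conjunct1] i
    g[unfolded riemannian_metric_def, THEN conjunct2, THEN conjunct1] by auto

text \<open>Straight segments in the coordinates of a ball chart have bounded velocity, and the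
  metric is bounded on the closed ball.\<close>

lemma joined_by_length_local:
  fixes M :: "'a::topological_space set" and C :: "'c::topological_space set"
    and \<phi> :: "'i \<Rightarrow> 'a \<Rightarrow> 'e::euclidean_space"
  assumes sm: "smooth_manifold M I D \<phi>" and covC: "covering_space C q M"
    and g: "riemannian_metric I D \<phi> g" and x: "x \<in> C"
  shows "\<exists>V K. openin (top_of_set C) V \<and> x \<in> V \<and> (\<forall>a\<in>V. \<forall>b\<in>V. \<exists>l\<le>K.
    joined_by_length (lift_index C q I D) snd (\<lambda>(i, V). \<phi> i \<circ> q) (\<lambda>(i, V). g i) a b l)"
proof -
  obtain i V c \<rho> k where i: "i \<in> I" and V: "openin (top_of_set C) V" "x \<in> V" "inj_on q V" "q ` V \<subseteq> D i"
    and ball: "cball c \<rho> \<subseteq> \<phi> i ` D i" and hom: "homeomorphism V (ball c \<rho>) (\<lambda>y. \<phi> i (q y)) k"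
    using covering_chart_ball[OF sm covC openin_subtopology_self x] by metis
  have bil: "bilinear (g i y)" if "y \<in> cball c \<rho>" for y
    using riemannian_metricD(1)[OF g i subsetD[OF ball that]] .
  have cont: "continuous_on (cball c \<rho>) (\<lambda>y. g i y v w)" for v w
  proof -
    have "Ck_on 0 (\<phi> i ` D i) (\<lambda>x. g i x v w)" 
      using riemannian_metricD(3)[OF g i] unfolding smooth_on_def ..
    then show ?thesis using ball by (auto intro: continuous_on_subset)
  qed
  obtain G where G: "G \<ge> 0" "\<And>y w. y \<in> cball c \<rho> \<Longrightarrow> g i y w w \<le> G * (norm w)\<^sup>2"
    using bilinear_form_bounded_on_compact[OF compact_cball bil cont] by blast
  \<comment> \<open>The coordinate velocity of a segment is the difference of two points of the
    ball, of norm at most \<open>2 * \<rho>\<close>.\<close>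
  define K where "K = sqrt (G * (2 * \<rho>)\<^sup>2)"
  have "\<exists>l\<le>K. joined_by_length (lift_index C q I D) snd (\<lambda>(i, V). \<phi> i \<circ> q) (\<lambda>(i, V). g i) a b l"
    if ab: "a \<in> V" "b \<in> V" for a b
  proof -
    define va vb where "va = \<phi> i (q a)" and "vb = \<phi> i (q b)"
    have vab: "va \<in> ball c \<rho>" "vb \<in> ball c \<rho>" using ab homeomorphism_image1[OF hom] by (auto simp: va_def vb_def)
    define w where "w = vb - va"
    define l where "l t = va + t *\<^sub>R w" for t :: real
    have l: "l t \<in> ball c \<rho>" if "t \<in> {0..1}" for t
    proof -
      have "(1 - t) *\<^sub>R va + t *\<^sub>R vb \<in> ball c \<rho>"
        using convexD[OF convex_ball vab, of "1 - t" t] that by simp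
      then show ?thesis by (simp add: l_def w_def algebra_simps)
    qed
    define cc where "cc t = k (l t)" for t
    have cV: "cc ` {0..1} \<subseteq> V" using l homeomorphism_image2[OF hom] by (auto simp: cc_def)
    have \<phi>c: "\<phi> i (q (cc t)) = l t" if "t \<in> {0..1}" for t
      using homeomorphism_apply2[OF hom l[OF that]] by (simp add: cc_def)
    have c01: "cc 0 = a" "cc 1 = b"
      using homeomorphism_apply1[OF hom ab(1)] homeomorphism_apply1[OF hom ab(2)]
      by (simp_all add: cc_def l_def w_def va_def vb_def)
    have idx: "(i, V) \<in> lift_index C q I D" using i V by (simp add: lift_index_def)
    have der: "((((\<lambda>(i, V). \<phi> i \<circ> q) (i, V)) \<circ> cc) has_vector_derivative (\<lambda>_. w) t) (at t within {0..1})"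
      if t: "t \<in> {0..1}" for t
    proof -
      have "(l has_vector_derivative w) (at t within {0..1})"
        unfolding l_def by (auto intro!: derivative_eq_intros)
      then show ?thesis
        by (rule has_vector_derivative_transform[OF t, rotated]) (use \<phi>c in auto)
    qed
    let ?f = "\<lambda>t. sqrt ((\<lambda>(i, V). g i) (i, V) (((\<lambda>(i, V). \<phi> i \<circ> q) (i, V)) (cc t)) ((\<lambda>_. w) t) ((\<lambda>_. w) t))"
    have "joined_by_length (lift_index C q I D) snd (\<lambda>(i, V). \<phi> i \<circ> q) (\<lambda>(i, V). g i) (cc 0) (cc 1)
        (integral {0..1} ?f)"
      by (rule joined_by_length.arc[where I = "lift_index C q I D" and D = snd and \<phi> = "\<lambda>(i, V). \<phi> i \<circ> q" and c = cc
            and u' = "\<lambda>_. w", OF idx]) (use cV in simp, rule der, simp_all)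
    moreover have "integral {0..1} ?f \<le> K"
    proof (cases "?f integrable_on {0..1}")
      case True
      have "norm w \<le> 2 * \<rho>"
      proof -
        have "dist va vb \<le> dist c va + dist c vb" by (metis dist_commute dist_triangle)
        then show ?thesis using vab by (simp add: w_def dist_norm norm_minus_commute)
      qed
      have "?f t \<le> K" if t: "t \<in> {0..1}" for t
      proof -
        have "g i (l t) w w \<le> G * (norm w)\<^sup>2" using G(2) l[OF t] ball_subset_cball by blast
        also have "\<dots> \<le> G * (2 * \<rho>)\<^sup>2" using \<open>norm w \<le> 2 * \<rho>\<close> G(1) by (intro mult_left_mono power_mono) auto
        finally show ?thesis using \<phi>c[OF t] by (simp add: K_def)
      qed
      then have "integral {0..1} ?f \<le> integral {0..1::real} (\<lambda>_. K)" by (intro integral_le[OF True]) auto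
      then show ?thesis by simp
    next
      case False
      \<comment> \<open>A non-integrable function has integral 0 by convention, which is still at
        most \<open>K\<close>.\<close>
      then have "integral {0..1} ?f = 0" by (rule not_integrable_integral)
      moreover have "0 \<le> K" unfolding K_def using G(1) by simp
      ultimately show ?thesis by simp
    qed
    ultimately show ?thesis using c01 by auto
  qed
  then show ?thesis using V(1,2) by blast
qed

text \<open>Makes the set of lengths bounded below, as its infimum requires. A non-integrable speed
  contributes the default value 0.\<close>

lemma joined_by_length_nonneg:
  assumes g: "riemannian_metric I D \<phi> g"
    and "joined_by_length (lift_index C q I D) snd (\<lambda>(i, V). \<phi> i \<circ> q) (\<lambda>(i, V). g i) x y l"
  shows "0 \<le> l"
  using assms(2)
proof (induction rule: joined_by_length.induct)
  case (arc iV c u')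
  obtain i V where iV: "iV = (i, V)" "i \<in> I" "q ` V \<subseteq> D i" using arc(1) by (auto simp: lift_index_def)
  let ?f = "\<lambda>t. sqrt ((\<lambda>(i, V). g i) iV ((\<lambda>(i, V). \<phi> i \<circ> q) iV (c t)) (u' t) (u' t))"
  show ?case
  proof (cases "?f integrable_on {0..1}")
    case True
    have "0 \<le> ?f t" if t: "t \<in> {0..1}" for t
    proof -
      have "q (c t) \<in> D i" using arc(2) iV t by force
      then have "\<phi> i (q (c t)) \<in> \<phi> i ` D i" by blast
      then have "bilinear (g i (\<phi> i (q (c t))))" "\<And>v. v \<noteq> 0 \<Longrightarrow> 0 < g i (\<phi> i (q (c t))) v v"
        using riemannian_metricD(1,2)[OF g iV(2)] by blast+
      then have "0 \<le> g i (\<phi> i (q (c t))) (u' t) (u' t)"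
        by (cases "u' t = 0") (auto simp: bilinear_lzero less_imp_le)
      then show ?thesis by (simp add: iV)
    qed
    then show ?thesis by (rule integral_nonneg[OF True])
  next
    case False then show ?thesis by (simp add: not_integrable_integral)
  qed
qed auto

context lifted_slithering
begin

text \<open>Move the chart domain \<open>V\<close> along with the curve by \<open>\<delta>\<close>.
  Since \<open>q (\<delta> x) = q x\<close>, the coordinate expression of the curve, its velocity
  and the integrand are unchanged.\<close>

lemma joined_by_length_deck:
  fixes \<phi> :: "'i \<Rightarrow> 'a \<Rightarrow> 'e::euclidean_space"
  assumes \<delta>: "deck \<delta>" "deck \<delta>'" and inv: "\<And>x. x \<in> C \<Longrightarrow> \<delta>' (\<delta> x) = x" "\<And>x. x \<in> C \<Longrightarrow> \<delta> (\<delta>' x) = x"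
    and "joined_by_length (lift_index C q I D) snd (\<lambda>(i, V). \<phi> i \<circ> q) (\<lambda>(i, V). g i) x y l"
  shows "joined_by_length (lift_index C q I D) snd (\<lambda>(i, V). \<phi> i \<circ> q) (\<lambda>(i, V). g i) (\<delta> x) (\<delta> y) l"
  using assms(5)
proof (induction rule: joined_by_length.induct)
  case (arc iV c u')
  obtain i V where iV: "iV = (i, V)" "i \<in> I" "q ` V \<subseteq> D i" "openin (top_of_set C) V" "inj_on q V"
    using arc(1) by (auto simp: lift_index_def)
  have VC: "V \<subseteq> C" using iV(4) openin_imp_subset by blast
  have q\<delta>: "q (\<delta> v) = q v" if "v \<in> V" for v using \<delta> VC that by (auto simp: deck_def)
  have "\<delta> ` V = C \<inter> \<delta>' -` V"
  proof (intro equalityI subsetI)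
    fix z assume "z \<in> C \<inter> \<delta>' -` V"
    then show "z \<in> \<delta> ` V" using inv(2)[of z] by (metis IntD1 IntD2 imageI vimageD)
  next
    fix z assume "z \<in> \<delta> ` V"
    then obtain v where v: "v \<in> V" "z = \<delta> v" by blast
    then have "v \<in> C" using VC by blast
    then show "z \<in> C \<inter> \<delta>' -` V" using v inv(1)[of v] \<delta>(1) by (auto simp: deck_def)
  qed
  moreover have "openin (top_of_set C) (C \<inter> \<delta>' -` V)"
    by (rule openin_preimage[OF _ _ iV(4)]) (use \<delta> in \<open>auto simp: deck_def\<close>)
  ultimately have "openin (top_of_set C) (\<delta> ` V)" by simp
  moreover have "inj_on q (\<delta> ` V)" using iV(5) q\<delta> by (auto simp: inj_on_def)
  moreover have "q ` \<delta> ` V \<subseteq> D i" using iV(3) q\<delta> by auto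
  ultimately have idx: "(i, \<delta> ` V) \<in> lift_index C q I D" using iV(2) by (simp add: lift_index_def)
  have cV: "c t \<in> V" if "t \<in> {0..1}" for t using arc(2) that iV(1) by auto
  have im: "(\<delta> \<circ> c) ` {0..1} \<subseteq> snd (i, \<delta> ` V)" using cV by auto
  have der: "((((\<lambda>(i, V). \<phi> i \<circ> q) (i, \<delta> ` V)) \<circ> (\<delta> \<circ> c)) has_vector_derivative u' t) (at t within {0..1})"
    if t: "t \<in> {0..1}" for t
    by (rule has_vector_derivative_transform[OF t _ arc(3)[OF t]]) (use cV q\<delta> iV(1) in auto)
  have "joined_by_length (lift_index C q I D) snd (\<lambda>(i, V). \<phi> i \<circ> q) (\<lambda>(i, V). g i) ((\<delta> \<circ> c) 0) ((\<delta> \<circ> c) 1)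
     (integral {0..1} (\<lambda>t. sqrt ((\<lambda>(i, V). g i) (i, \<delta> ` V) (((\<lambda>(i, V). \<phi> i \<circ> q) (i, \<delta> ` V)) ((\<delta> \<circ> c) t)) (u' t) (u' t))))"
    by (rule joined_by_length.arc[where I = "lift_index C q I D" and D = snd and \<phi> = "\<lambda>(i, V). \<phi> i \<circ> q" and c = "\<delta> \<circ> c"
          and u' = u', OF idx im _ arc(4)]) (rule der)
  also have "integral {0..1} (\<lambda>t. sqrt ((\<lambda>(i, V). g i) (i, \<delta> ` V) (((\<lambda>(i, V). \<phi> i \<circ> q) (i, \<delta> ` V)) ((\<delta> \<circ> c) t)) (u' t) (u' t)))
      = integral {0..1} (\<lambda>t. sqrt ((\<lambda>(i, V). g i) iV (((\<lambda>(i, V). \<phi> i \<circ> q) iV) (c t)) (u' t) (u' t)))"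
    by (rule integral_cong) (use cV q\<delta> iV(1) in auto)
  finally show ?case by simp
next
  case (join x y l z m)
  then show ?case by (blast intro: joined_by_length.join)
qed

lemma level_bounded_distance:
  fixes \<phi> :: "'i \<Rightarrow> 'a \<Rightarrow> 'e::euclidean_space"
  assumes sm: "smooth_manifold M I D \<phi>" and M: "compact M" and g: "riemannian_metric I D \<phi> g"
  shows "\<exists>B. \<forall>x\<in>C. \<forall>t. \<bar>t - \<theta> x\<bar> \<le> d \<longrightarrow> (\<exists>y\<in>C. \<theta> y = t \<and> lift_dist C q I D \<phi> g x y < B)"
proof -
  let ?R = "joined_by_length (lift_index C q I D) snd (\<lambda>(i, V). \<phi> i \<circ> q) (\<lambda>(i, V). g i)"
  obtain N :: nat where N: "d \<le> 2 * pi * real N"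
    using real_arch_simple[of "d / (2 * pi)"] pi_gt_zero by (auto simp: field_simps)
  have "\<exists>B. \<forall>x\<in>C. \<forall>t. \<bar>t - \<theta> x\<bar> \<le> 2 * pi * real N \<longrightarrow> (\<exists>y\<in>C. \<theta> y = t \<and> (\<exists>l\<le>B. ?R x y l))"
    by (rule uniform_reach[OF M joined_by_length.join joined_by_length_local[OF sm covC g]])
       (auto intro: joined_by_length_deck)
  then obtain B where B: "\<And>x t. x \<in> C \<Longrightarrow> \<bar>t - \<theta> x\<bar> \<le> 2 * pi * real N \<Longrightarrow> \<exists>y\<in>C. \<theta> y = t \<and> (\<exists>l\<le>B. ?R x y l)"
    by blast
  have dist: "lift_dist C q I D \<phi> g x y \<le> l" if "?R x y l" for x y l
    unfolding lift_dist_def riemannian_dist_def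
    by (rule cInf_lower) (use that joined_by_length_nonneg[OF g] in \<open>auto intro!: bdd_belowI[of _ 0]\<close>)
  \<comment> \<open>\<open>B + 1\<close> turns the weak bound into the strict one that
    \<open>uniform_foliation\<close> asks for.\<close>
  have "\<exists>y\<in>C. \<theta> y = t \<and> lift_dist C q I D \<phi> g x y < B + 1" if x: "x \<in> C" and t: "\<bar>t - \<theta> x\<bar> \<le> d" for x t
  proof -
    obtain y l where "y \<in> C" "\<theta> y = t" "l \<le> B" "?R x y l" using B[OF x] t N by (meson order_trans)
    then show ?thesis using dist[of x y l] by (intro bexI[of _ y]) auto
  qed
  then show ?thesis by blast
qed

end

section \<open>The foliation of a slithering\<close>

text \<open>Each point lies in a set of a countable basis on which \<open>p\<close> is injective,
  and distinct points over \<open>x\<close> need distinct sets.\<close>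

lemma countable_covering_fibre:
  fixes E :: "'b::topological_space set"
  assumes cov: "covering_space E p M" and sc: "second_countable (top_of_set E)"
  shows "countable {e \<in> E. p e = x}"
proof -
  obtain \<B> where \<B>: "countable \<B>" "\<And>U e. openin (top_of_set E) U \<Longrightarrow> e \<in> U \<Longrightarrow> \<exists>V\<in>\<B>. e \<in> V \<and> V \<subseteq> U"
    using sc unfolding second_countable_def by metis
  have "\<exists>V\<in>\<B>. e \<in> V \<and> inj_on p V" if e: "e \<in> E" for e
  proof -
    obtain T u k where T: "e \<in> T" "openin (top_of_set E) T" and k: "homeomorphism T u p k"
      using covering_space_local_homeomorphism[OF cov e] by metis
    have "inj_on p T" using homeomorphism_apply1[OF k] by (metis inj_on_inverseI)
    then show ?thesis using \<B>(2)[OF T(2,1)] inj_on_subset by blast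
  qed
  then obtain B where B: "\<And>e. e \<in> E \<Longrightarrow> B e \<in> \<B> \<and> e \<in> B e \<and> inj_on p (B e)" by metis
  have "inj_on B {e \<in> E. p e = x}"
    using B by (intro inj_onI) (metis (mono_tags, lifting) inj_onD mem_Collect_eq)
  moreover have "countable (B ` {e \<in> E. p e = x})"
    by (rule countable_subset[OF _ \<B>(1)]) (use B in auto)
  ultimately show ?thesis by (rule countable_image_inj_on[rotated])
qed

lemma path_connected_function_segments:
  fixes A :: "('i \<Rightarrow> real) set"
  assumes A: "\<And>x y t. x \<in> A \<Longrightarrow> y \<in> A \<Longrightarrow> 0 \<le> t \<Longrightarrow> t \<le> 1 \<Longrightarrow> (\<lambda>i. (1 - t) * x i + t * y i) \<in> A"
  shows "path_connected A"
  unfolding path_connected_def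
proof (intro ballI)
  fix x y assume xy: "x \<in> A" "y \<in> A"
  let ?g = "\<lambda>t i. (1 - t) * x i + t * y i"
  have "path ?g" unfolding path_def
    by (intro continuous_on_coordinatewise_then_product continuous_intros)
  moreover have "path_image ?g \<subseteq> A" unfolding path_image_def using A[OF xy] by auto
  ultimately show "\<exists>g. path g \<and> path_image g \<subseteq> A \<and> pathstart g = x \<and> pathfinish g = y"
    by (intro exI[of _ ?g]) (simp add: pathstart_def pathfinish_def)
qed

lemma convex_comb_bound:
  fixes t :: real
  assumes "\<bar>a - c\<bar> < \<eta>" "\<bar>b - c\<bar> < \<eta>" "0 \<le> t" "t \<le> 1"
  shows "\<bar>(1 - t) * a + t * b - c\<bar> < \<eta>"
  using convexD[OF convex_ball, of a c \<eta> b "1 - t" t] assms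
  by (simp add: dist_real_def abs_minus_commute)

lemma locally_injective_endpoints_neq:
  fixes f :: "real \<Rightarrow> real"
  assumes cont: "continuous_on {0..1} f"
    and inj: "\<And>t. 0 < t \<Longrightarrow> t < 1 \<Longrightarrow> \<exists>\<delta>>0. inj_on f ({t - \<delta><..<t + \<delta>} \<inter> {0<..<1})"
  shows "f 0 \<noteq> f 1"
proof
  assume eq: "f 0 = f 1"
  have no_ext: False if t: "0 < t" "t < 1" and ext: "(\<forall>u\<in>{0..1}. f u \<le> f t) \<or> (\<forall>u\<in>{0..1}. f t \<le> f u)" for t
  proof -
    obtain \<delta> where \<delta>: "\<delta> > 0" "inj_on f ({t - \<delta><..<t + \<delta>} \<inter> {0<..<1})" using inj[OF t] by blast
    define a b where "a = t - min (min t (1 - t)) \<delta> / 2" and "b = t + min (min t (1 - t)) \<delta> / 2"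
    have ab: "a < t" "t < b" "0 < a" "b < 1" "t - \<delta> < a" "b < t + \<delta>"
      using t \<delta> by (auto simp: a_def b_def min_def field_simps)
    have "continuous_on {a..b} f" by (rule continuous_on_subset[OF cont]) (use ab in auto)
    moreover have "inj_on f {a..b}" by (rule inj_on_subset[OF \<delta>(2)]) (use ab in auto)
    ultimately have "f a < f t \<and> f t < f b \<or> f b < f t \<and> f t < f a"
      using continuous_inj_imp_mono[OF ab(1,2)] by blast
    moreover have "a \<in> {0..1}" "b \<in> {0..1}" using ab by auto
    ultimately show False using ext by fastforce
  qed
  obtain m where m: "m \<in> {0..1}" "\<forall>u\<in>{0..1}. f m \<le> f u"
    using continuous_attains_inf[OF compact_Icc _ cont] by auto
  obtain m' where m': "m' \<in> {0..1}" "\<forall>u\<in>{0..1}. f u \<le> f m'"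
    using continuous_attains_sup[OF compact_Icc _ cont] by auto
  have "f m = f 0" using no_ext[of m] m eq by (cases "m = 0 \<or> m = 1") auto
  moreover have "f m' = f 0" using no_ext[of m'] m' eq by (cases "m' = 0 \<or> m' = 1") auto
  moreover have "f m \<le> f (1/2)" using m(2) by simp
  ultimately have "\<forall>u\<in>{0..1}. f u \<le> f (1/2)" using m'(2) by fastforce
  then show False using no_ext[of "1/2"] by simp
qed

locale lifted_slithering_foliation = lifted_slithering M E p s C q r \<theta>
  for M :: "'a::topological_space set" and E :: "'b::topological_space set" and p :: "'b \<Rightarrow> 'a"
    and s :: "'b \<Rightarrow> complex" and C :: "'c::topological_space set" and q :: "'c \<Rightarrow> 'a"
    and r :: "'c \<Rightarrow> 'b" and \<theta> :: "'c \<Rightarrow> real" +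
  fixes n :: nat
  assumes fib: "fibration n 1 E s (sphere 0 1)" and n: "n \<ge> 1"
begin

abbreviation "leaves \<equiv> slithering_foliation E p s (sphere 0 1)"

lemma s_sphere: "e \<in> E \<Longrightarrow> s e \<in> sphere 0 1"
  using fib by (auto simp: fibration_def)

lemma s_continuous: "continuous_on E s"
  using fibration_circle_continuous[OF fib n] .

section \<open>Leaves and images of fibers\<close>

text \<open>A map over \<open>M\<close> that takes \<open>e1\<close> to \<open>e2\<close> carries
  the one fiber into the other and is invisible after \<open>p\<close>. By symmetry, images of
  fibers that meet are equal.\<close>

lemma fiber_image_subset:
  assumes e: "e1 \<in> E" "e2 \<in> E" "p e1 = p e2"
  shows "p ` fiber E s (s e1) \<subseteq> p ` fiber E s (s e2)"
proof
  obtain \<tau> where \<tau>: "\<tau> ` E \<subseteq> E" "\<forall>x\<in>E. p (\<tau> x) = p x" "\<tau> e1 = e2" "\<forall>x\<in>E. \<forall>y\<in>E. s x = s y \<longrightarrow> s (\<tau> x) = s (\<tau> y)"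
    using deckE[OF e] by metis
  fix z assume "z \<in> p ` fiber E s (s e1)"
  then obtain x where x: "x \<in> E" "s x = s e1" "z = p x" by (auto simp: fiber_def)
  have "\<tau> x \<in> E" using \<tau>(1) x(1) by blast
  moreover have "s (\<tau> x) = s e2" using \<tau>(3,4) x(1,2) e(1) by metis
  ultimately have "\<tau> x \<in> fiber E s (s e2)" by (simp add: fiber_def)
  moreover have "p (\<tau> x) = z" using \<tau>(2) x by simp
  ultimately show "z \<in> p ` fiber E s (s e2)" by blast
qed

lemma fiber_image_eq:
  assumes "z \<in> p ` fiber E s y1" "z \<in> p ` fiber E s y2"
  shows "p ` fiber E s y1 = p ` fiber E s y2"
proof -
  obtain e1 e2 where "e1 \<in> E" "s e1 = y1" "e2 \<in> E" "s e2 = y2" "p e1 = p e2"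
    using assms by (auto simp: fiber_def)
  then show ?thesis using fiber_image_subset[of e1 e2] fiber_image_subset[of e2 e1] by auto
qed

lemma mem_fiber_image: "e \<in> E \<Longrightarrow> p e \<in> p ` fiber E s (s e)"
  by (auto simp: fiber_def)

text \<open>Every fiber with the same image contains a point over \<open>p e0\<close>, so all the
  values are already taken on the countable set of points over \<open>p e0\<close>.\<close>

lemma countable_fiber_values: "countable {s e |e. e \<in> E \<and> p e \<in> p ` fiber E s y}"
proof (cases "fiber E s y = {}")
  case False
  then obtain e0 where e0: "e0 \<in> fiber E s y" by blast
  have sc: "second_countable (top_of_set E)" using fib by (simp add: fibration_def topological_manifold_def)
  have "{s e |e. e \<in> E \<and> p e \<in> p ` fiber E s y} \<subseteq> s ` {e \<in> E. p e = p e0}"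
  proof
    fix w assume "w \<in> {s e |e. e \<in> E \<and> p e \<in> p ` fiber E s y}"
    then obtain e where e: "e \<in> E" "p e \<in> p ` fiber E s y" "w = s e" by blast
    have "p ` fiber E s (s e) = p ` fiber E s y" using fiber_image_eq[OF mem_fiber_image[OF e(1)] e(2)] .
    then have "p e0 \<in> p ` fiber E s (s e)" using e0 by blast
    then obtain x where "x \<in> E" "s x = s e" "p x = p e0" by (auto simp: fiber_def)
    then show "w \<in> s ` {e \<in> E. p e = p e0}" using e(3) by (metis (mono_tags, lifting) imageI mem_Collect_eq)
  qed
  then show ?thesis using countable_covering_fibre[OF covE sc] by (meson countable_image countable_subset)
qed auto

text \<open>
  A leaf may be dense, but its preimage in \<open>E\<close> meets only countably many fibers of \<open>s\<close>, and a connected subset of the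
  circle with more than one point is uncountable.
\<close>

lemma constant_on_leaf:
  fixes \<sigma> :: "'x::topological_space \<Rightarrow> 'b"
  assumes X: "connected X" and \<sigma>: "continuous_on X \<sigma>" "\<sigma> ` X \<subseteq> E" "\<And>x. x \<in> X \<Longrightarrow> p (\<sigma> x) \<in> p ` fiber E s y"
    and ab: "a \<in> X" "b \<in> X"
  shows "s (\<sigma> a) = s (\<sigma> b)"
proof (rule ccontr)
  assume ne: "s (\<sigma> a) \<noteq> s (\<sigma> b)"
  have "continuous_on X (\<lambda>x. s (\<sigma> x))" by (rule continuous_on_compose2[OF s_continuous \<sigma>(1,2)])
  then have "connected ((\<lambda>x. s (\<sigma> x)) ` X)" using X by (rule connected_continuous_image)
  then have "uncountable ((\<lambda>x. s (\<sigma> x)) ` X)" using connected_uncountable ne ab by blast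
  moreover have "(\<lambda>x. s (\<sigma> x)) ` X \<subseteq> {s e |e. e \<in> E \<and> p e \<in> p ` fiber E s y}" using \<sigma>(2,3) by blast
  ultimately show False using countable_fiber_values countable_subset by blast
qed

lemma constant_angle_on_leaf:
  fixes \<sigma> :: "'x::topological_space \<Rightarrow> 'c"
  assumes X: "connected X" and \<sigma>: "continuous_on X \<sigma>" "\<sigma> ` X \<subseteq> C" "\<And>x. x \<in> X \<Longrightarrow> q (\<sigma> x) \<in> p ` fiber E s y"
    and ab: "a \<in> X" "b \<in> X"
  shows "\<theta> (\<sigma> a) = \<theta> (\<sigma> b)"
proof -
  have \<sigma>C: "\<sigma> x \<in> C" if "x \<in> X" for x using \<sigma>(2) that by blast
  have c: "continuous_on X (\<lambda>x. r (\<sigma> x))" by (rule continuous_on_compose2[OF r(1) \<sigma>(1,2)])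
  have "s (r (\<sigma> x)) = s (r (\<sigma> b))" if x: "x \<in> X" for x
    by (rule constant_on_leaf[OF X c _ _ x ab(2), of y]) (use r(2,3) \<sigma>C \<sigma>(3) in auto)
  then have cis: "cis (\<theta> (\<sigma> x)) = cis (\<theta> (\<sigma> b))" if x: "x \<in> X" for x
    using \<theta>(2)[OF \<sigma>C[OF x]] \<theta>(2)[OF \<sigma>C[OF ab(2)]] x by simp
  have c': "continuous_on X (\<lambda>x. \<theta> (\<sigma> x))" by (rule continuous_on_compose2[OF \<theta>(1) \<sigma>(1,2)])
  show ?thesis
    by (rule cis_lift_unique[OF X c' continuous_on_const cis ab(2) refl ab(1)])
qed

lemma leafE:
  assumes "L \<in> leaves"
  obtains y where "L \<in> path_components_of (top_of_set (p ` fiber E s y))" "L \<subseteq> p ` fiber E s y" "L \<noteq> {}" "path_connected L"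
proof -
  obtain y where y: "L \<in> path_components_of (top_of_set (p ` fiber E s y))"
    using assms unfolding slithering_foliation_def by blast
  show ?thesis
    using that[OF y] path_components_of_subset[OF y] nonempty_path_components_of[OF y]
      path_connectedin_path_components_of[OF y] by (simp add: path_connectedin_subtopology)
qed

text \<open>The fiber of \<open>A\<close> may differ from the one that defines \<open>L\<close>, but
  their images meet and are therefore equal.\<close>

lemma leaf_maximal:
  assumes L: "L \<in> leaves" and A: "path_connected A" "A \<subseteq> p ` fiber E s y" "A \<inter> L \<noteq> {}"
  shows "A \<subseteq> L"
proof -
  obtain y' where y': "L \<in> path_components_of (top_of_set (p ` fiber E s y'))" "L \<subseteq> p ` fiber E s y'"
    using leafE[OF L] .
  have "p ` fiber E s y = p ` fiber E s y'" using A y' fiber_image_eq by blast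
  then have "path_connectedin (top_of_set (p ` fiber E s y')) A" using A by (simp add: path_connectedin_subtopology)
  then show ?thesis by (rule path_components_of_maximal[OF y'(1)]) (use A(3) in \<open>auto simp: disjnt_def\<close>)
qed

lemma leaf_through:
  assumes x: "x \<in> M"
  obtains L where "L \<in> leaves" "x \<in> L"
proof -
  obtain e where e: "e \<in> E" "x = p e" using x covering_space_imp_surjective[OF covE] by blast
  then have "x \<in> \<Union> (path_components_of (top_of_set (p ` fiber E s (s e))))"
    using mem_fiber_image[OF e(1)] by (simp add: Union_path_components_of)
  then show ?thesis using that s_sphere[OF e(1)] unfolding slithering_foliation_def by blast
qed

lemma leaves_partition: "partition_on M leaves"
proof (rule partition_onI)
  have "L \<subseteq> M" if L: "L \<in> leaves" for L
  proof -
    obtain y where "L \<subseteq> p ` fiber E s y" using leafE[OF L] .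
    then show ?thesis using covering_space_imp_surjective[OF covE] by (auto simp: fiber_def)
  qed
  then show "\<Union> leaves = M" using leaf_through by blast
  show "disjnt L1 L2" if L: "L1 \<in> leaves" "L2 \<in> leaves" "L1 \<noteq> L2" for L1 L2
  proof (rule ccontr)
    assume "\<not> disjnt L1 L2"
    then have ne: "L1 \<inter> L2 \<noteq> {}" "L2 \<inter> L1 \<noteq> {}" by (auto simp: disjnt_def)
    obtain y1 where 1: "L1 \<subseteq> p ` fiber E s y1" "path_connected L1" using leafE[OF L(1)] .
    obtain y2 where 2: "L2 \<subseteq> p ` fiber E s y2" "path_connected L2" using leafE[OF L(2)] .
    have "L1 \<subseteq> L2" by (rule leaf_maximal[OF L(2) 1(2,1) ne(1)])
    moreover have "L2 \<subseteq> L1" by (rule leaf_maximal[OF L(1) 2(2,1) ne(2)])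
    ultimately show False using L(3) by blast
  qed
  show "{} \<notin> leaves" using leafE by blast
qed

text \<open>The chart is the inverse of \<open>p \<circ> \<Psi>\<close>, with \<open>\<Psi>\<close>
  taken inside a set on which \<open>p\<close> is injective. For the plaques,
  \<open>constant_on_leaf\<close> gives one inclusion, and path connectedness of the coordinate
  slices gives the other.\<close>

lemma slithering_chart:
  assumes x: "x \<in> M"
  obtains U \<phi> where "x \<in> U" "foliation_chart n 1 M leaves U \<phi>"
proof -
  obtain e where e: "e \<in> E" "x = p e" using x covering_space_imp_surjective[OF covE] by blast
  obtain T u k where T: "e \<in> T" "openin (top_of_set E) T" and k: "homeomorphism T u p k"
    using covering_space_local_homeomorphism[OF covE e(1)] by metis
  obtain \<Psi> F where \<Psi>: "continuous_on (coord_space n) \<Psi>" "inj_on \<Psi> (coord_space n)" "\<Psi> ` coord_space n \<subseteq> T"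
    "e \<in> \<Psi> ` coord_space n" and s\<Psi>: "\<And>z. z \<in> coord_space n \<Longrightarrow> s (\<Psi> z) = cis (F (z (n - 1)))"
    and F: "\<And>a b. cis (F a) = cis (F b) \<Longrightarrow> a = b"
    and op: "\<And>W. openin (top_of_set (coord_space n)) W \<Longrightarrow> openin (top_of_set E) (\<Psi> ` W)"
    using fibration_circle_chart[OF fib n T] by metis
  have TE: "T \<subseteq> E" using T(2) openin_imp_subset by blast
  have \<Psi>E: "\<Psi> z \<in> E" if "z \<in> coord_space n" for z using \<Psi>(3) TE that by blast
  define \<Lambda> where "\<Lambda> z = p (\<Psi> z)" for z
  define U where "U = \<Lambda> ` coord_space n"
  have injT: "inj_on p T" using homeomorphism_apply1[OF k] by (metis inj_on_inverseI)
  have c\<Lambda>: "continuous_on (coord_space n) \<Lambda>"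
    unfolding \<Lambda>_def by (rule continuous_on_compose2[OF covering_space_imp_continuous[OF covE] \<Psi>(1)]) (use \<Psi>E in blast)
  have i\<Lambda>: "inj_on \<Lambda> (coord_space n)"
  proof -
    have "\<Lambda> = p \<circ> \<Psi>" by (simp add: fun_eq_iff \<Lambda>_def)
    then show ?thesis using comp_inj_on[OF \<Psi>(2) inj_on_subset[OF injT \<Psi>(3)]] by simp
  qed
  have op\<Lambda>: "openin (top_of_set M) (\<Lambda> ` W)" if "openin (top_of_set (coord_space n)) W" for W
    using covering_open_map[OF covE op[OF that]] by (simp add: \<Lambda>_def image_image)
  have U: "openin (top_of_set M) U" unfolding U_def by (rule op\<Lambda>[OF openin_subtopology_self])
  have op\<Lambda>U: "openin (top_of_set U) (\<Lambda> ` W)" if W: "openin (top_of_set (coord_space n)) W" for W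
  proof (rule openin_subset_trans[OF op\<Lambda>[OF W]])
    show "\<Lambda> ` W \<subseteq> U" using W openin_imp_subset unfolding U_def by blast
    show "U \<subseteq> M" using U openin_imp_subset by blast
  qed
  obtain g where g: "homeomorphism (coord_space n) U \<Lambda> g"
    using homeomorphism_injective_open_map[OF c\<Lambda> U_def[symmetric] i\<Lambda> op\<Lambda>U] by blast
  have g': "homeomorphism U (coord_space n) g \<Lambda>" using g by (simp add: homeomorphism_symD)
  have map: "homeomorphic_map (top_of_set U) (Euclidean_space n) g"
    unfolding Euclidean_space_coord_space homeomorphic_map_maps homeomorphic_maps_top_of_set using g' by blast
  have gU: "g z \<in> coord_space n" if "z \<in> U" for z using homeomorphism_image1[OF g'] that by blast
  have \<Lambda>g: "\<Lambda> (g z) = z" if "z \<in> U" for z using homeomorphism_apply1[OF g' that] .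
  have plaque: "\<exists>c. P = {z \<in> U. \<forall>j\<in>{n - 1..<n}. g z j = c j}" if L: "L \<in> leaves" and P: "P \<in> components (L \<inter> U)" for L P
  proof -
    obtain y where y: "L \<subseteq> p ` fiber E s y" using leafE[OF L] .
    have Pc: "connected P" and PLU: "P \<subseteq> L \<inter> U" using P in_components_connected in_components_subset by blast+
    obtain x1 where x1: "x1 \<in> P" using P in_components_nonempty by blast
    define c where "c = g x1 (n - 1)"
    define Q where "Q = {z \<in> U. g z (n - 1) = c}"
    have "P \<subseteq> Q"
    proof
      fix z assume z: "z \<in> P"
      have "continuous_on P (\<lambda>z. \<Psi> (g z))"
        by (rule continuous_on_compose2[OF \<Psi>(1) continuous_on_subset[OF homeomorphism_cont1[OF g']]]) (use PLU gU in auto)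
      then have "s (\<Psi> (g z)) = s (\<Psi> (g x1))"
      proof (rule constant_on_leaf[OF Pc _ _ _ z x1])
        show "(\<lambda>z. \<Psi> (g z)) ` P \<subseteq> E" using PLU gU \<Psi>E by blast
        show "p (\<Psi> (g w)) \<in> p ` fiber E s y" if "w \<in> P" for w
          using \<Lambda>g[of w] that PLU y unfolding \<Lambda>_def by auto
      qed
      then have "g z (n - 1) = c"
        using s\<Psi>[OF gU] z x1 PLU F unfolding c_def by (metis IntD2 subsetD)
      then show "z \<in> Q" using z PLU by (auto simp: Q_def)
    qed
    moreover have "Q \<subseteq> P"
    proof -
      define Z where "Z = {z \<in> coord_space n. z (n - 1) = c}"
      have "path_connected Z"
        by (rule path_connected_function_segments) (auto simp: Z_def coord_space_def algebra_simps)
      moreover have "Q = \<Lambda> ` Z"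
      proof (intro equalityI subsetI)
        fix z assume "z \<in> Q"
        then have "g z \<in> Z" "\<Lambda> (g z) = z" using gU \<Lambda>g by (auto simp: Q_def Z_def)
        then show "z \<in> \<Lambda> ` Z" by (metis imageI)
      next
        fix z assume "z \<in> \<Lambda> ` Z"
        then obtain w where w: "w \<in> coord_space n" "w (n - 1) = c" "z = \<Lambda> w" by (auto simp: Z_def)
        then show "z \<in> Q" using homeomorphism_apply1[OF g w(1)] by (simp add: Q_def U_def)
      qed
      moreover have "continuous_on Z \<Lambda>" by (rule continuous_on_subset[OF c\<Lambda>]) (auto simp: Z_def)
      ultimately have pQ: "path_connected Q" using path_connected_continuous_image by blast
      have "Q \<subseteq> p ` fiber E s (cis (F c))"
      proof
        fix z assume z: "z \<in> Q"
        then have "\<Psi> (g z) \<in> fiber E s (cis (F c))" using gU \<Psi>E s\<Psi> by (auto simp: Q_def fiber_def)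
        moreover have "p (\<Psi> (g z)) = z" using z \<Lambda>g by (simp add: Q_def \<Lambda>_def)
        ultimately show "z \<in> p ` fiber E s (cis (F c))" by (metis imageI)
      qed
      moreover have x1Q: "x1 \<in> Q" using x1 PLU by (auto simp: Q_def c_def)
      ultimately have "Q \<subseteq> L" using leaf_maximal[OF L pQ] x1 PLU by blast
      then have "Q \<subseteq> L \<inter> U" by (auto simp: Q_def)
      then show ?thesis using components_maximal[OF P path_connected_imp_connected[OF pQ]] x1 x1Q by blast
    qed
    ultimately have "P = Q" by blast
    moreover have "{n - 1..<n} = {n - 1}" using n by auto
    ultimately show ?thesis unfolding Q_def by (intro exI[of _ "\<lambda>_. c"]) simp
  qed
  have "foliation_chart n 1 M leaves U g"
    unfolding foliation_chart_def using U map plaque by blast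
  moreover have "x \<in> U" using \<Psi>(4) e(2) unfolding U_def \<Lambda>_def by blast
  ultimately show ?thesis using that by blast
qed

lemma slithering_foliation: "foliation n 1 M leaves"
  unfolding foliation_def
proof (intro conjI ballI leaves_partition)
  show "path_connected L" if "L \<in> leaves" for L using leafE[OF that] .
  show "\<exists>U \<phi>. x \<in> U \<and> foliation_chart n 1 M leaves U \<phi>" if "x \<in> M" for x
    using slithering_chart[OF that] by metis
qed

section \<open>Closed transversals\<close>

text \<open>A closed transversal may use any foliation chart, unrelated to the trivialisations of
  \<open>s\<close>. That the angle determines the transverse coordinate lets injectivity of the
  coordinate along a curve pass to the angle.\<close>

lemma chart_angle_locally_injective:
  assumes chart: "foliation_chart n 1 M leaves U \<phi>" and x0: "x0 \<in> C" "q x0 \<in> U"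
  obtains W where "openin (top_of_set C) W" "x0 \<in> W"
    "\<And>x x'. x \<in> W \<Longrightarrow> x' \<in> W \<Longrightarrow> \<theta> x = \<theta> x' \<Longrightarrow> \<phi> (q x) (n - 1) = \<phi> (q x') (n - 1)"
proof -
  have U: "openin (top_of_set M) U" and UM: "U \<subseteq> M"
    using chart openin_imp_subset unfolding foliation_chart_def by blast+
  have plaques: "\<exists>c. P = {z \<in> U. \<forall>j\<in>{n - 1..<n}. \<phi> z j = c j}" if "L \<in> leaves" "P \<in> components (L \<inter> U)" for L P
    using chart that unfolding foliation_chart_def by blast
  have "homeomorphic_map (top_of_set U) (top_of_set (coord_space n)) \<phi>"
    using chart unfolding foliation_chart_def Euclidean_space_coord_space by blast
  then obtain \<psi> where \<psi>: "homeomorphism U (coord_space n) \<phi> \<psi>"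
    unfolding homeomorphic_map_maps homeomorphic_maps_top_of_set by blast
  have \<psi>U: "\<psi> z \<in> U" if "z \<in> coord_space n" for z using homeomorphism_image2[OF \<psi>] that by blast
  have \<phi>\<psi>: "\<phi> (\<psi> z) = z" if "z \<in> coord_space n" for z using homeomorphism_apply2[OF \<psi> that] .
  have \<psi>\<phi>: "\<psi> (\<phi> z) = z" if "z \<in> U" for z using homeomorphism_apply1[OF \<psi> that] .
  obtain V u k where V: "x0 \<in> V" "openin (top_of_set C) V" and u: "openin (top_of_set M) u"
    and k: "homeomorphism V u q k"
    using covering_space_local_homeomorphism[OF covC x0(1)] by metis
  have VC: "V \<subseteq> C" using V(2) openin_imp_subset by blast
  have qx0: "q x0 \<in> u" using V(1) homeomorphism_image1[OF k] by blast
  define \<Omega> where "\<Omega> = coord_space n \<inter> \<psi> -` (u \<inter> U)"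
  have "openin (top_of_set M) (u \<inter> U)" using u U by (rule openin_Int)
  then have "openin (top_of_set U) (u \<inter> U)" by (rule openin_subset_trans) (use UM in auto)
  then have \<Omega>: "openin (top_of_set (coord_space n)) \<Omega>"
    unfolding \<Omega>_def by (intro openin_preimage[OF homeomorphism_cont2[OF \<psi>]]) (use \<psi>U in auto)
  define z0 where "z0 = \<phi> (q x0)"
  have z0S: "z0 \<in> coord_space n" using homeomorphism_image1[OF \<psi>] x0(2) by (auto simp: z0_def)
  then have "z0 \<in> \<Omega>" using \<psi>\<phi>[OF x0(2)] x0(2) qx0 by (simp add: \<Omega>_def z0_def)
  then obtain \<eta> where \<eta>: "\<eta> > 0" "{z \<in> coord_space n. \<forall>i<n. \<bar>z i - z0 i\<bar> < \<eta>} \<subseteq> \<Omega>"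
    by (rule coord_space_box[OF \<Omega>])
  define J where "J = {z0 (n - 1) - \<eta><..<z0 (n - 1) + \<eta>}"
  \<comment> \<open>The part of the box with transverse coordinate in \<open>T\<close>; arbitrary
    open \<open>T\<close> are needed to see that \<open>g\<close> below is an open map.\<close>
  define A where "A T = {z \<in> coord_space n. (\<forall>i<n. \<bar>z i - z0 i\<bar> < \<eta>) \<and> z (n - 1) \<in> T}" for T
  have A\<Omega>: "A T \<subseteq> \<Omega>" for T using \<eta>(2) by (auto simp: A_def)
  have openA: "openin (top_of_set (coord_space n)) (A T)" if T: "open T" for T
  proof -
    have "open {f. \<forall>i\<in>{..<n}. f (id i) \<in> ball (z0 i) \<eta>}"
      by (rule product_topology_basis') auto
    moreover have "open {f. \<forall>i\<in>{n - 1}. f (id i) \<in> T}"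
      by (rule product_topology_basis') (use T in auto)
    ultimately have "open ({f. \<forall>i\<in>{..<n}. f (id i) \<in> ball (z0 i) \<eta>} \<inter> {f. \<forall>i\<in>{n - 1}. f (id i) \<in> T})"
      by (rule open_Int)
    moreover have "A T = coord_space n \<inter> ({f. \<forall>i\<in>{..<n}. f (id i) \<in> ball (z0 i) \<eta>} \<inter> {f. \<forall>i\<in>{n - 1}. f (id i) \<in> T})"
      by (auto simp: A_def dist_real_def abs_minus_commute)
    ultimately show ?thesis by (simp only: openin_open_Int)
  qed
  define \<sigma> where "\<sigma> z = k (\<psi> z)" for z
  have \<sigma>V: "\<sigma> z \<in> V" and q\<sigma>: "q (\<sigma> z) = \<psi> z" if "z \<in> \<Omega>" for z
    using that homeomorphism_image2[OF k] homeomorphism_apply2[OF k] by (auto simp: \<sigma>_def \<Omega>_def)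
  have c\<sigma>: "continuous_on \<Omega> \<sigma>"
    unfolding \<sigma>_def
    by (rule continuous_on_compose2[OF homeomorphism_cont2[OF k] continuous_on_subset[OF homeomorphism_cont2[OF \<psi>]]])
       (auto simp: \<Omega>_def)
  have open\<sigma>: "openin (top_of_set C) (\<sigma> ` A T)" if T: "open T" for T
  proof -
    have "openin (top_of_set U) (\<psi> ` A T)"
      by (rule homeomorphism_imp_open_map[OF homeomorphism_symD[OF \<psi>] openA[OF T]])
    then have "openin (top_of_set M) (\<psi> ` A T)" using U openin_trans by blast
    then have "openin (top_of_set u) (\<psi> ` A T)"
      by (rule openin_subset_trans) (use A\<Omega>[of T] u openin_imp_subset in \<open>auto simp: \<Omega>_def\<close>)
    then have "openin (top_of_set V) (k ` \<psi> ` A T)"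
      by (rule homeomorphism_imp_open_map[OF homeomorphism_symD[OF k]])
    then show ?thesis using V(2) openin_trans by (metis \<sigma>_def image_cong image_image)
  qed
  have const: "\<theta> (\<sigma> z) = \<theta> (\<sigma> z')" if z: "z \<in> A UNIV" "z' \<in> A UNIV" "z (n - 1) = z' (n - 1)" for z z'
  proof -
    \<comment> \<open>The slice of the box at one transverse coordinate is closed under segments,
      and \<open>\<psi>\<close> maps it into a single plaque, hence into one leaf.\<close>
    define X where "X = {w \<in> A UNIV. w (n - 1) = z (n - 1)}"
    have "path_connected X"
    proof (rule path_connected_function_segments)
      fix x y and t :: real assume xy: "x \<in> X" "y \<in> X" and t: "0 \<le> t" "t \<le> 1"
      have "\<bar>(1 - t) * x i + t * y i - z0 i\<bar> < \<eta>" if "i < n" for i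
        by (rule convex_comb_bound[OF _ _ t]) (use xy that in \<open>auto simp: X_def A_def\<close>)
      moreover have "(1 - t) * x (n - 1) + t * y (n - 1) = z (n - 1)"
        using xy by (simp add: X_def algebra_simps)
      moreover have "(\<lambda>i. (1 - t) * x i + t * y i) \<in> coord_space n"
        using xy by (simp add: X_def A_def coord_space_def)
      ultimately show "(\<lambda>i. (1 - t) * x i + t * y i) \<in> X" by (simp add: X_def A_def)
    qed
    then have conX: "connected X" by (rule path_connected_imp_connected)
    have zS: "z \<in> coord_space n" using z by (simp add: A_def)
    have XS: "X \<subseteq> coord_space n" "X \<subseteq> \<Omega>" using A\<Omega> by (auto simp: X_def A_def)
    obtain L where L: "L \<in> leaves" "\<psi> z \<in> L" using leaf_through \<psi>U[OF zS] UM by blast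
    obtain y where y: "L \<subseteq> p ` fiber E s y" using leafE[OF L(1)] .
    have "\<psi> z \<in> L \<inter> U" using L \<psi>U[OF zS] by blast
    then obtain P where P: "P \<in> components (L \<inter> U)" "\<psi> z \<in> P" by (metis UnionE Union_components)
    obtain c where c: "P = {x \<in> U. \<forall>j\<in>{n - 1..<n}. \<phi> x j = c j}" using plaques[OF L(1) P(1)] by blast
    have n1: "{n - 1..<n} = {n - 1}" using n by auto
    have PL: "P \<subseteq> L" using in_components_subset[OF P(1)] by blast
    have "\<psi> w \<in> L" if w: "w \<in> X" for w
    proof -
      have "w \<in> coord_space n" using w XS by blast
      then have "\<psi> w \<in> P" using w P(2) \<phi>\<psi>[of w] \<phi>\<psi>[OF zS] \<psi>U[of w] unfolding c n1 by (simp add: X_def)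
      then show ?thesis using PL by blast
    qed
    then have qX: "q (\<sigma> w) \<in> p ` fiber E s y" if "w \<in> X" for w using q\<sigma>[OF subsetD[OF XS(2) that]] that y by auto
    show ?thesis
      by (rule constant_angle_on_leaf[OF conX continuous_on_subset[OF c\<sigma> XS(2)] _ qX])
         (use z XS \<sigma>V VC in \<open>auto simp: X_def\<close>)
  qed
  \<comment> \<open>\<open>\<theta>\<close> is a function \<open>g\<close> of the transverse coordinate; \<open>g\<close> is open because \<open>\<theta>\<close> is, hence injective\<close>
  define g where "g c = \<theta> (\<sigma> (z0(n - 1 := c)))" for c
  have zJ: "z0(n - 1 := c) \<in> A UNIV" if "c \<in> J" for c
    using that z0S n \<eta>(1) by (auto simp: A_def J_def coord_space_def abs_less_iff)
  have \<theta>g: "\<theta> (\<sigma> z) = g (z (n - 1))" and memJ: "z (n - 1) \<in> J" if "z \<in> A UNIV" for z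
  proof -
    have "\<bar>z (n - 1) - z0 (n - 1)\<bar> < \<eta>" using that n by (auto simp: A_def)
    then show J: "z (n - 1) \<in> J" by (auto simp: J_def abs_less_iff)
    show "\<theta> (\<sigma> z) = g (z (n - 1))" unfolding g_def by (rule const[OF that zJ[OF J]]) simp
  qed
  have contg: "continuous_on J g"
  proof -
    have 1: "continuous_on J (\<lambda>c. z0(n - 1 := c))"
    proof (rule continuous_on_coordinatewise_then_product)
      fix i show "continuous_on J (\<lambda>c. (z0(n - 1 := c)) i)"
        by (cases "i = n - 1") (auto intro: continuous_intros)
    qed
    have "continuous_on J (\<lambda>c. \<sigma> (z0(n - 1 := c)))"
      by (rule continuous_on_compose2[OF c\<sigma> 1]) (use zJ A\<Omega> in blast)
    then show ?thesis unfolding g_def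
      by (rule continuous_on_compose2[OF \<theta>(1)]) (use zJ A\<Omega> \<sigma>V VC in blast)
  qed
  have "open (g ` T)" if T: "open T" "T \<subseteq> J" for T
  proof -
    have "g ` T = \<theta> ` \<sigma> ` A T"
    proof (intro equalityI subsetI)
      fix v assume "v \<in> g ` T"
      then obtain c where c: "c \<in> T" "v = g c" by blast
      have "z0(n - 1 := c) \<in> A UNIV" using zJ c(1) T(2) by blast
      then have "z0(n - 1 := c) \<in> A T" using c(1) unfolding A_def by simp
      then show "v \<in> \<theta> ` \<sigma> ` A T" using c unfolding g_def by blast
    next
      fix v assume "v \<in> \<theta> ` \<sigma> ` A T"
      then obtain z where z: "z \<in> A T" "v = \<theta> (\<sigma> z)" by blast
      then have "z \<in> A UNIV" "z (n - 1) \<in> T" by (auto simp: A_def)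
      then show "v \<in> g ` T" using \<theta>g z(2) by blast
    qed
    then show ?thesis using squeezable_open[OF squeezableC open\<sigma>[OF T(1)]] by simp
  qed
  moreover have "is_interval J" unfolding J_def by (simp add: is_interval_1)
  ultimately have injg: "inj_on g J" using injective_eq_1d_open_map_UNIV[OF contg] by blast
  show ?thesis
  proof (rule that[of "\<sigma> ` A UNIV"])
    show "openin (top_of_set C) (\<sigma> ` A UNIV)" by (rule open\<sigma>) simp
    have "\<sigma> z0 = x0" using homeomorphism_apply1[OF k V(1)] \<psi>\<phi>[OF x0(2)] by (simp add: \<sigma>_def z0_def)
    moreover have "z0 \<in> A UNIV" using z0S \<eta>(1) by (simp add: A_def)
    ultimately show "x0 \<in> \<sigma> ` A UNIV" by (metis imageI)
    fix x x' assume "x \<in> \<sigma> ` A UNIV" "x' \<in> \<sigma> ` A UNIV" and eq: "\<theta> x = \<theta> x'"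
    then obtain z z' where z: "z \<in> A UNIV" "x = \<sigma> z" "z' \<in> A UNIV" "x' = \<sigma> z'" by blast
    then have "g (z (n - 1)) = g (z' (n - 1))" using \<theta>g eq by simp
    then have "z (n - 1) = z' (n - 1)" using injg memJ z by (metis inj_onD)
    moreover have "\<phi> (q x) = z" "\<phi> (q x') = z'"
      using z q\<sigma> A\<Omega>[of UNIV] \<phi>\<psi> by (auto simp: \<Omega>_def subset_iff)
    ultimately show "\<phi> (q x) (n - 1) = \<phi> (q x') (n - 1)" by simp
  qed
qed

text \<open>The lift of the loop would be closed, so the angle along it would have equal end values,
  although it is locally injective in between.\<close>

lemma closed_transversal_not_null_homotopic:
  assumes trans: "closed_transversal n M leaves \<gamma>"
  shows "\<not> homotopic_loops M \<gamma> (\<lambda>_. a)"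
proof
  assume hom: "homotopic_loops M \<gamma> (\<lambda>_. a)"
  have \<gamma>: "path \<gamma>" "path_image \<gamma> \<subseteq> M" using trans by (auto simp: closed_transversal_def)
  have "\<gamma> 0 \<in> M" using \<gamma>(2) by (auto simp: path_image_def)
  then have "\<gamma> 0 \<in> q ` C" using covering_space_imp_surjective[OF covC] by simp
  then obtain x where x: "x \<in> C" "q x = \<gamma> 0" by force
  have "0 \<in> {0..1 :: real}" by simp
  then obtain \<beta> where \<beta>: "path \<beta>" "path_image \<beta> \<subseteq> C" "\<And>t. t \<in> {0..1} \<Longrightarrow> q (\<beta> t) = \<gamma> t"
    using covering_path_lift[OF covC \<gamma> _ x] by metis
  have closed: "\<beta> 0 = \<beta> 1" by (rule null_homotopic_lift_closed[OF covC hom \<beta>])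
  have \<beta>C: "\<beta> t \<in> C" if "t \<in> {0..1}" for t using \<beta>(2) that by (auto simp: path_image_def)
  have "\<theta> (\<beta> 0) \<noteq> \<theta> (\<beta> 1)"
  proof (rule locally_injective_endpoints_neq[of "\<lambda>t. \<theta> (\<beta> t)"])
    show "continuous_on {0..1} (\<lambda>t. \<theta> (\<beta> t))"
      by (rule continuous_on_compose2[OF \<theta>(1)]) (use \<beta> in \<open>auto simp: path_def path_image_def\<close>)
    fix t :: real assume t: "0 < t" "t < 1"
    \<comment> \<open>Away from the base point the periodic extension is the loop itself.\<close>
    have fr: "frac u = u" if "0 < u" "u < 1" for u :: real using that by (simp add: frac_eq)
    obtain U \<phi> \<epsilon> where chart: "foliation_chart n 1 M leaves U \<phi>" and \<epsilon>: "0 < \<epsilon>"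
      and inU: "\<And>u. u \<in> {t-\<epsilon><..<t+\<epsilon>} \<Longrightarrow> \<gamma> (frac u) \<in> U"
      and mono: "strict_mono_on {t-\<epsilon><..<t+\<epsilon>} (\<lambda>u. \<phi> (\<gamma> (frac u)) (n - 1)) \<or>
         strict_antimono_on {t-\<epsilon><..<t+\<epsilon>} (\<lambda>u. \<phi> (\<gamma> (frac u)) (n - 1))"
      using trans unfolding closed_transversal_def by metis
    have inj: "inj_on (\<lambda>u. \<phi> (\<gamma> (frac u)) (n - 1)) {t-\<epsilon><..<t+\<epsilon>}"
      using mono
    proof
      assume "strict_mono_on {t-\<epsilon><..<t+\<epsilon>} (\<lambda>u. \<phi> (\<gamma> (frac u)) (n - 1))"
      then show ?thesis by (rule strict_mono_on_imp_inj_on)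
    next
      assume *: "strict_antimono_on {t-\<epsilon><..<t+\<epsilon>} (\<lambda>u. \<phi> (\<gamma> (frac u)) (n - 1))"
      show ?thesis
        by (rule linorder_inj_onI) (use monotone_onD[OF *] in fastforce)+
    qed
    have "q (\<beta> t) \<in> U" using inU[of t] \<epsilon> \<beta>(3)[of t] fr t by simp
    then obtain W where W: "openin (top_of_set C) W" "\<beta> t \<in> W"
      "\<And>x x'. x \<in> W \<Longrightarrow> x' \<in> W \<Longrightarrow> \<theta> x = \<theta> x' \<Longrightarrow> \<phi> (q x) (n - 1) = \<phi> (q x') (n - 1)"
      using chart_angle_locally_injective[OF chart \<beta>C[of t]] t by auto
    have "openin (top_of_set {0..1}) ({0..1} \<inter> \<beta> -` W)"
      by (rule openin_preimage[OF _ _ W(1)]) (use \<beta> in \<open>auto simp: path_def path_image_def\<close>)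
    then obtain S where S: "open S" "{0..1} \<inter> \<beta> -` W = {0..1} \<inter> S" by (metis openin_open)
    have "t \<in> {0..1} \<inter> \<beta> -` W" using W(2) t by simp
    then have "t \<in> S" unfolding S(2) by simp
    then obtain d where d: "d > 0" "ball t d \<subseteq> S" using S(1) open_contains_ball by blast
    have inW: "\<beta> u \<in> W" if "u \<in> {t - d<..<t + d} \<inter> {0<..<1}" for u
    proof -
      have "u \<in> {0..1} \<inter> S" using that d(2) by (auto simp: dist_real_def subset_iff)
      then show ?thesis using equalityD2[OF S(2)] by blast
    qed
    have "inj_on (\<lambda>t. \<theta> (\<beta> t)) ({t - min d \<epsilon><..<t + min d \<epsilon>} \<inter> {0<..<1})"
    proof (rule inj_onI)
      fix u v assume u: "u \<in> {t - min d \<epsilon><..<t + min d \<epsilon>} \<inter> {0<..<1}"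
        and v: "v \<in> {t - min d \<epsilon><..<t + min d \<epsilon>} \<inter> {0<..<1}" and eq: "\<theta> (\<beta> u) = \<theta> (\<beta> v)"
      have "\<phi> (q (\<beta> u)) (n - 1) = \<phi> (q (\<beta> v)) (n - 1)"
        by (rule W(3)[OF inW inW eq]) (use u v in auto)
      then have "\<phi> (\<gamma> (frac u)) (n - 1) = \<phi> (\<gamma> (frac v)) (n - 1)"
        using \<beta>(3)[of u] \<beta>(3)[of v] fr[of u] fr[of v] u v by simp
      then show "u = v" by (rule inj_onD[OF inj]) (use u v in auto)
    qed
    then show "\<exists>\<delta>>0. inj_on (\<lambda>t. \<theta> (\<beta> t)) ({t - \<delta><..<t + \<delta>} \<inter> {0<..<1})"
      using d(1) \<epsilon> by (intro exI[of _ "min d \<epsilon>"]) auto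
  qed
  then show False using closed by simp
qed

section \<open>Distances between lifted leaves and conclusion\<close>

text \<open>Two inclusions suffice: \<open>L1\<close> lies in one level of \<open>\<theta>\<close>,
  and the whole level through a point of \<open>L2\<close> lies in \<open>L2\<close>, because that
  level is path connected and \<open>q\<close> maps it into the image of one fiber.\<close>

lemma lifted_leaves_bounded_distance:
  fixes \<phi> :: "'i \<Rightarrow> 'a \<Rightarrow> 'e::euclidean_space"
  assumes sm: "smooth_manifold M I D \<phi>" and M: "compact M" and g: "riemannian_metric I D \<phi> g"
    and L: "L1 \<in> lifted_leaves C q leaves" "L2 \<in> lifted_leaves C q leaves"
  shows "\<exists>B. \<forall>x\<in>L1. \<exists>y\<in>L2. lift_dist C q I D \<phi> g x y < B"
proof -
  obtain L where L': "L \<in> leaves" "L1 \<in> path_components_of (top_of_set (C \<inter> q -` L))"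
    using L(1) unfolding lifted_leaves_def by blast
  obtain y where y: "L \<subseteq> p ` fiber E s y" using leafE[OF L'(1)] .
  have L1: "L1 \<subseteq> C \<inter> q -` L" "L1 \<noteq> {}" "path_connected L1"
    using path_components_of_subset[OF L'(2)] nonempty_path_components_of[OF L'(2)]
      path_connectedin_path_components_of[OF L'(2)] by (simp_all add: path_connectedin_subtopology)
  obtain x1 where x1: "x1 \<in> L1" using L1 by blast
  have \<theta>1: "\<theta> x = \<theta> x1" if x: "x \<in> L1" for x
    by (rule constant_angle_on_leaf[OF path_connected_imp_connected[OF L1(3)] continuous_on_id, of y])
       (use L1(1) y x x1 in auto)
  obtain L' where L'': "L' \<in> leaves" "L2 \<in> path_components_of (top_of_set (C \<inter> q -` L'))"
    using L(2) unfolding lifted_leaves_def by blast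
  have L2: "L2 \<subseteq> C \<inter> q -` L'" "L2 \<noteq> {}"
    using path_components_of_subset[OF L''(2)] nonempty_path_components_of[OF L''(2)] by simp_all
  obtain x2 where x2: "x2 \<in> L2" using L2 by blast
  let ?A = "{x \<in> C. \<theta> x = \<theta> x2}"
  have pA: "path_connected ?A" by (rule squeezable_level_path_connected[OF squeezableC \<theta>(1) path_connectedC])
  have "path_connected (q ` ?A)"
    by (rule path_connected_continuous_image[OF continuous_on_subset[OF covering_space_imp_continuous[OF covC]] pA]) auto
  moreover have "q ` ?A \<subseteq> p ` fiber E s (cis (\<theta> x2))"
  proof
    fix z assume "z \<in> q ` ?A"
    then obtain x where x: "x \<in> C" "\<theta> x = \<theta> x2" "z = q x" by blast
    then have "r x \<in> fiber E s (cis (\<theta> x2))" using r(2) \<theta>(2) by (auto simp: fiber_def)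
    then show "z \<in> p ` fiber E s (cis (\<theta> x2))" using r(3)[OF x(1)] x(3) by (metis imageI)
  qed
  moreover have "q ` ?A \<inter> L' \<noteq> {}" using x2 L2 by blast
  ultimately have "q ` ?A \<subseteq> L'" by (rule leaf_maximal[OF L''(1)])
  then have "path_connectedin (top_of_set (C \<inter> q -` L')) ?A"
    using pA by (auto simp: path_connectedin_subtopology)
  then have AL2: "?A \<subseteq> L2"
    by (rule path_components_of_maximal[OF L''(2)]) (use x2 L2 in \<open>auto simp: disjnt_iff\<close>)
  obtain B where B: "\<forall>x\<in>C. \<forall>t. \<bar>t - \<theta> x\<bar> \<le> \<bar>\<theta> x2 - \<theta> x1\<bar> \<longrightarrow>
      (\<exists>y\<in>C. \<theta> y = t \<and> lift_dist C q I D \<phi> g x y < B)"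
    using level_bounded_distance[OF sm M g] by blast
  have "\<exists>y\<in>L2. lift_dist C q I D \<phi> g x y < B" if x: "x \<in> L1" for x
  proof -
    have "x \<in> C" using x L1 by blast
    moreover have "\<bar>\<theta> x2 - \<theta> x\<bar> \<le> \<bar>\<theta> x2 - \<theta> x1\<bar>" using \<theta>1[OF x] by simp
    ultimately obtain y where "y \<in> C" "\<theta> y = \<theta> x2" "lift_dist C q I D \<phi> g x y < B" using B by blast
    then show ?thesis using AL2 by blast
  qed
  then show ?thesis by blast
qed

end

theorem proposition2p5:
  fixes M :: "'a::topological_space set"
    and I :: "'i set" and D :: "'i \<Rightarrow> 'a set" and \<phi> :: "'i \<Rightarrow> 'a \<Rightarrow> 'e::euclidean_space"
    and E :: "'b::topological_space set" and p :: "'b \<Rightarrow> 'a" and s :: "'b \<Rightarrow> complex"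
    and C :: "'c::topological_space set" and q :: "'c \<Rightarrow> 'a"
  assumes "smooth_manifold M I D \<phi>" and "compact M" and "connected M"
    and "slithering DIM('e) 1 M E p s (sphere 0 1)"
    and "universal_covering C q M"
  shows "uniform_foliation M I D \<phi> C q (slithering_foliation E p s (sphere 0 1))"
proof -
  have covE: "covering_space E p M" and fib: "fibration DIM('e) 1 E s (sphere 0 1)"
    and reg: "\<And>x y. x \<in> E \<Longrightarrow> y \<in> E \<Longrightarrow> p x = p y \<Longrightarrow> \<exists>\<tau>\<in>deck_transformations E p. \<tau> x = y"
    and slit: "\<And>\<tau> y. \<tau> \<in> deck_transformations E p \<Longrightarrow> y \<in> sphere 0 1 \<Longrightarrow> \<exists>z\<in>sphere 0 1. \<tau> ` fiber E s y = fiber E s z"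
    using assms(4) unfolding slithering_def regular_covering_def by blast+
  have covC: "covering_space C q M" and simplyC: "simply_connected C"
    using assms(5) unfolding universal_covering_def by blast+
  have DIM: "DIM('e) \<ge> 1" using DIM_positive[where 'a='e] by linarith
  have sE: "s ` E = sphere 0 1" using fib by (simp add: fibration_def)
  have triv: "\<exists>U h h'. openin (top_of_set (sphere 0 1)) U \<and> y \<in> U \<and>
        homeomorphism (E \<inter> s -` U) (U \<times> fiber E s y) h h' \<and> (\<forall>x\<in>E \<inter> s -` U. fst (h x) = s x)"
    if "y \<in> sphere 0 1" for y
    using fib that unfolding fibration_def by blast
  have loc: "\<exists>V. openin (top_of_set C) V \<and> y \<in> V \<and> V \<subseteq> O' \<and> path_connected V"
    if "openin (top_of_set C) O'" "y \<in> O'" for O' y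
    using covering_locally_path_connected[OF assms(1) covC that] .
  have pE: "p ` E = M" and qC: "q ` C = M"
    using covering_space_imp_surjective covE covC by blast+
  \<comment> \<open>The fibration is onto the circle, so \<open>E\<close>, and with it
    \<open>M\<close> and \<open>C\<close>, is nonempty; this provides the base points for the
    lifts.\<close>
  have "(1 :: complex) \<in> s ` E" unfolding sE by simp
  then have "E \<noteq> {}" by blast
  then obtain y0 where y0: "y0 \<in> C" using pE qC by blast
  then obtain e0 where e0: "e0 \<in> E" "p e0 = q y0" using pE qC by (metis imageE imageI)
  obtain r where r: "continuous_on C r" "r ` C \<subseteq> E" "\<And>x. x \<in> C \<Longrightarrow> p (r x) = q x" "r y0 = e0"
    using covering_lift[OF covE simplyC loc covering_space_imp_continuous[OF covC] _ y0 e0] qC by blast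
  have sr: "continuous_on C (\<lambda>x. s (r x))"
    by (rule continuous_on_compose2[OF fibration_circle_continuous[OF fib DIM] r(1,2)])
  have norm_sr: "norm (s (r x)) = 1" if "x \<in> C" for x
    using r(2) that sE by (metis dist_0_norm imageI mem_sphere subsetD)
  then have sr0: "(\<lambda>x. s (r x)) ` C \<subseteq> - {0}" by force
  obtain w0 where w0: "exp w0 = s (r y0)"
    using norm_sr[OF y0] exp_Ln by (metis norm_zero zero_neq_one)
  obtain l where l: "continuous_on C l" "\<And>x. x \<in> C \<Longrightarrow> exp (l x) = s (r x)"
    using covering_lift[OF covering_space_exp_punctured_plane simplyC loc sr sr0 y0 UNIV_I w0] by metis
  \<comment> \<open>The angle is the imaginary part of a continuous logarithm of
    \<open>s (r x)\<close>, whose real part vanishes because \<open>s\<close> takes values in the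
    unit circle.\<close>
  define \<theta> where "\<theta> x = Im (l x)" for x
  have \<theta>: "s (r x) = cis (\<theta> x)" if "x \<in> C" for x
  proof -
    have "exp (Re (l x)) = 1" using l(2)[OF that] norm_sr[OF that] by (metis norm_exp_eq_Re)
    then show ?thesis using l(2)[OF that] by (simp add: \<theta>_def exp_eq_polar)
  qed
  have contT: "continuous_on C \<theta>" unfolding \<theta>_def using l(1) by (intro continuous_intros)
  \<comment> \<open>A deck transformation sends a whole fiber onto one fiber, so points with equal
    values of \<open>s\<close> keep equal values.\<close>
  have deck: "\<exists>\<tau>. continuous_on E \<tau> \<and> \<tau> ` E \<subseteq> E \<and> (\<forall>x\<in>E. p (\<tau> x) = p x) \<and> \<tau> e = e' \<and>
      (\<forall>x\<in>E. \<forall>y\<in>E. s x = s y \<longrightarrow> s (\<tau> x) = s (\<tau> y))"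
    if e: "e \<in> E" "e' \<in> E" "p e = p e'" for e e'
  proof -
    obtain \<tau> where \<tau>: "\<tau> \<in> deck_transformations E p" "\<tau> e = e'" using reg[OF e] by blast
    then obtain \<tau>' where \<tau>': "homeomorphism E E \<tau> \<tau>'" and p\<tau>: "\<forall>x\<in>E. p (\<tau> x) = p x"
      unfolding deck_transformations_def by blast
    have "s (\<tau> x) = s (\<tau> y)" if xy: "x \<in> E" "y \<in> E" "s x = s y" for x y
    proof -
      have "s x \<in> sphere 0 1" using xy sE by blast
      then obtain z where z: "\<tau> ` fiber E s (s x) = fiber E s z" using slit[OF \<tau>(1)] by blast
      have "\<tau> x \<in> fiber E s z" "\<tau> y \<in> fiber E s z" using xy unfolding z[symmetric] by (auto simp: fiber_def)
      then show ?thesis by (simp add: fiber_def)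
    qed
    then show ?thesis
      using homeomorphism_cont1[OF \<tau>'] homeomorphism_image1[OF \<tau>'] p\<tau> \<tau>(2) by blast
  qed
  interpret lifted_slithering_foliation M E p s C q r \<theta> "DIM('e)"
    by unfold_locales (use covE covC simplyC y0 loc r \<theta> contT triv deck fib DIM in auto)
  show ?thesis
    unfolding uniform_foliation_def
    using slithering_foliation closed_transversal_not_null_homotopic
      lifted_leaves_bounded_distance[OF assms(1,2)] by blast
qed

end
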